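(* Let $\nu$ be a Borel probability measure on the unit circle $\mathbb{T}$ and let $\theta_1,\theta_2,\ldots$ be independent random angles such that each $e^{i\theta_j}$ has law $\nu$. Let $P=P(d)$ be a family of particles with $\operatorname{diam}(P)=d$, and with $\operatorname{lcap}(P)\asymp d^2$ as $d\to 0$. For each $d$ let $P_1=P_2=\cdots=P$. Fix $T\in(0,\infty)$, and let $\Phi$ denote the solution, evaluated at time $T$, of the Loewner--Kufarev equation driven by the time-independent family $\{\nu_t\}_{t\ge 0}=\{\nu\}_{t\geq 0}$, i.e. $\Phi=f_T$ where $$\partial_t f_t(z)=z f_t'(z)\int_{\mathbb{T}}\frac{z+\zeta}{z-\zeta}\,\mathrm{d}\nu(\zeta),\qquad f_0(z)=z,\quad z\in D_0 .$$ Set $n=\lfloor \operatorname{lcap}(P)^{-1}T\rfloor$ and define the conformal map $$\Phi_n=f_{P_1}^{\theta_1}\circ\cdots\circ f_{P_n}^{\theta_n}.$$ Then, almost surely, $\Phi_n$ converges to $\Phi$ uniformly on compact subsets of $D_0$ as $d\to 0$.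
   Context: $D_0=\{z\in\mathbb{C}_\infty:|z|>1\}$ is the exterior unit disk in the Riemann sphere and $K_0=\mathbb{C}\setminus D_0$ is the closed unit disk. A particle is a set $P=D_1^c\setminus K_0$, where $D_1\subset D_0$ is a simply connected domain (containing $\infty$), such that $P$ has diameter $d\in(0,1]$ and $1\in\overline{P}$. $f_P:D_0\to D_1$ is the unique conformal bijection with $f_P(z)=C(P)z+o(z)$ at infinity for some $C(P)>0$; $\operatorname{cap}(K_0\cup P)=C(P)$ is the logarithmic capacity and $\operatorname{lcap}(P)=\log \operatorname{cap}(K_0\cup P)$. The rotated maps are $f_{P}^{\theta}(z)=e^{i\theta}f_P(e^{-i\theta}z)$. The notation $\operatorname{lcap}(P)\asymp d^2$ means that the ratio is bounded above and below by positive constants as $d\to0$. Solutions of the Loewner--Kufarev equation are decreasing Loewner chains: conformal maps $f_t$ of $D_0$ onto complements of a growing family of compact sets, with $f_t(\infty)=\infty$, $f_t'(\infty)>0$. The same sequence $\theta_1,\theta_2,\ldots$ is used for all $d$. *)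

theory Defs
  imports
    "HOL-Analysis.Analysis"
    "HOL-Library.Landau_Symbols"
    "HOL-Probability.Probability"
begin

section \<open>The Riemann sphere\<close>

datatype riemann_sphere = Fin complex | Infty

text \<open>Stereographic projection onto the unit sphere of complex \<open>\<times>\<close> real, the point at
  infinity being the north pole. It carries the chordal metric over to the Riemann sphere.\<close>

fun stereo :: "riemann_sphere \<Rightarrow> complex \<times> real" where
  "stereo (Fin z) =
     (of_real (2 / (1 + (cmod z)\<^sup>2)) * z, ((cmod z)\<^sup>2 - 1) / (1 + (cmod z)\<^sup>2))"
| "stereo Infty = (0, 1)"

lemma stereo_inject: "stereo p = stereo q \<longleftrightarrow> p = q"
proof -
  have pos: "1 + (cmod z)\<^sup>2 > 0" for z
    by (simp add: add_pos_nonneg)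
  have snd_eq: "snd (stereo (Fin z)) = 1 - 2 / (1 + (cmod z)\<^sup>2)" for z
    using pos[of z] by (simp add: field_simps)
  have inf: "stereo (Fin z) \<noteq> stereo Infty" for z
  proof
    assume "stereo (Fin z) = stereo Infty"
    then have "1 - 2 / (1 + (cmod z)\<^sup>2) = 1"
      using snd_eq[of z] by simp
    then show False
      using pos[of z] by simp
  qed
  have fin: "z = w" if "stereo (Fin z) = stereo (Fin w)" for z w
  proof -
    from that have "2 / (1 + (cmod z)\<^sup>2) = 2 / (1 + (cmod w)\<^sup>2)"
      using snd_eq[of z] snd_eq[of w] by simp
    moreover have "of_real (2 / (1 + (cmod z)\<^sup>2)) * z = of_real (2 / (1 + (cmod w)\<^sup>2)) * w"
      using that by simp
    moreover have "complex_of_real (2 / (1 + (cmod w)\<^sup>2)) \<noteq> 0"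
      using pos[of w] by (metis divide_eq_0_iff less_irrefl of_real_eq_0_iff zero_neq_numeral)
    ultimately show ?thesis
      by (metis mult_left_cancel)
  qed
  show ?thesis
    using inf fin by (cases p; cases q) (auto simp del: stereo.simps, metis+)
qed

instantiation riemann_sphere :: metric_space
begin

definition dist_riemann_sphere :: "riemann_sphere \<Rightarrow> riemann_sphere \<Rightarrow> real" where
  "dist_riemann_sphere p q = dist (stereo p) (stereo q)"

definition uniformity_riemann_sphere :: "(riemann_sphere \<times> riemann_sphere) filter" where
  "uniformity_riemann_sphere = (INF e\<in>{0<..}. principal {(p, q). dist p q < e})"

definition open_riemann_sphere :: "riemann_sphere set \<Rightarrow> bool" where
  "open_riemann_sphere U \<longleftrightarrow> (\<forall>p\<in>U. \<forall>\<^sub>F (p', q) in uniformity. p' = p \<longrightarrow> q \<in> U)"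

instance
proof
  show "dist p q = 0 \<longleftrightarrow> p = q" for p q :: riemann_sphere
    by (simp add: dist_riemann_sphere_def stereo_inject)
  show "dist p q \<le> dist p r + dist q r" for p q r :: riemann_sphere
    unfolding dist_riemann_sphere_def by (rule dist_triangle2)
qed (rule uniformity_riemann_sphere_def open_riemann_sphere_def)+

end

text \<open>The action on the sphere of a planar map that fixes infinity.\<close>

fun sphere_map :: "(complex \<Rightarrow> complex) \<Rightarrow> riemann_sphere \<Rightarrow> riemann_sphere" where
  "sphere_map f (Fin z) = Fin (f z)"
| "sphere_map f Infty = Infty"

definition D0 :: "riemann_sphere set" where
  "D0 = insert Infty (Fin ` {z. 1 < cmod z})"


section \<open>Conformal maps and particles\<close>

definition expansion_at_infinity :: "(complex \<Rightarrow> complex) \<Rightarrow> real \<Rightarrow> bool" where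
  "expansion_at_infinity f C \<longleftrightarrow>
     C > 0 \<and> (\<lambda>z. f z - of_real C * z) \<in> o[at_infinity](\<lambda>z. z)"

text \<open>Conformal bijections of \<open>D0\<close> onto \<open>D\<close> that fix infinity and have positive derivative there.
  Only the values of \<open>f\<close> on the finite part of \<open>D0\<close> matter; holomorphy at infinity (in the
  coordinate 1/z) follows from the expansion by removability of the singularity.\<close>

definition normalized_conformal :: "(complex \<Rightarrow> complex) \<Rightarrow> riemann_sphere set \<Rightarrow> bool" where
  "normalized_conformal f D \<longleftrightarrow>
     f holomorphic_on {z. 1 < cmod z} \<and>
     bij_betw (sphere_map f) D0 D \<and>
     (\<exists>C. expansion_at_infinity f C)"

definition particle :: "complex set \<Rightarrow> bool" where
  "particle P \<longleftrightarrow>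
     (\<exists>D1. D1 \<subseteq> D0 \<and> open D1 \<and> connected D1 \<and> simply_connected D1 \<and> Infty \<in> D1 \<and>
           Fin ` P = - D1 - Fin ` cball 0 1) \<and>
     0 < diameter P \<and> diameter P \<le> 1 \<and>
     1 \<in> closure P"

text \<open>The target \<open>D0 - Fin ` P\<close> is the domain \<open>D1\<close>. Extensionality fixes the irrelevant values
  inside the closed unit disk, so that the map is unique as a HOL function.\<close>

definition particle_map :: "complex set \<Rightarrow> complex \<Rightarrow> complex" where
  "particle_map P =
     (THE f. f \<in> extensional {z. 1 < cmod z} \<and> normalized_conformal f (D0 - Fin ` P))"

text \<open>The capacity of the union of the closed unit disk and \<open>P\<close>.\<close>

definition particle_cap :: "complex set \<Rightarrow> real" where
  "particle_cap P = (THE C. expansion_at_infinity (particle_map P) C)"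

definition lcap :: "complex set \<Rightarrow> real" where
  "lcap P = ln (particle_cap P)"

definition rotated_map :: "real \<Rightarrow> (complex \<Rightarrow> complex) \<Rightarrow> complex \<Rightarrow> complex" where
  "rotated_map \<theta> f z = cis \<theta> * f (cis (- \<theta>) * z)"

text \<open>Sequences are indexed from 1; the map with index \<open>n\<close> is innermost.\<close>

definition cluster_map :: "(nat \<Rightarrow> complex set) \<Rightarrow> (nat \<Rightarrow> real) \<Rightarrow> nat \<Rightarrow> complex \<Rightarrow> complex" where
  "cluster_map P \<theta> n =
     foldr (\<circ>) (map (\<lambda>j. rotated_map (\<theta> j) (particle_map (P j))) [1..<Suc n]) id"


section \<open>The Loewner--Kufarev equation\<close>

text \<open>Decreasing Loewner chains driven by a time-independent measure \<open>\<nu>\<close> on the unit circle.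
  The time derivative at 0 is one-sided.\<close>

definition loewner_kufarev_solution ::
    "complex measure \<Rightarrow> (real \<Rightarrow> complex \<Rightarrow> complex) \<Rightarrow> bool" where
  "loewner_kufarev_solution \<nu> f \<longleftrightarrow>
     (\<exists>K :: real \<Rightarrow> complex set.
        mono_on {0..} K \<and>
        (\<forall>t\<ge>0. compact (K t) \<and> normalized_conformal (f t) (- Fin ` K t))) \<and>
     (\<forall>z. 1 < cmod z \<longrightarrow> f 0 z = z) \<and>
     (\<forall>t\<ge>0. \<forall>z. 1 < cmod z \<longrightarrow>
        ((\<lambda>s. f s z) has_vector_derivative
           z * deriv (f t) z * (\<integral>\<zeta>. (z + \<zeta>) / (z - \<zeta>) \<partial>\<nu>)) (at t within {0..}))"

end

theory Submission
  imports Defs "HOL-Complex_Analysis.Complex_Analysis"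
begin

text \<open>The proof works in the coordinate \<open>x = 1/z\<close> at infinity, where \<open>D0\<close> is the unit disk and every
map in sight is a self-map of the disk that fixes 0 and is bounded by 1. The particle map becomes
\<open>\<phi>(x) = x exp (-h(x))\<close>, its rotation by \<open>\<theta>\<close> becomes \<open>x exp (-h(\<zeta> x))\<close> with \<open>\<zeta> = cis \<theta>\<close>, and the
Loewner--Kufarev equation becomes \<open>\<partial>\<^sub>t F = - x F' q\<close>, where \<open>q(x)\<close> is the integral of
\<open>k\<^sub>\<zeta>(x) = (1 + \<zeta> x) / (1 - \<zeta> x)\<close> against \<open>\<nu>\<close>. Write \<open>c = lcap P\<close>.

A small particle at 1 acts like a point source: \<open>h(x) = c (1 + x) / (1 - x) + O(c d)\<close> uniformly on
smaller disks (\<open>slit_map_estimate\<close>). By the Herglotz formula, \<open>h\<close> is an average of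
\<open>(w + x) / (w - x)\<close> over a circle \<open>|w| = r\<close> close to the unit circle, with weight \<open>Re h(w) \<ge> 0\<close>
of total mass \<open>c\<close>. The weight sits near 1: where it is not negligible, \<open>\<phi>(w)\<close> is within \<open>2 d\<close> of 1,
and \<open>\<phi>(w)\<close> is close to \<open>w\<close> in mean square because the mean square of \<open>h\<close> is at most twice
that of \<open>Re h\<close>, which is at most \<open>O(d) c\<close>.

Now let \<open>\<Phi>\<^sub>n\<close> be the composition of the first \<open>n\<close> rotated maps. Since \<open>\<nu>\<close> does not depend on time, a
time step \<open>c\<close> changes \<open>F\<^sub>t(x)\<close> by about \<open>- c x F' q\<close>, and replacing \<open>x\<close> by the image under the \<open>j\<close>-th
particle map changes \<open>F\<^sub>t\<close> by about \<open>- c x F' k\<^sub>j\<close>. Hence the error between \<open>\<Phi>\<^sub>n\<close> and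
\<open>F\<close> at time \<open>c n\<close> grows in step \<open>j\<close> by \<open>c x F' (k\<^sub>j - q)\<close> up to \<open>O(c\<^sup>2 + c d)\<close>. These terms are not
small one by one, but they average out: with \<open>D\<^sub>j\<close> the sum of \<open>k\<^sub>i - q\<close> over \<open>i \<le> j\<close>, summation by parts moves
the sum onto \<open>D\<^sub>j\<close>, at the price of \<open>c\<close> times the increments of \<open>x F'\<close>, which are again \<open>O(c)\<close>. The total
error is then \<open>O(c + d + c max |D\<^sub>j|)\<close> (\<open>composition_estimate\<close>). All constants
come from \<open>|F| \<le> 1\<close> by Cauchy's estimate.

Probability enters only through the strong law of large numbers for the moments \<open>\<zeta>\<^sub>j\<^sup>k\<close>: on one event of
probability 1, all empirical moments converge to those of \<open>\<nu>\<close>, so that \<open>D\<^sub>j = o(j)\<close> uniformly on smaller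
disks (\<open>herglotz_sum_deviation\<close>). As \<open>c n \<le> T\<close>, the error tends to 0 along every particle size at
once, which is why the exceptional null set is the same for all \<open>d\<close>.\<close>


section \<open>The coordinate at infinity\<close>

text \<open>The chart \<open>x = 1/z\<close> at infinity. It misses only the point 0 of the sphere.\<close>

definition sphere_chart :: "complex \<Rightarrow> riemann_sphere" where
  "sphere_chart y = (if y = 0 then Infty else Fin (inverse y))"

text \<open>The inverse chart, written through the stereographic projection, where its continuity is visible.\<close>

definition chart_coord :: "riemann_sphere \<Rightarrow> complex" where
  "chart_coord p = cnj (fst (stereo p)) / of_real (1 + snd (stereo p))"

text \<open>The map \<open>f\<close> in the coordinate \<open>1/z\<close>; the value at 0 says that \<open>f\<close> fixes infinity.\<close>

definition disk_map :: "(complex \<Rightarrow> complex) \<Rightarrow> complex \<Rightarrow> complex" where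
  "disk_map f x = (if x = 0 then 0 else inverse (f (inverse x)))"

lemma stereo_sphere_chart:
  "stereo (sphere_chart y) =
     (of_real (2 / (1 + (cmod y)\<^sup>2)) * cnj y, (1 - (cmod y)\<^sup>2) / (1 + (cmod y)\<^sup>2))"
proof (cases "y = 0")
  case False
  have pos: "1 + (cmod y)\<^sup>2 > 0" by (simp add: add_pos_nonneg)
  have inv: "inverse y = cnj y / of_real ((cmod y)\<^sup>2)"
    using complex_div_cnj[of 1 y] by (simp add: divide_inverse)
  have cy: "cmod y \<noteq> 0" using False by simp
  have eq: "2 / (1 + (inverse (cmod y))\<^sup>2) = 2 / (1 + (cmod y)\<^sup>2) * (cmod y)\<^sup>2"
    using cy pos by (simp add: field_simps)
  have "of_real (2 / (1 + (cmod (inverse y))\<^sup>2)) * inverse y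
      = of_real (2 / (1 + (cmod y)\<^sup>2) * (cmod y)\<^sup>2) * (cnj y / of_real ((cmod y)\<^sup>2))"
    by (simp only: norm_inverse eq) (simp only: inv)
  also have "\<dots> = of_real (2 / (1 + (cmod y)\<^sup>2)) * cnj y"
    using cy by simp
  finally have 1: "of_real (2 / (1 + (cmod (inverse y))\<^sup>2)) * inverse y
      = of_real (2 / (1 + (cmod y)\<^sup>2)) * cnj y" .
  have 2: "((cmod (inverse y))\<^sup>2 - 1) / (1 + (cmod (inverse y))\<^sup>2) = (1 - (cmod y)\<^sup>2) / (1 + (cmod y)\<^sup>2)"
  proof -
    have "((inverse m)\<^sup>2 - 1) / (1 + (inverse m)\<^sup>2) = (1 - m\<^sup>2) / (1 + m\<^sup>2)" if "m > 0" for m :: real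
      using that by (simp add: divide_simps power_inverse)
    then show ?thesis using cy by (simp add: norm_inverse)
  qed
  show ?thesis
    unfolding sphere_chart_def using False 1 2 by (simp only: if_False stereo.simps)
qed (simp add: sphere_chart_def)

lemma one_plus_cmod_square_neq_0: "1 + (cmod y)\<^sup>2 \<noteq> 0"
  using zero_le_power2[of "cmod y"] by linarith

lemma chart_coord_sphere_chart [simp]: "chart_coord (sphere_chart y) = y"
proof -
  have "1 + (1 - (cmod y)\<^sup>2) / (1 + (cmod y)\<^sup>2) = 2 / (1 + (cmod y)\<^sup>2)"
    using one_plus_cmod_square_neq_0[of y] by (simp add: field_simps)
  then have "chart_coord (sphere_chart y)
      = of_real (2 / (1 + (cmod y)\<^sup>2)) * y / of_real (2 / (1 + (cmod y)\<^sup>2))"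
    by (simp only: chart_coord_def stereo_sphere_chart fst_conv snd_conv complex_cnj_mult
        complex_cnj_complex_of_real complex_cnj_cnj)
  moreover have "of_real (2 / (1 + (cmod y)\<^sup>2)) \<noteq> (0::complex)"
    using one_plus_cmod_square_neq_0[of y] by (metis divide_eq_0_iff of_real_eq_0_iff zero_neq_numeral)
  ultimately show ?thesis by (metis nonzero_mult_div_cancel_left)
qed

lemma inj_sphere_chart: "inj sphere_chart"
  by (metis chart_coord_sphere_chart injI)

lemma continuous_on_iff_stereo:
  fixes f :: "'a::metric_space \<Rightarrow> riemann_sphere"
  shows "continuous_on S f \<longleftrightarrow> continuous_on S (\<lambda>x. stereo (f x))"
  by (simp add: continuous_on_iff dist_riemann_sphere_def)

lemma continuous_on_sphere_chart: "continuous_on S sphere_chart"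
  unfolding continuous_on_iff_stereo stereo_sphere_chart
  by (intro continuous_intros) (auto simp: one_plus_cmod_square_neq_0)

lemma sphere_chart_chart_coord:
  assumes "p \<noteq> Fin 0" shows "sphere_chart (chart_coord p) = p"
proof -
  have "p \<in> range sphere_chart"
  proof (cases p)
    case (Fin z)
    then have "p = sphere_chart (inverse z)" using assms by (simp add: sphere_chart_def)
    then show ?thesis by simp
  next
    case Infty
    then have "p = sphere_chart 0" by (simp add: sphere_chart_def)
    then show ?thesis by simp
  qed
  then show ?thesis by auto
qed

lemma continuous_on_chart_coord: "Fin 0 \<notin> S \<Longrightarrow> continuous_on S chart_coord"
proof -
  assume S: "Fin 0 \<notin> S"
  have *: "1 + snd (stereo p) \<noteq> 0" if "p \<in> S" for p
  proof -
    from that S obtain y where y: "p = sphere_chart y"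
      by (metis sphere_chart_chart_coord)
    have "1 + (1 - (cmod y)\<^sup>2) / (1 + (cmod y)\<^sup>2) = 2 / (1 + (cmod y)\<^sup>2)"
      using one_plus_cmod_square_neq_0[of y] by (simp add: field_simps)
    then show ?thesis unfolding y stereo_sphere_chart
      using one_plus_cmod_square_neq_0[of y] by simp
  qed
  have c: "continuous_on S stereo"
    using continuous_on_iff_stereo[of S "\<lambda>x. x"] by simp
  show ?thesis
    unfolding chart_coord_def
    by (intro continuous_intros c) (use * in \<open>auto simp del: of_real_add simp: \<close>)
qed

lemma D0_eq_chart: "D0 = sphere_chart ` ball 0 1"
proof (intro equalityI subsetI)
  fix p assume p: "p \<in> D0"
  show "p \<in> sphere_chart ` ball 0 1"
  proof (cases p)
    case (Fin z)
    then have "1 < cmod z" using p by (auto simp: D0_def)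
    then have "inverse z \<in> ball 0 1" "p = sphere_chart (inverse z)"
      using Fin by (auto simp: sphere_chart_def norm_inverse inverse_less_1_iff)
    then show ?thesis by blast
  next
    case Infty
    then show ?thesis by (intro image_eqI[of _ _ 0]) (auto simp: sphere_chart_def)
  qed
next
  fix p assume "p \<in> sphere_chart ` ball 0 1"
  then show "p \<in> D0"
    by (auto simp: sphere_chart_def D0_def norm_inverse one_less_inverse_iff split: if_splits)
qed

lemma Fin_0_notin_D0: "Fin 0 \<notin> D0"
  by (auto simp: D0_def)

lemma sphere_map_chart:
  assumes "x \<noteq> 0 \<Longrightarrow> f (inverse x) \<noteq> 0"
  shows "sphere_map f (sphere_chart x) = sphere_chart (disk_map f x)"
  using assms by (auto simp: sphere_chart_def disk_map_def)

lemma expansion_at_infinity_iff: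
  "expansion_at_infinity f C \<longleftrightarrow> C > 0 \<and> ((\<lambda>x. f (inverse x) * x) \<longlongrightarrow> of_real C) (at 0)"
proof -
  have "(\<lambda>z. f z - of_real C * z) \<in> o[at_infinity](\<lambda>z. z) \<longleftrightarrow>
        ((\<lambda>z. (f z - of_real C * z) / z) \<longlongrightarrow> 0) at_infinity"
    using eventually_not_equal_at_infinity[of "0::complex"]
    by (auto intro: smalloI_tendsto dest: smalloD_tendsto)
  also have "\<dots> \<longleftrightarrow> ((\<lambda>z. f z / z - of_real C) \<longlongrightarrow> 0) at_infinity"
    by (intro filterlim_cong refl eventually_mono[OF eventually_not_equal_at_infinity[of 0]])
       (auto simp: field_simps)
  also have "\<dots> \<longleftrightarrow> ((\<lambda>z. f z / z) \<longlongrightarrow> of_real C) at_infinity"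
    by (simp add: LIM_zero_iff)
  also have "\<dots> \<longleftrightarrow> ((\<lambda>x. f (inverse x) * x) \<longlongrightarrow> of_real C) (at 0)"
    by (simp add: at_to_infinity filterlim_filtermap divide_inverse)
  finally show ?thesis by (auto simp: expansion_at_infinity_def)
qed

text \<open>An expansion \<open>C z + o(z)\<close> at infinity is differentiability of the transformed map at 0, with derivative
\<open>1/C\<close>. This makes the transformed map holomorphic at 0 without an appeal to removable singularities.\<close>

lemma expansion_at_infinity_iff_deriv:
  assumes "\<And>z. 1 < cmod z \<Longrightarrow> f z \<noteq> 0"
  shows "expansion_at_infinity f C \<longleftrightarrow>
    C > 0 \<and> (disk_map f has_field_derivative inverse (of_real C)) (at 0)"
proof -
  have ev: "\<forall>\<^sub>F x in at 0. x \<noteq> 0 \<and> f (inverse x) \<noteq> 0"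
    unfolding eventually_at
    by (rule exI[of _ 1]) (auto intro!: assms simp: norm_inverse one_less_inverse_iff)
  have "(disk_map f has_field_derivative inverse (of_real C)) (at 0) \<longleftrightarrow>
     ((\<lambda>x. disk_map f x / x) \<longlongrightarrow> inverse (of_real C)) (at 0)"
    by (simp add: has_field_derivative_iff disk_map_def)
  also have "\<dots> \<longleftrightarrow> ((\<lambda>x. inverse (f (inverse x) * x)) \<longlongrightarrow> inverse (of_real C)) (at 0)"
    by (intro filterlim_cong refl eventually_mono[OF ev]) (auto simp: field_simps disk_map_def)
  also have "C > 0 \<and> \<dots> \<longleftrightarrow> C > 0 \<and> ((\<lambda>x. f (inverse x) * x) \<longlongrightarrow> of_real C) (at 0)"
  proof -
    have "((\<lambda>x. f (inverse x) * x) \<longlongrightarrow> of_real C) (at 0)"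
      if "((\<lambda>x. inverse (f (inverse x) * x)) \<longlongrightarrow> inverse (of_real C)) (at 0)" "C > 0"
      using tendsto_inverse[OF that(1)] that(2) by simp
    moreover have "((\<lambda>x. inverse (f (inverse x) * x)) \<longlongrightarrow> inverse (of_real C)) (at 0)"
      if "((\<lambda>x. f (inverse x) * x) \<longlongrightarrow> of_real C) (at 0)" "C > 0"
      using tendsto_inverse[OF that(1)] that(2) by simp
    ultimately show ?thesis by blast
  qed
  finally show ?thesis by (simp add: expansion_at_infinity_iff)
qed

definition disk_conformal :: "(complex \<Rightarrow> complex) \<Rightarrow> complex set \<Rightarrow> bool" where
  "disk_conformal \<phi> \<Omega> \<longleftrightarrow> \<phi> holomorphic_on ball 0 1 \<and> bij_betw \<phi> (ball 0 1) \<Omega> \<and> \<phi> 0 = 0 \<and>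
     (\<exists>a>0. deriv \<phi> 0 = of_real a)"

lemma normalized_conformal_exterior:
  assumes "normalized_conformal f D" "D \<subseteq> D0" "1 < cmod z"
  shows "1 < cmod (f z)"
proof -
  have "Fin z \<in> D0" using assms by (auto simp: D0_def)
  then have "sphere_map f (Fin z) \<in> D" using assms bij_betwE unfolding normalized_conformal_def by blast
  then show ?thesis using assms(2) by (auto simp: D0_def)
qed

text \<open>Together with \<open>normalized_conformal_of_disk\<close>, this moves all questions about conformal maps of \<open>D0\<close>
to the disk.\<close>

lemma disk_conformal_disk_map:
  assumes f: "normalized_conformal f D" and D: "D \<subseteq> D0"
  shows "disk_conformal (disk_map f) (sphere_chart -` D)"
proof -
  have nz: "f z \<noteq> 0" if "1 < cmod z" for z
    using normalized_conformal_exterior[OF f D that] by auto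
  have inv1: "1 < cmod (inverse x)" if "x \<in> ball 0 1" "x \<noteq> 0" for x
    using that by (simp add: norm_inverse one_less_inverse_iff)
  obtain C where C: "expansion_at_infinity f C"
    using f by (auto simp: normalized_conformal_def)
  have C0: "C > 0" and d0: "(disk_map f has_field_derivative inverse (of_real C)) (at 0)"
    using C expansion_at_infinity_iff_deriv[OF nz] by auto
  have hol: "disk_map f holomorphic_on ball 0 1"
  proof -
    have "(disk_map f) field_differentiable at x" if x: "x \<in> ball 0 1" for x
    proof (cases "x = 0")
      case True
      then show ?thesis using d0 field_differentiable_def by blast
    next
      case False
      have "f holomorphic_on {z. 1 < cmod z}" using f by (simp add: normalized_conformal_def)
      then have "(\<lambda>x. inverse (f (inverse x))) holomorphic_on ball 0 1 - {0}"
        by (intro holomorphic_intros holomorphic_on_compose_gen[of inverse _ f "{z. 1 < cmod z}", unfolded o_def])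
           (use inv1 nz in \<open>force+\<close>)
      then have "disk_map f holomorphic_on ball 0 1 - {0}"
        by (rule holomorphic_transform) (auto simp: disk_map_def)
      then show ?thesis
        by (rule holomorphic_on_imp_differentiable_at) (use x False in auto)
    qed
    then show ?thesis by (simp add: holomorphic_on_def field_differentiable_at_within)
  qed
  have bij: "bij_betw (sphere_map f) D0 D" using f by (simp add: normalized_conformal_def)
  have sm: "sphere_map f (sphere_chart x) = sphere_chart (disk_map f x)" if "x \<in> ball 0 1" for x
    by (rule sphere_map_chart) (use inv1[OF that] nz in auto)
  have "inj_on (disk_map f) (ball 0 1)"
  proof (rule inj_onI)
    fix x y assume xy: "x \<in> ball 0 1" "y \<in> ball 0 1" "disk_map f x = disk_map f y"
    then have "sphere_map f (sphere_chart x) = sphere_map f (sphere_chart y)" by (simp add: sm)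
    moreover have "sphere_chart x \<in> D0" "sphere_chart y \<in> D0" using xy by (auto simp: D0_eq_chart)
    ultimately have "sphere_chart x = sphere_chart y" using bij by (auto simp: bij_betw_def inj_on_def)
    then show "x = y" using inj_sphere_chart by (auto dest: injD)
  qed
  moreover have "disk_map f ` ball 0 1 = sphere_chart -` D"
  proof (intro equalityI subsetI)
    fix y assume "y \<in> disk_map f ` ball 0 1"
    then obtain x where x: "x \<in> ball 0 1" "y = disk_map f x" by auto
    then have "sphere_map f (sphere_chart x) \<in> D" using bij by (auto simp: D0_eq_chart bij_betw_def)
    then show "y \<in> sphere_chart -` D" using sm x by auto
  next
    fix y assume "y \<in> sphere_chart -` D"
    then have "sphere_chart y \<in> sphere_map f ` D0" using bij by (auto simp: bij_betw_def)
    then obtain x where x: "x \<in> ball 0 1" "sphere_chart y = sphere_chart (disk_map f x)"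
      by (auto simp: D0_eq_chart sm)
    then show "y \<in> disk_map f ` ball 0 1" using inj_sphere_chart by (auto dest: injD)
  qed
  ultimately have "bij_betw (disk_map f) (ball 0 1) (sphere_chart -` D)"
    by (simp add: bij_betw_def)
  moreover have "deriv (disk_map f) 0 = of_real (inverse C)" using DERIV_imp_deriv[OF d0] by simp
  ultimately show ?thesis
    using hol C0 unfolding disk_conformal_def
    by (metis disk_map_def positive_imp_inverse_positive)
qed

lemma deriv_disk_map:
  assumes f: "normalized_conformal f D" and D: "D \<subseteq> D0" and C: "expansion_at_infinity f C"
  shows "C > 0" "deriv (disk_map f) 0 = of_real (inverse C)"
proof -
  have nz: "f z \<noteq> 0" if "1 < cmod z" for z
    using normalized_conformal_exterior[OF f D that] by auto
  have C0: "C > 0" and d0: "(disk_map f has_field_derivative inverse (of_real C)) (at 0)"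
    using C expansion_at_infinity_iff_deriv[OF nz] by auto
  show "C > 0" by (rule C0)
  show "deriv (disk_map f) 0 = of_real (inverse C)" using DERIV_imp_deriv[OF d0] by simp
qed

lemma normalized_conformal_of_disk:
  assumes \<phi>: "disk_conformal \<phi> \<Omega>" and \<Omega>: "\<Omega> \<subseteq> ball 0 1"
  shows "normalized_conformal (restrict (disk_map \<phi>) {z. 1 < cmod z}) (sphere_chart ` \<Omega>)"
proof -
  let ?f = "restrict (disk_map \<phi>) {z. 1 < cmod z}"
  have hol: "\<phi> holomorphic_on ball 0 1" and bij: "bij_betw \<phi> (ball 0 1) \<Omega>" and 0: "\<phi> 0 = 0"
    using \<phi> by (auto simp: disk_conformal_def)
  obtain a where a: "a > 0" "deriv \<phi> 0 = of_real a"
    using \<phi> by (auto simp: disk_conformal_def)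
  have nz: "\<phi> x \<noteq> 0" if "x \<in> ball 0 1" "x \<noteq> 0" for x
    using that bij 0 by (metis bij_betw_def centre_in_ball inj_onD less_numeral_extra(1))
  have inv: "inverse z \<in> ball 0 1" if "1 < cmod z" for z
    using that by (simp add: norm_inverse inverse_less_1_iff)
  have holf: "?f holomorphic_on {z. 1 < cmod z}"
  proof -
    have "(\<lambda>z. inverse (\<phi> (inverse z))) holomorphic_on {z. 1 < cmod z}"
      by (intro holomorphic_intros holomorphic_on_compose_gen[of inverse _ \<phi> "ball 0 1", unfolded o_def] hol)
         (use inv nz in force)+
    then show ?thesis by (rule holomorphic_transform) (auto simp: disk_map_def)
  qed
  have dm: "disk_map ?f x = \<phi> x" if "x \<in> ball 0 1" for x
  proof (cases "x = 0")
    case False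
    then have "1 < cmod (inverse x)" using that by (simp add: norm_inverse one_less_inverse_iff)
    then show ?thesis using False by (auto simp: disk_map_def)
  qed (simp add: disk_map_def 0)
  have fnz: "?f z \<noteq> 0" if "1 < cmod z" for z
    using nz[OF inv[OF that]] that by (auto simp: disk_map_def)
  have sm: "sphere_map ?f (sphere_chart x) = sphere_chart (\<phi> x)" if "x \<in> ball 0 1" for x
    using dm[OF that] that
    by (subst sphere_map_chart) (auto intro!: fnz simp del: restrict_apply simp: norm_inverse one_less_inverse_iff)
  have "(\<phi> has_field_derivative of_real a) (at 0)"
    using holomorphic_derivI[OF hol, of 0] a by simp
  then have "(disk_map ?f has_field_derivative of_real a) (at 0)"
    by (rule has_field_derivative_transform_within_open[where S = "ball 0 1"]) (auto simp: dm simp del: restrict_apply)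
  then have exp: "expansion_at_infinity ?f (inverse a)"
    using a(1) by (subst expansion_at_infinity_iff_deriv[OF fnz]) (auto simp del: restrict_apply)
  have "bij_betw (sphere_map ?f) (sphere_chart ` ball 0 1) (sphere_chart ` \<Omega>)"
    unfolding bij_betw_def
  proof
    show "inj_on (sphere_map ?f) (sphere_chart ` ball 0 1)"
      using bij inj_sphere_chart by (auto simp: inj_on_def sm bij_betw_def simp del: restrict_apply dest!: injD)
    have "sphere_map ?f ` sphere_chart ` ball 0 1 = sphere_chart ` \<phi> ` ball 0 1"
      unfolding image_image by (intro image_cong refl sm)
    then show "sphere_map ?f ` sphere_chart ` ball 0 1 = sphere_chart ` \<Omega>"
      using bij by (simp add: bij_betw_def)
  qed
  then show ?thesis using holf exp by (auto simp: normalized_conformal_def D0_eq_chart)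
qed


section \<open>The Riemann map of a particle\<close>

text \<open>Two normalized maps onto the same domain differ by a self-map of the disk that fixes 0. The Schwarz
lemma, used in both directions, shows that their derivatives at 0 have equal modulus; hence the self-map
is a rotation, and as both derivatives are positive it is the identity.\<close>

lemma disk_conformal_unique:
  assumes "disk_conformal \<phi> \<Omega>" "disk_conformal \<psi> \<Omega>" "x \<in> ball 0 1"
  shows "\<phi> x = \<psi> x"
proof -
  have inverse_ex: "\<exists>g. g holomorphic_on \<Omega> \<and> (\<forall>z\<in>ball 0 1. g (\<phi> z) = z) \<and>
      deriv \<phi> 0 * deriv g 0 = 1" if \<phi>: "disk_conformal \<phi> \<Omega>" for \<phi>
  proof -
    have hol: "\<phi> holomorphic_on ball 0 1" and inj: "inj_on \<phi> (ball 0 1)"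
      and im: "\<phi> ` ball 0 1 = \<Omega>" and 0: "\<phi> 0 = 0"
      using \<phi> by (auto simp: disk_conformal_def bij_betw_def)
    obtain g where g: "g holomorphic_on \<phi> ` ball 0 1"
       "\<And>z. z \<in> ball 0 1 \<Longrightarrow> deriv \<phi> z * deriv g (\<phi> z) = 1"
       "\<And>z. z \<in> ball 0 1 \<Longrightarrow> g (\<phi> z) = z"
      using holomorphic_has_inverse[OF hol open_ball inj] by metis
    then show ?thesis using im g(2)[of 0] 0 by (metis centre_in_ball zero_less_one)
  qed
  have op: "open \<Omega>" if \<phi>: "disk_conformal \<phi> \<Omega>" for \<phi>
    using \<phi> open_mapping_thm3[of \<phi> "ball 0 1"] by (auto simp: disk_conformal_def bij_betw_def)
  have schwarz: "cmod (deriv \<psi> 0) \<le> cmod (deriv \<phi> 0)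
     \<and> (cmod (deriv \<psi> 0) = cmod (deriv \<phi> 0) \<longrightarrow> (\<exists>\<alpha>. \<forall>z\<in>ball 0 1. \<psi> z = \<phi> (\<alpha> * z) \<and> cmod \<alpha> = 1 \<and> deriv \<psi> 0 = deriv \<phi> 0 * \<alpha>))"
    if \<phi>: "disk_conformal \<phi> \<Omega>" and \<psi>: "disk_conformal \<psi> \<Omega>" for \<phi> \<psi>
  proof -
    obtain g where g: "g holomorphic_on \<Omega>" "\<And>z. z \<in> ball 0 1 \<Longrightarrow> g (\<phi> z) = z" "deriv \<phi> 0 * deriv g 0 = 1"
      using inverse_ex[OF \<phi>] by blast
    have im: "\<phi> ` ball 0 1 = \<Omega>" "\<psi> ` ball 0 1 = \<Omega>" and 0: "\<phi> 0 = 0" "\<psi> 0 = 0"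
      and hol: "\<psi> holomorphic_on ball 0 1"
      using \<phi> \<psi> by (auto simp: disk_conformal_def bij_betw_def)
    have g1: "g w \<in> ball 0 1 \<and> \<phi> (g w) = w" if "w \<in> \<Omega>" for w
      using that im(1) g(2) by (metis imageE)
    let ?h = "\<lambda>z. g (\<psi> z)"
    have h1: "?h holomorphic_on ball 0 1"
      using holomorphic_on_compose_gen[OF hol g(1)] im by (auto simp: o_def)
    have h2: "?h 0 = 0" using g(2)[of 0] 0 by simp
    have h3: "cmod (?h z) < 1" if "cmod z < 1" for z
      using g1[of "\<psi> z"] im(2) that by auto
    have dh: "deriv ?h 0 = deriv g 0 * deriv \<psi> 0"
    proof -
      have "(g has_field_derivative deriv g (\<psi> 0)) (at (\<psi> 0))"
        by (rule holomorphic_derivI[OF g(1) op[OF \<phi>]]) (use im(2) 0 in \<open>auto intro!: image_eqI[of _ \<psi> 0]\<close>)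
      moreover have "(\<psi> has_field_derivative deriv \<psi> 0) (at 0)"
        by (rule holomorphic_derivI[OF hol open_ball]) auto
      ultimately show ?thesis using DERIV_chain2[of g _ \<psi> 0] DERIV_imp_deriv 0 by metis
    qed
    have nz: "deriv \<phi> 0 \<noteq> 0" using g(3) by auto
    then have dg: "deriv g 0 = inverse (deriv \<phi> 0)" using g(3) by (metis inverse_unique)
    note S = Schwarz_Lemma'[OF h1 h2 h3]
    have "cmod (deriv ?h 0) \<le> 1" using S by blast
    then have "inverse (cmod (deriv \<phi> 0)) * cmod (deriv \<psi> 0) \<le> 1"
      by (simp only: dh dg norm_mult norm_inverse)
    then have le: "cmod (deriv \<psi> 0) \<le> cmod (deriv \<phi> 0)"
      using nz by (simp add: field_simps)
    moreover have "\<exists>\<alpha>. \<forall>z\<in>ball 0 1. \<psi> z = \<phi> (\<alpha> * z) \<and> cmod \<alpha> = 1 \<and> deriv \<psi> 0 = deriv \<phi> 0 * \<alpha>"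
      if "cmod (deriv \<psi> 0) = cmod (deriv \<phi> 0)"
    proof -
      have "cmod (deriv ?h 0) = 1" using nz that by (simp add: dh dg norm_mult norm_inverse)
      then obtain \<alpha> where \<alpha>: "\<And>z. cmod z < 1 \<Longrightarrow> ?h z = \<alpha> * z" "cmod \<alpha> = 1" using S by blast
      have "(?h has_field_derivative \<alpha>) (at 0)"
        by (rule has_field_derivative_transform_within_open[where S = "ball 0 1" and f = "\<lambda>z. \<alpha> * z"])
           (auto intro!: derivative_eq_intros \<alpha>(1)[symmetric])
      then have "deriv ?h 0 = \<alpha>" by (rule DERIV_imp_deriv)
      then have "deriv \<psi> 0 = deriv \<phi> 0 * \<alpha>" using nz by (simp add: dh dg field_simps)
      moreover have "\<psi> z = \<phi> (\<alpha> * z)" if "z \<in> ball 0 1" for z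
        using g1[of "\<psi> z"] im(2) that \<alpha>(1)[of z] by auto
      ultimately show ?thesis using \<alpha>(2) by blast
    qed
    ultimately show ?thesis by blast
  qed
  obtain a b where ab: "a > 0" "b > 0" "deriv \<phi> 0 = of_real a" "deriv \<psi> 0 = of_real b"
    using assms by (auto simp: disk_conformal_def)
  have "a = b" using schwarz[OF assms(1,2)] schwarz[OF assms(2,1)] ab by simp
  then obtain \<alpha> where \<alpha>: "\<And>z. z \<in> ball 0 1 \<Longrightarrow> \<psi> z = \<phi> (\<alpha> * z) \<and> deriv \<psi> 0 = deriv \<phi> 0 * \<alpha>"
    using schwarz[OF assms(1,2)] ab by metis
  then have "\<alpha> = 1" using ab \<open>a = b\<close> \<alpha>[of 0] by simp
  then show ?thesis using \<alpha> assms(3) by simp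
qed

text \<open>A Riemann map, composed with a disk automorphism that moves the base point to 0 and a rotation that
makes the derivative positive.\<close>

lemma disk_conformal_exists:
  assumes "open \<Omega>" "simply_connected \<Omega>" "0 \<in> \<Omega>" "\<Omega> \<subseteq> ball 0 1"
  shows "\<exists>\<phi>. disk_conformal \<phi> \<Omega>"
proof -
  have "\<Omega> \<noteq> {}" "\<Omega> \<noteq> UNIV" using assms by (auto, metis UNIV_I bounded_ball bounded_subset not_bounded_UNIV)
  then obtain F G where FG: "F holomorphic_on \<Omega>" "G holomorphic_on ball 0 1"
    "\<And>z. z \<in> \<Omega> \<Longrightarrow> F z \<in> ball 0 1 \<and> G (F z) = z"
    "\<And>z. z \<in> ball 0 1 \<Longrightarrow> G z \<in> \<Omega> \<and> F (G z) = z"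
    using Riemann_mapping_theorem[of \<Omega>] assms(1,2) by metis
  obtain m k where mk: "m (F 0) = 0" "m holomorphic_on ball 0 1" "m ` ball 0 1 \<subseteq> ball 0 1"
                "k holomorphic_on ball 0 1" "k ` ball 0 1 \<subseteq> ball 0 1"
                "\<And>z. z \<in> ball 0 1 \<Longrightarrow> m (k z) = z"
                "\<And>z. z \<in> ball 0 1 \<Longrightarrow> k (m z) = z"
    using ball_biholomorphism_exists[of "F 0"] FG(3)[OF assms(3)] by metis
  have F0: "F 0 \<in> ball 0 1" "G (F 0) = 0" using FG(3)[OF assms(3)] by auto
  have k0: "k 0 = F 0" using mk(7)[OF F0(1)] mk(1) by simp
  define P where "P = (\<lambda>z. G (k z))"
  have P: "P holomorphic_on ball 0 1"
    unfolding P_def using holomorphic_on_compose_gen[OF mk(4) FG(2) mk(5)] by (simp add: o_def)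
  have P0: "P 0 = 0" by (simp add: P_def k0 F0)
  have inj: "inj_on P (ball 0 1)"
    unfolding P_def using mk FG by (intro inj_onI) (metis image_subset_iff)
  have im: "P ` ball 0 1 = \<Omega>"
  proof (intro equalityI subsetI)
    fix y assume "y \<in> P ` ball 0 1"
    then show "y \<in> \<Omega>" unfolding P_def using mk(5) FG(4) by auto
  next
    fix y assume "y \<in> \<Omega>"
    then have "P (m (F y)) = y" "m (F y) \<in> ball 0 1"
      unfolding P_def using FG(3)[of y] mk(7)[of "F y"] mk(3) by (auto, metis image_subset_iff mem_ball_0)
    then show "y \<in> P ` ball 0 1" by (metis imageI)
  qed
  have dnz: "deriv P 0 \<noteq> 0"
    by (rule holomorphic_injective_imp_regular[OF P open_ball inj]) auto
  define b where "b = cnj (sgn (deriv P 0))"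
  have b: "cmod b = 1" using dnz by (simp add: b_def norm_sgn)
  have ball_b: "(*) b ` ball 0 1 = ball 0 1"
  proof (intro equalityI subsetI)
    fix y assume "y \<in> ball (0::complex) 1"
    then have "y = b * (y / b)" "y / b \<in> ball 0 1" using b by (auto simp: norm_divide)
    then show "y \<in> (*) b ` ball 0 1" by (rule image_eqI)
  qed (auto simp: norm_mult b)
  define Q where "Q = P \<circ> (*) b"
  have "Q holomorphic_on ball 0 1"
    unfolding Q_def by (rule holomorphic_on_compose_gen[OF _ P]) (auto intro!: holomorphic_intros simp: norm_mult b)
  moreover have "bij_betw Q (ball 0 1) \<Omega>"
  proof -
    have "b \<noteq> 0" using b by auto
    then have "bij_betw ((*) b) (ball 0 1) (ball 0 1)"
      using ball_b by (auto simp: bij_betw_def inj_on_def)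
    moreover have "bij_betw P (ball 0 1) \<Omega>" using inj im by (simp add: bij_betw_def)
    ultimately show ?thesis unfolding Q_def by (rule bij_betw_trans)
  qed
  moreover have "Q 0 = 0" by (simp add: Q_def P0)
  moreover have "deriv Q 0 = of_real (cmod (deriv P 0))"
  proof -
    have "(P has_field_derivative deriv P 0) (at (b * 0))"
      using holomorphic_derivI[OF P open_ball, of 0] by simp
    then have "((\<lambda>z. P (b * z)) has_field_derivative deriv P 0 * b) (at 0)"
      by (rule DERIV_chain2) (auto intro!: derivative_eq_intros)
    then have "deriv Q 0 = deriv P 0 * b" unfolding Q_def o_def by (rule DERIV_imp_deriv)
    also have "\<dots> = of_real (cmod (deriv P 0))"
    proof -
      have "deriv P 0 * b = (deriv P 0 * cnj (deriv P 0)) / of_real (cmod (deriv P 0))"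
        by (simp add: b_def sgn_eq)
      also have "\<dots> = of_real ((cmod (deriv P 0))\<^sup>2) / of_real (cmod (deriv P 0))"
        by (metis complex_norm_square of_real_power)
      also have "\<dots> = of_real (cmod (deriv P 0))" using dnz by (simp add: power2_eq_square)
      finally show ?thesis .
    qed
    finally show ?thesis .
  qed
  ultimately show ?thesis using dnz unfolding disk_conformal_def by (metis zero_less_norm_iff)
qed

definition disk_shape :: "complex set \<Rightarrow> complex set" where
  "disk_shape P = ball 0 1 - inverse ` P"

text \<open>Topological properties pass from the complement of the particle in the sphere to the slit disk because
the chart is a homeomorphism away from the point 0 of the sphere.\<close>

lemma particle_chart:
  assumes "particle P"
  shows "D0 - Fin ` P = sphere_chart ` disk_shape P" "P \<subseteq> {z. 1 < cmod z}"
    "open (disk_shape P)" "simply_connected (disk_shape P)" "0 \<in> disk_shape P"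
    "disk_shape P = sphere_chart -` (D0 - Fin ` P)"
proof -
  obtain D where D: "D \<subseteq> D0" "open D" "connected D" "simply_connected D" "Infty \<in> D"
     "Fin ` P = - D - Fin ` cball 0 1"
    using assms unfolding particle_def by (elim conjE exE) (rule that)
  have cD0: "- D0 = Fin ` cball 0 1"
  proof (rule set_eqI)
    fix p show "p \<in> - D0 \<longleftrightarrow> p \<in> Fin ` cball 0 1"
      by (cases p) (auto simp: D0_def image_iff)
  qed
  have D_eq: "D = D0 - Fin ` P" using D(1,6) cD0 by blast
  have PD0: "Fin ` P \<subseteq> D0" using D(6) cD0 by blast
  then show P: "P \<subseteq> {z. 1 < cmod z}" by (auto simp: D0_def)
  have "sphere_chart y \<in> Fin ` P \<longleftrightarrow> y \<in> inverse ` P" for y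
  proof (cases "y = 0")
    case True
    then show ?thesis using P by (auto simp: sphere_chart_def image_iff)
  next
    case False
    then have "sphere_chart y \<in> Fin ` P \<longleftrightarrow> inverse y \<in> P" by (auto simp: sphere_chart_def)
    also have "\<dots> \<longleftrightarrow> y \<in> inverse ` P" by (metis image_iff inverse_inverse_eq)
    finally show ?thesis .
  qed
  then show 1: "disk_shape P = sphere_chart -` (D0 - Fin ` P)"
    using inj_sphere_chart by (auto simp: disk_shape_def D0_eq_chart dest: injD)
  show 2: "D0 - Fin ` P = sphere_chart ` disk_shape P"
    unfolding 1 by (auto simp: D0_eq_chart)
  show "open (disk_shape P)"
    unfolding 1 D_eq[symmetric]
    by (rule open_vimage[OF D(2)]) (rule continuous_on_sphere_chart)
  show "0 \<in> disk_shape P" unfolding 1 D_eq[symmetric] using D(5) by (simp add: sphere_chart_def)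
  have "Fin 0 \<notin> D" using D(1) Fin_0_notin_D0 by auto
  then have "homeomorphism D (disk_shape P) chart_coord sphere_chart"
    unfolding homeomorphism_def
    using 2 D_eq by (auto simp: continuous_on_sphere_chart continuous_on_chart_coord image_image)
  then show "simply_connected (disk_shape P)"
    using D(4) homeomorphic_simply_connected unfolding homeomorphic_def by blast
qed

text \<open>Existence and uniqueness of the normalized map give the definite description its meaning.\<close>

lemma particle_map_conformal:
  assumes "particle P"
  shows "normalized_conformal (particle_map P) (D0 - Fin ` P)"
proof -
  let ?E = "{z::complex. 1 < cmod z}"
  note pc = particle_chart[OF assms]
  obtain \<phi> where \<phi>: "disk_conformal \<phi> (disk_shape P)"
    using disk_conformal_exists[OF pc(3,4,5)] by (auto simp: disk_shape_def)
  have "normalized_conformal (restrict (disk_map \<phi>) ?E) (D0 - Fin ` P)"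
    using normalized_conformal_of_disk[OF \<phi>] pc(1) by (simp add: disk_shape_def)
  then have ex: "restrict (disk_map \<phi>) ?E \<in> extensional ?E \<and> normalized_conformal (restrict (disk_map \<phi>) ?E) (D0 - Fin ` P)"
    by simp
  have "f = g" if "f \<in> extensional ?E \<and> normalized_conformal f (D0 - Fin ` P)"
      "g \<in> extensional ?E \<and> normalized_conformal g (D0 - Fin ` P)" for f g
  proof (rule extensionalityI[of f ?E g])
    fix z assume z: "z \<in> ?E"
    have "disk_map f (inverse z) = disk_map g (inverse z)"
      by (rule disk_conformal_unique[of _ "sphere_chart -` (D0 - Fin ` P)"])
         (use that z in \<open>auto intro!: disk_conformal_disk_map simp: norm_inverse inverse_less_1_iff\<close>)
    then show "f z = g z" using z by (auto simp: disk_map_def split: if_splits)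
  qed (use that in auto)
  then have "\<exists>!f. f \<in> extensional ?E \<and> normalized_conformal f (D0 - Fin ` P)"
    using ex by blast
  then show ?thesis unfolding particle_map_def by (rule theI'[THEN conjunct2])
qed

lemma particle_cap_expansion:
  assumes "particle P"
  shows "expansion_at_infinity (particle_map P) (particle_cap P)"
proof -
  obtain C where C: "expansion_at_infinity (particle_map P) C"
    using particle_map_conformal[OF assms] by (auto simp: normalized_conformal_def)
  have uniq: "C' = C" if "expansion_at_infinity (particle_map P) C'" for C'
  proof -
    have "complex_of_real C' = of_real C"
      by (rule LIM_unique[of "\<lambda>x. particle_map P (inverse x) * x" _ 0])
         (use that C in \<open>auto simp: expansion_at_infinity_iff\<close>)
    then show ?thesis by simp
  qed
  show ?thesis unfolding particle_cap_def by (rule theI[where P = "expansion_at_infinity (particle_map P)" and a = C, OF C uniq])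
qed


section \<open>Circle averages, logarithms and boundary behaviour\<close>

definition circle_avg :: "real \<Rightarrow> (complex \<Rightarrow> 'a::banach) \<Rightarrow> 'a" where
  "circle_avg r g = integral {0..1} (\<lambda>t. g (of_real r * cis (2 * pi * t)))"

lemma circle_avg_integrable:
  fixes g :: "complex \<Rightarrow> 'a::banach"
  assumes "continuous_on (sphere 0 r) g" "0 \<le> r"
  shows "(\<lambda>t. g (of_real r * cis (2 * pi * t))) integrable_on {0..1::real}"
proof (rule integrable_continuous_real)
  show "continuous_on {0..1} (\<lambda>t. g (of_real r * cis (2 * pi * t)))"
    by (rule continuous_on_compose2[OF assms(1)]) (auto intro!: continuous_intros simp: norm_mult assms(2))
qed

lemma circle_avg_add:
  assumes "continuous_on (sphere 0 r) f" "continuous_on (sphere 0 r) g" "0 \<le> r"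
  shows "circle_avg r (\<lambda>w. f w + g w) = circle_avg r f + circle_avg r g"
  unfolding circle_avg_def by (rule integral_add[OF circle_avg_integrable[OF assms(1,3)] circle_avg_integrable[OF assms(2,3)]])

lemma circle_avg_diff:
  assumes "continuous_on (sphere 0 r) f" "continuous_on (sphere 0 r) g" "0 \<le> r"
  shows "circle_avg r (\<lambda>w. f w - g w) = circle_avg r f - circle_avg r g"
  unfolding circle_avg_def by (rule integral_diff[OF circle_avg_integrable[OF assms(1,3)] circle_avg_integrable[OF assms(2,3)]])

lemma circle_avg_linear:
  assumes "bounded_linear L" "continuous_on (sphere 0 r) f" "0 \<le> r"
  shows "circle_avg r (\<lambda>w. L (f w)) = L (circle_avg r f)"
  unfolding circle_avg_def
  using integral_linear[OF circle_avg_integrable[OF assms(2,3)] assms(1)] by (simp add: o_def)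

lemma circle_avg_const: "circle_avg r (\<lambda>w. c) = c"
  by (simp add: circle_avg_def)

lemma circle_avg_cong:
  assumes "\<And>w. w \<in> sphere 0 r \<Longrightarrow> f w = g w" "0 \<le> r"
  shows "circle_avg r f = circle_avg r g"
  unfolding circle_avg_def by (rule integral_cong) (auto intro!: assms(1) simp: norm_mult assms(2))

lemma norm_circle_avg_le:
  assumes "continuous_on (sphere 0 r) f" "continuous_on (sphere 0 r) g" "0 \<le> r"
    "\<And>w. w \<in> sphere 0 r \<Longrightarrow> norm (f w) \<le> g w"
  shows "norm (circle_avg r f) \<le> circle_avg r g"
  unfolding circle_avg_def
  by (rule integral_norm_bound_integral[OF circle_avg_integrable[OF assms(1,3)] circle_avg_integrable[OF assms(2,3)]])
    (auto intro!: assms(4) simp: norm_mult assms(3))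

lemma circle_avg_Cauchy:
  assumes "F holomorphic_on cball 0 r" "cmod x < r"
  shows "circle_avg r (\<lambda>w. F w * w / (w - x)) = F x"
proof -
  have r: "r > 0" using assms(2) by (metis norm_ge_zero order_le_less_trans)
  have "((\<lambda>u. F u / (u - x)) has_contour_integral (2 * of_real pi * \<i> * F x)) (circlepath 0 r)"
    by (rule Cauchy_integral_circlepath_simple[OF assms(1)]) (use assms(2) in simp)
  then have "((\<lambda>t. F (circlepath 0 r t) / (circlepath 0 r t - x) *
       vector_derivative (circlepath 0 r) (at t within {0..1})) has_integral (2 * of_real pi * \<i> * F x)) {0..1}"
    by (simp add: has_contour_integral_def)
  then have "((\<lambda>t. (2 * of_real pi * \<i>) * ((\<lambda>w. F w * w / (w - x)) (of_real r * cis (2 * pi * t))))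
      has_integral (2 * of_real pi * \<i> * F x)) {0..1}"
  proof (rule has_integral_eq[rotated])
    fix t :: real assume t: "t \<in> {0..1}"
    have w: "circlepath 0 r t = of_real r * cis (2 * pi * t)"
      by (simp add: circlepath cis_conv_exp mult_ac)
    have "vector_derivative (circlepath 0 r) (at t within {0..1}) = 2 * of_real pi * \<i> * (of_real r * cis (2 * pi * t))"
      using t by (simp add: vector_derivative_circlepath01 cis_conv_exp mult_ac)
    then show "F (circlepath 0 r t) / (circlepath 0 r t - x) * vector_derivative (circlepath 0 r) (at t within {0..1})
       = (2 * of_real pi * \<i>) * ((\<lambda>w. F w * w / (w - x)) (of_real r * cis (2 * pi * t)))"
      unfolding w by simp
  qed
  from integral_unique[OF this]
  have "(2 * of_real pi * \<i>) * circle_avg r (\<lambda>w. F w * w / (w - x)) = 2 * of_real pi * \<i> * F x"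
    unfolding circle_avg_def integral_mult_right .
  then show ?thesis by simp
qed

lemma circle_avg_mean_value:
  assumes "F holomorphic_on cball 0 r" "0 < r"
  shows "circle_avg r F = F 0"
proof -
  have "circle_avg r F = circle_avg r (\<lambda>w. F w * w / (w - 0))"
    by (rule circle_avg_cong) (use assms in auto)
  also have "\<dots> = F 0" by (rule circle_avg_Cauchy) (use assms in auto)
  finally show ?thesis .
qed

text \<open>Cauchy's formula represents \<open>h(x)\<close> as the average of \<open>h(w) w / (w - x)\<close>. On the circle,
\<open>w / (w - x)\<close> is the conjugate of \<open>r\<^sup>2 / (r\<^sup>2 - cnj x w)\<close>, which is holomorphic on the disk, so the mean
value property evaluates the average of \<open>cnj (h(w)) w / (w - x)\<close> as \<open>h(0)\<close>. Adding the two leaves only the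
real part of \<open>h\<close>.\<close>

lemma Herglotz_formula:
  assumes h: "h holomorphic_on cball 0 r" and x: "cmod x < r" and real: "h 0 \<in> \<real>"
  shows "h x = circle_avg r (\<lambda>w. of_real (Re (h w)) * ((w + x) / (w - x)))"
proof -
  have r: "r > 0" using x by (metis norm_ge_zero order_le_less_trans)
  have nz: "w - x \<noteq> 0" if "w \<in> sphere 0 r" for w :: complex using that x by auto
  have ch: "continuous_on (sphere 0 r) h"
    using holomorphic_on_imp_continuous_on[OF h] by (rule continuous_on_subset) auto
  have nz2: "of_real (r\<^sup>2) - cnj x * w \<noteq> 0" if "w \<in> cball 0 r" for w :: complex
  proof
    assume "of_real (r\<^sup>2) - cnj x * w = 0"
    then have "r\<^sup>2 = cmod x * cmod w" using r
      by (metis abs_power2 complex_mod_cnj norm_mult norm_of_real right_minus_eq)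
    also have "\<dots> \<le> cmod x * r" using that by (intro mult_left_mono) auto
    also have "\<dots> < r * r" using x r by simp
    finally show False by (simp add: power2_eq_square)
  qed
  have 1: "circle_avg r (\<lambda>w. h w * w / (w - x)) = h x" by (rule circle_avg_Cauchy[OF h x])
  have "circle_avg r (\<lambda>w. h w * (of_real (r\<^sup>2) / (of_real (r\<^sup>2) - cnj x * w))) = h 0"
    by (subst circle_avg_mean_value) (use r nz2 in \<open>auto intro!: holomorphic_intros h\<close>)
  then have "cnj (circle_avg r (\<lambda>w. h w * (of_real (r\<^sup>2) / (of_real (r\<^sup>2) - cnj x * w)))) = h 0"
    using real by (simp add: Reals_cnj_iff)
  moreover have "circle_avg r (\<lambda>w. cnj (h w * (of_real (r\<^sup>2) / (of_real (r\<^sup>2) - cnj x * w))))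
     = cnj (circle_avg r (\<lambda>w. h w * (of_real (r\<^sup>2) / (of_real (r\<^sup>2) - cnj x * w))))"
    by (rule circle_avg_linear[OF bounded_linear_cnj])
       (use r nz2 in \<open>force intro!: continuous_intros ch\<close>)+
  moreover have "circle_avg r (\<lambda>w. cnj (h w * (of_real (r\<^sup>2) / (of_real (r\<^sup>2) - cnj x * w))))
     = circle_avg r (\<lambda>w. cnj (h w) * w / (w - x))"
  proof (rule circle_avg_cong)
    fix w :: complex assume w: "w \<in> sphere 0 r"
    then have rw: "of_real (r\<^sup>2) = w * cnj w" using complex_norm_square[of w] by simp
    have "w \<noteq> 0" using w r by (metis norm_zero mem_sphere_0 less_irrefl)
    have "cnj (of_real (r\<^sup>2) / (of_real (r\<^sup>2) - cnj x * w)) = (cnj w * w) / (cnj w * (w - x))"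
      unfolding rw by (simp add: algebra_simps)
    also have "\<dots> = w / (w - x)" using \<open>w \<noteq> 0\<close> by simp
    finally have e: "cnj (of_real (r\<^sup>2) / (of_real (r\<^sup>2) - cnj x * w)) = w / (w - x)" .
    show "cnj (h w * (of_real (r\<^sup>2) / (of_real (r\<^sup>2) - cnj x * w))) = cnj (h w) * w / (w - x)"
      unfolding complex_cnj_mult[of "h w"] e by (rule times_divide_eq_right)
  qed (use r in auto)
  ultimately have 2: "circle_avg r (\<lambda>w. cnj (h w) * w / (w - x)) = h 0" by simp
  have 3: "circle_avg r (\<lambda>w. complex_of_real (Re (h w))) = h 0"
  proof -
    have "bounded_linear (\<lambda>z. complex_of_real (Re z))"
      by (rule bounded_linear_compose[OF bounded_linear_of_real bounded_linear_Re])
    from circle_avg_linear[OF this ch] show ?thesis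
      using circle_avg_mean_value[OF h r] r real by simp
  qed
  have "circle_avg r (\<lambda>w. of_real (Re (h w)) * ((w + x) / (w - x)))
     = circle_avg r (\<lambda>w. (h w * w / (w - x) + cnj (h w) * w / (w - x)) - of_real (Re (h w)))"
  proof (rule circle_avg_cong)
    fix w :: complex assume w: "w \<in> sphere 0 r"
    have "h w * w / (w - x) + cnj (h w) * w / (w - x) = (h w + cnj (h w)) * (w / (w - x))"
      by (simp only: distrib_right add_divide_distrib times_divide_eq_right)
    also have "\<dots> = of_real (Re (h w)) * (2 * w / (w - x))"
      by (simp add: complex_add_cnj)
    also have "\<dots> - of_real (Re (h w)) = of_real (Re (h w)) * ((w + x) / (w - x))"
      using nz[OF w] by (simp add: field_simps)
    finally show "of_real (Re (h w)) * ((w + x) / (w - x))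
       = (h w * w / (w - x) + cnj (h w) * w / (w - x)) - of_real (Re (h w))" ..
  qed (use r in auto)
  also have "\<dots> = (h x + h 0) - h 0"
  proof -
    have c: "continuous_on (sphere 0 r) (\<lambda>w. h w * w / (w - x))"
      "continuous_on (sphere 0 r) (\<lambda>w. cnj (h w) * w / (w - x))"
      "continuous_on (sphere 0 r) (\<lambda>w. complex_of_real (Re (h w)))"
      using nz by (auto intro!: continuous_intros ch)
    show ?thesis
      using circle_avg_diff[OF continuous_on_add[OF c(1,2)] c(3)] circle_avg_add[OF c(1,2)] r 1 2 3 by simp
  qed
  finally show ?thesis by simp
qed

text \<open>The quotient \<open>\<phi>(x) / x\<close> has no zeros because \<open>\<phi>\<close> is injective, and modulus at most 1 by the Schwarz
lemma; \<open>-h\<close> is its logarithm.\<close>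

lemma disk_conformal_log:
  assumes \<phi>: "disk_conformal \<phi> \<Omega>" and \<Omega>: "\<Omega> \<subseteq> ball 0 1" and a: "deriv \<phi> 0 = of_real (exp (- c))"
  shows "\<exists>h. h holomorphic_on ball 0 1 \<and> h 0 = of_real c \<and>
    (\<forall>x\<in>ball 0 1. \<phi> x = x * exp (- h x) \<and> 0 \<le> Re (h x))"
proof -
  have hol: "\<phi> holomorphic_on ball 0 1" and bij: "bij_betw \<phi> (ball 0 1) \<Omega>" and 0: "\<phi> 0 = 0"
    using \<phi> by (auto simp: disk_conformal_def)
  define u where "u = (\<lambda>z. if z = 0 then deriv \<phi> 0 else \<phi> z / z)"
  have u: "u holomorphic_on ball 0 1"
  proof -
    have "u = (\<lambda>z. if z = 0 then deriv \<phi> 0 else (\<phi> z - \<phi> 0) / (z - 0))"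
      by (simp add: u_def fun_eq_iff 0)
    then show ?thesis using pole_lemma_open[OF hol open_ball, of 0] by simp
  qed
  have \<phi>u: "\<phi> x = x * u x" for x by (simp add: u_def 0)
  have nz: "u x \<noteq> 0" if "x \<in> ball 0 1" for x
  proof (cases "x = 0")
    case False
    have "\<phi> x \<noteq> \<phi> 0"
      using that bij False by (metis bij_betw_def centre_in_ball inj_onD less_numeral_extra(1))
    then show ?thesis using 0 False by (simp add: u_def)
  qed (simp add: u_def a)
  obtain g where g: "g holomorphic_on ball 0 1" "\<And>x. x \<in> ball 0 1 \<Longrightarrow> exp (g x) = u x"
    using holomorphic_logarithm_exists[OF convex_ball open_ball u nz, of 0] by auto
  have g0: "exp (g 0) = of_real (exp (- c))" using g(2)[of 0] by (simp add: u_def a)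
  define h where "h = (\<lambda>x. g 0 + of_real c - g x)"
  have hu: "exp (- h x) = u x" if "x \<in> ball 0 1" for x
  proof -
    have "exp (- h x) = exp (g x) / (exp (g 0) * exp (of_real c))"
      by (simp add: h_def exp_diff exp_add)
    also have "exp (g 0) * exp (of_real c) = (1::complex)"
      unfolding g0 exp_of_real of_real_mult[symmetric] by (simp flip: exp_add)
    finally show ?thesis using g(2)[OF that] by simp
  qed
  have less: "cmod (\<phi> z) < 1" if "cmod z < 1" for z
    using bij \<Omega> that by (force simp: bij_betw_def)
  have u1: "cmod (u x) \<le> 1" if "x \<in> ball 0 1" for x
  proof (cases "x = 0")
    case True
    then show ?thesis using Schwarz_Lemma(2)[OF hol 0 less, of 0] by (simp add: u_def)
  next
    case False
    have "cmod (\<phi> x) \<le> cmod x" by (rule Schwarz_Lemma(1)[OF hol 0 less]) (use that in auto)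
    then show ?thesis using False by (simp add: u_def norm_divide)
  qed
  have "0 \<le> Re (h x)" if "x \<in> ball 0 1" for x
    using u1[OF that] unfolding hu[OF that, symmetric] by simp
  moreover have "h holomorphic_on ball 0 1" unfolding h_def by (intro holomorphic_intros g)
  ultimately show ?thesis using hu \<phi>u by (intro exI[of _ h]) (auto simp: h_def)
qed

lemma norm_exp_minus_one_le:
  assumes "0 \<le> Re z"
  shows "cmod (exp (- z) - 1) \<le> cmod z"
proof -
  have "norm (exp (- z) - exp 0) \<le> 1 * norm (- z - 0)"
  proof (rule field_differentiable_bound[where S = "{z. Re z \<le> 0}" and f' = exp])
    show "convex {z. Re z \<le> 0}" by (rule convex_halfspace_Re_le)
  qed (use assms in \<open>auto intro!: DERIV_subset[OF DERIV_exp]\<close>)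
  then show ?thesis by simp
qed

text \<open>The points of the image that stay away from both the unit circle and \<open>S\<close> form a compact set, whose
preimage is compact and so stays away from the unit circle.\<close>

lemma disk_conformal_proper:
  assumes \<phi>: "disk_conformal \<phi> (ball 0 1 - S)" and \<epsilon>: "0 < \<epsilon>"
  shows "\<exists>r0<1. \<forall>w. r0 < cmod w \<and> cmod w < 1 \<longrightarrow> 1 - \<epsilon> < cmod (\<phi> w) \<or> (\<exists>s\<in>S. dist (\<phi> w) s < \<epsilon>)"
proof -
  have hol: "\<phi> holomorphic_on ball 0 1" and inj: "inj_on \<phi> (ball 0 1)" and im: "\<phi> ` ball 0 1 = ball 0 1 - S"
    using \<phi> by (auto simp: disk_conformal_def bij_betw_def)
  obtain g where g: "g holomorphic_on \<phi> ` ball 0 1" "\<And>z. z \<in> ball 0 1 \<Longrightarrow> g (\<phi> z) = z"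
    using holomorphic_has_inverse[OF hol open_ball inj] by metis
  define L where "L = cball 0 (1 - \<epsilon>) \<inter> (\<Inter>s\<in>S. {y. \<epsilon> \<le> dist y s})"
  have "closed (\<Inter>s\<in>S. {y. \<epsilon> \<le> dist y s})"
    by (intro closed_INT ballI closed_Collect_le continuous_intros)
  then have L: "compact L" unfolding L_def by (intro compact_Int_closed) auto
  have Lsub: "L \<subseteq> ball 0 1 - S"
    using \<epsilon> by (force simp: L_def)
  have gL: "compact (g ` L)"
    by (rule compact_continuous_image[OF continuous_on_subset[OF holomorphic_on_imp_continuous_on[OF g(1)]] L])
       (use im Lsub in auto)
  have "g y \<in> ball 0 1" if "y \<in> L" for y
  proof -
    have "y \<in> \<phi> ` ball 0 1" using that Lsub im by blast
    then show ?thesis using g(2) by fastforce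
  qed
  then have sub: "g ` L \<subseteq> ball 0 1" by auto
  obtain r0 where r0: "r0 < 1" "\<And>z. z \<in> g ` L \<Longrightarrow> cmod z \<le> r0"
  proof (cases "L = {}")
    case False
    then obtain z0 where "z0 \<in> g ` L" "\<And>z. z \<in> g ` L \<Longrightarrow> cmod z \<le> cmod z0"
      using continuous_attains_sup[OF gL, of cmod] by (auto intro: continuous_intros)
    then show ?thesis using that[of "cmod z0"] sub by auto
  qed (use that[of 0] in auto)
  have "1 - \<epsilon> < cmod (\<phi> w) \<or> (\<exists>s\<in>S. dist (\<phi> w) s < \<epsilon>)" if "r0 < cmod w" "cmod w < 1" for w
  proof (rule ccontr)
    assume "\<not> ?thesis"
    then have "\<phi> w \<in> L" by (auto simp: L_def not_less)
    then have "cmod (g (\<phi> w)) \<le> r0" using r0(2) by blast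
    then show False using g(2)[of w] that by auto
  qed
  then show ?thesis using r0(1) by blast
qed


section \<open>Small particles act like point sources\<close>

lemma small_exponent:
  fixes R t :: real
  assumes "1 - t \<le> exp (- R)" "0 \<le> t" "t \<le> 1/2"
  shows "R \<le> 2 * t"
proof -
  have "- t - 2 * t\<^sup>2 \<le> ln (1 - t)" by (rule ln_one_minus_pos_lower_bound) (use assms in auto)
  also have "\<dots> \<le> ln (exp (- R))" using assms by (subst ln_le_cancel_iff) auto
  finally have "R \<le> t + 2 * t\<^sup>2" by simp
  also have "2 * t\<^sup>2 \<le> t" using assms mult_right_mono[of t "1/2" t] by (simp add: power2_eq_square)
  finally show ?thesis by simp
qed

text \<open>The difference to be estimated is, by the Herglotz formula, an average with weight \<open>Re h(w)\<close> of a
difference of kernels that is at most a constant times \<open>|1 - w|\<close>. So it suffices that the weighted average of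
\<open>|1 - w|\<close> is \<open>O(c d)\<close>, although the total weight is only \<open>c\<close>. Pointwise on a circle close to the
unit circle, either the weight is negligible or \<open>\<phi>(w)\<close> is near 1; in both cases the weight is at most \<open>4 d\<close>.
Passing from \<open>\<phi>(w)\<close> back to \<open>w\<close> costs \<open>|h(w)|\<close>, whose square is
\<open>2 (Re h)\<^sup>2 - Re (h\<^sup>2)\<close>; the average of \<open>Re (h\<^sup>2)\<close> is \<open>c\<^sup>2 \<ge> 0\<close> by the mean value property, and
\<open>(Re h)\<^sup>2\<close> is at most \<open>4 d Re h\<close>.\<close>

lemma slit_map_estimate:
  assumes \<phi>: "disk_conformal \<phi> (ball 0 1 - S)" and S: "S \<subseteq> cball 1 d"
    and d: "0 < d" "d \<le> 1/4" and c: "0 < c"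
    and hol: "h holomorphic_on ball 0 1" and h0: "h 0 = of_real c"
    and h: "\<And>x. x \<in> ball 0 1 \<Longrightarrow> \<phi> x = x * exp (- h x) \<and> 0 \<le> Re (h x)"
    and x: "cmod x \<le> \<rho>" and \<rho>: "\<rho> < 1"
  shows "cmod (h x - of_real c * ((1 + x) / (1 - x))) \<le> 164 * d * c / (1 - \<rho>)\<^sup>2"
proof -
  \<comment> \<open>Small enough for the negligible part of the weight to contribute \<open>O(c d)\<close> after division by \<open>d\<close>.\<close>
  define \<epsilon> where "\<epsilon> = min d (d\<^sup>2 * c / 2)"
  have \<epsilon>: "0 < \<epsilon>" "\<epsilon> \<le> d" "\<epsilon> \<le> d\<^sup>2 * c / 2" using d c by (auto simp: \<epsilon>_def)
  obtain r0 where r0: "r0 < 1"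
    "\<And>w. r0 < cmod w \<Longrightarrow> cmod w < 1 \<Longrightarrow> 1 - \<epsilon> < cmod (\<phi> w) \<or> (\<exists>s\<in>S. dist (\<phi> w) s < \<epsilon>)"
    using disk_conformal_proper[OF \<phi> \<epsilon>(1)] by blast
  have "0 \<le> \<rho>" using x norm_ge_zero[of x] by linarith
  define m where "m = max r0 ((1 + \<rho>) / 2)"
  have "m < 1" using r0(1) \<rho> by (auto simp: m_def)
  define r where "r = (m + 1) / 2"
  have r: "r0 < r" "(1 + \<rho>) / 2 \<le> r" "r < 1"
  proof -
    have "r0 \<le> m" "(1 + \<rho>) / 2 \<le> m" by (auto simp: m_def)
    then show "r0 < r" "(1 + \<rho>) / 2 \<le> r" "r < 1" using \<open>m < 1\<close> by (auto simp: r_def field_simps)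
  qed
  have r_pos: "0 < r" "\<rho> < r" using r(2) \<rho> \<open>0 \<le> \<rho>\<close> by auto
  have holr: "h holomorphic_on cball 0 r" by (rule holomorphic_on_subset[OF hol]) (use r(3) in auto)
  have ch: "continuous_on (sphere 0 r) h"
    using holomorphic_on_imp_continuous_on[OF holr] by (rule continuous_on_subset) auto

  \<comment> \<open>A pointwise bound that is linear in \<open>Re h\<close> and \<open>Re (h\<^sup>2)\<close>, so that the mean value property evaluates its average.\<close>
  define B where "B = (\<lambda>w. 8 * \<epsilon> / d + 73 / 2 * d * Re (h w) - 4 * Re ((h w)\<^sup>2))"
  have bound: "Re (h w) * cmod (1 - w) \<le> B w" if w: "w \<in> sphere 0 r" for w
  proof -
    have wb: "w \<in> ball 0 1" "cmod w = r" using w r(3) by auto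
    define R where "R = Re (h w)"
    have R0: "0 \<le> R" using h[OF wb(1)] by (simp add: R_def)
    have \<phi>w: "\<phi> w = w * exp (- h w)" using h[OF wb(1)] by blast
    then have n\<phi>: "cmod (\<phi> w) = r * exp (- R)" by (simp add: norm_mult wb(2) R_def)
    then have le: "cmod (\<phi> w) \<le> exp (- R)" using r(3) r_pos by simp
    have "exp (- R) \<le> 1" using R0 by simp
    then have le1: "cmod (\<phi> w) \<le> 1" using le by linarith
    have key: "R \<le> 4 * d \<and> R * (cmod (1 - \<phi> w))\<^sup>2 \<le> 8 * \<epsilon> + 4 * d\<^sup>2 * R"
    proof -
      consider "1 - \<epsilon> < cmod (\<phi> w)" | s where "s \<in> S" "dist (\<phi> w) s < \<epsilon>"
        using r0(2)[of w] wb r by auto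
      then show ?thesis
      proof cases
        case 1
        have R: "R \<le> 2 * \<epsilon>" by (rule small_exponent) (use 1 le \<epsilon> d in auto)
        have "cmod (1 - \<phi> w) \<le> 2" using norm_triangle_ineq4[of 1 "\<phi> w"] le1 by simp
        then have "(cmod (1 - \<phi> w))\<^sup>2 \<le> 2\<^sup>2" by (intro power_mono) auto
        then have "R * (cmod (1 - \<phi> w))\<^sup>2 \<le> (2 * \<epsilon>) * 4" by (intro mult_mono R) (use \<epsilon> in auto)
        moreover have "0 \<le> 4 * d\<^sup>2 * R" using R0 by simp
        ultimately show ?thesis using R \<epsilon>(2) d(1) by linarith
      next
        case 2
        have "dist 1 s \<le> d" using 2 S by auto
        then have near: "cmod (1 - \<phi> w) \<le> 2 * d"
          using 2(2) dist_triangle2[of 1 "\<phi> w" s] \<epsilon>(2) by (simp add: dist_norm)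
        then have "1 - 2 * d \<le> cmod (\<phi> w)" using norm_triangle_ineq2[of 1 "\<phi> w"] by simp
        then have "R \<le> 2 * (2 * d)" by (intro small_exponent) (use le d in auto)
        moreover have "(cmod (1 - \<phi> w))\<^sup>2 \<le> (2 * d)\<^sup>2" using near by (intro power_mono) auto
        then have "R * (cmod (1 - \<phi> w))\<^sup>2 \<le> R * (2 * d)\<^sup>2" using R0 by (intro mult_left_mono)
        moreover have "R * (2 * d)\<^sup>2 = 4 * d\<^sup>2 * R" by (simp add: power2_eq_square)
        ultimately show ?thesis using \<epsilon>(1) by linarith
      qed
    qed
    have "cmod (\<phi> w - w) \<le> cmod (h w)"
    proof -
      have "\<phi> w - w = w * (exp (- h w) - 1)" by (simp add: \<phi>w algebra_simps)
      then have "cmod (\<phi> w - w) = r * cmod (exp (- h w) - 1)" by (simp add: norm_mult wb(2))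
      also have "\<dots> \<le> 1 * cmod (h w)"
        using r(3) r_pos norm_exp_minus_one_le[of "h w"] h[OF wb(1)] by (intro mult_mono) auto
      finally show ?thesis by simp
    qed
    then have "cmod (1 - w) \<le> cmod (1 - \<phi> w) + cmod (h w)"
      using norm_triangle_ineq[of "1 - \<phi> w" "\<phi> w - w"] by simp
    then have "(cmod (1 - w))\<^sup>2 \<le> (cmod (1 - \<phi> w) + cmod (h w))\<^sup>2" by (intro power_mono) auto
    also have "\<dots> \<le> 2 * (cmod (1 - \<phi> w))\<^sup>2 + 2 * (cmod (h w))\<^sup>2"
      using zero_le_power2[of "cmod (1 - \<phi> w) - cmod (h w)"] by (simp add: power2_sum power2_diff)
    finally have "R * (cmod (1 - w))\<^sup>2 \<le> 2 * (R * (cmod (1 - \<phi> w))\<^sup>2) + 2 * (R * (cmod (h w))\<^sup>2)"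
      using mult_left_mono[OF _ R0] by (fastforce simp: algebra_simps)
    also have "R * (cmod (h w))\<^sup>2 \<le> 4 * d * (2 * (4 * d * R) - Re ((h w)\<^sup>2))"
    proof -
      have "(cmod (h w))\<^sup>2 = 2 * (R * R) - Re ((h w)\<^sup>2)"
        using cmod_power2[of "h w"] by (simp add: R_def power2_eq_square)
      also have "\<dots> \<le> 2 * (4 * d * R) - Re ((h w)\<^sup>2)" using mult_right_mono[of R "4 * d" R] key R0 by linarith
      finally have "(cmod (h w))\<^sup>2 \<le> 2 * (4 * d * R) - Re ((h w)\<^sup>2)" .
      then show ?thesis using key R0 d by (intro mult_mono) auto
    qed
    finally have *: "R * (cmod (1 - w))\<^sup>2 \<le> 16 * \<epsilon> + 72 * d\<^sup>2 * R - 8 * d * Re ((h w)\<^sup>2)"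
      using key by (simp add: algebra_simps power2_eq_square)
    \<comment> \<open>From the second moment to the first: the weight \<open>d\<close> balances total mass \<open>c\<close> against second moment \<open>O(c d\<^sup>2)\<close>.\<close>
    have "2 * d * cmod (1 - w) \<le> d\<^sup>2 + (cmod (1 - w))\<^sup>2"
      using zero_le_power2[of "d - cmod (1 - w)"] by (simp add: power2_diff)
    then have "R * (2 * d * cmod (1 - w)) \<le> R * (d\<^sup>2 + (cmod (1 - w))\<^sup>2)" using R0 by (rule mult_left_mono)
    also have "\<dots> \<le> 2 * d * B w"
      using * d by (simp add: B_def R_def[symmetric] algebra_simps power2_eq_square)
    finally have "(2 * d) * (R * cmod (1 - w)) \<le> (2 * d) * B w" by (simp add: algebra_simps)
    then show ?thesis using d(1) unfolding R_def[symmetric] by (simp add: mult_le_cancel_left)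
  qed

  have nz: "w - x \<noteq> 0" "(1 - \<rho>) / 2 \<le> cmod (w - x)" if "w \<in> sphere 0 r" for w
  proof -
    have "r - cmod x \<le> cmod (w - x)" using that norm_triangle_ineq2[of w x] by simp
    then show "(1 - \<rho>) / 2 \<le> cmod (w - x)" using x r(2) by (simp add: field_simps)
    then show "w - x \<noteq> 0" using \<rho> by auto
  qed
  have x1: "1 - x \<noteq> 0" "1 - \<rho> \<le> cmod (1 - x)"
    using x \<rho> norm_triangle_ineq2[of 1 x] by auto
  have cRe: "continuous_on (sphere 0 r) (\<lambda>w. complex_of_real (Re (h w)))" by (intro continuous_intros ch)
  have avg_h: "circle_avg r h = of_real c" using circle_avg_mean_value[OF holr r_pos(1)] h0 by simp
  have avg_Re: "circle_avg r (\<lambda>w. Re (h w)) = c"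
    using circle_avg_linear[OF bounded_linear_Re ch] avg_h r_pos by simp
  have avg_cRe: "circle_avg r (\<lambda>w. complex_of_real (Re (h w))) = of_real c"
    using circle_avg_linear[OF bounded_linear_of_real continuous_on_Re[OF ch]] avg_Re r_pos by simp
  have avg_sq: "circle_avg r (\<lambda>w. Re ((h w)\<^sup>2)) = c\<^sup>2"
  proof -
    have "circle_avg r (\<lambda>w. (h w)\<^sup>2) = of_real (c\<^sup>2)"
      using circle_avg_mean_value[of "\<lambda>w. (h w)\<^sup>2" r] holr r_pos h0 by (auto intro!: holomorphic_intros)
    then show ?thesis
      using circle_avg_linear[OF bounded_linear_Re, of r "\<lambda>w. (h w)\<^sup>2"] r_pos ch by (auto intro!: continuous_intros)
  qed
  have cB: "continuous_on (sphere 0 r) B" unfolding B_def by (intro continuous_intros ch)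
  have avg_B: "circle_avg r B \<le> 41 * d * c"
  proof -
    have l: "circle_avg r (\<lambda>w. 73 / 2 * d * Re (h w)) = 73 / 2 * d * c"
      by (rule circle_avg_linear[OF bounded_linear_mult_right[of "73 / 2 * d"] continuous_on_Re[OF ch] less_imp_le[OF r_pos(1)], unfolded avg_Re])
    have l2: "circle_avg r (\<lambda>w. 4 * Re ((h w)\<^sup>2)) = 4 * c\<^sup>2"
      by (rule circle_avg_linear[OF bounded_linear_mult_right[of 4] _ less_imp_le[OF r_pos(1)], of "\<lambda>w. Re ((h w)\<^sup>2)", unfolded avg_sq])
         (intro continuous_intros ch)
    have "circle_avg r B = 8 * \<epsilon> / d + 73 / 2 * d * c - 4 * c\<^sup>2"
    proof -
      have c1: "continuous_on (sphere 0 r) (\<lambda>w. 73 / 2 * d * Re (h w))"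
        "continuous_on (sphere 0 r) (\<lambda>w. 8 * \<epsilon> / d)"
        "continuous_on (sphere 0 r) (\<lambda>w. 4 * Re ((h w)\<^sup>2))" by (intro continuous_intros ch)+
      show ?thesis unfolding B_def
        using circle_avg_diff[OF continuous_on_add[OF c1(2,1)] c1(3)] circle_avg_add[OF c1(2,1)] r_pos
          l l2 circle_avg_const[of r "8 * \<epsilon> / d"] by simp
    qed
    also have "8 * \<epsilon> / d \<le> 4 * d * c" using \<epsilon>(3) d by (simp add: field_simps power2_eq_square)
    finally have "circle_avg r B \<le> 4 * d * c + 73 / 2 * d * c - 4 * c\<^sup>2" by simp
    moreover have "0 \<le> d * c" "0 \<le> c\<^sup>2" using d c by auto
    ultimately show ?thesis by linarith
  qed

  have "h x - of_real c * ((1 + x) / (1 - x))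
     = circle_avg r (\<lambda>w. of_real (Re (h w)) * ((w + x) / (w - x)) - of_real (Re (h w)) * ((1 + x) / (1 - x)))"
  proof -
    have "cmod x < r" using x r_pos by simp
    then have e1: "h x = circle_avg r (\<lambda>w. of_real (Re (h w)) * ((w + x) / (w - x)))"
      by (rule Herglotz_formula[OF holr]) (simp add: h0)
    have e2: "circle_avg r (\<lambda>w. of_real (Re (h w)) * ((1 + x) / (1 - x))) = of_real c * ((1 + x) / (1 - x))"
      by (rule circle_avg_linear[OF bounded_linear_mult_left cRe less_imp_le[OF r_pos(1)], unfolded avg_cRe])
    have c1: "continuous_on (sphere 0 r) (\<lambda>w. of_real (Re (h w)) * ((w + x) / (w - x)))"
      "continuous_on (sphere 0 r) (\<lambda>w. of_real (Re (h w)) * ((1 + x) / (1 - x)))"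
      using nz x1 by (auto intro!: continuous_intros ch)
    show ?thesis
      by (subst circle_avg_diff[OF c1]) (use r_pos e1 e2 in auto)
  qed
  also have "cmod \<dots> \<le> circle_avg r (\<lambda>w. 4 / (1 - \<rho>)\<^sup>2 * B w)"
  proof (rule norm_circle_avg_le)
    fix w :: complex assume w: "w \<in> sphere 0 r"
    have R0: "0 \<le> Re (h w)" using h[of w] w r(3) by auto
    have "(w + x) / (w - x) - (1 + x) / (1 - x) = 2 * x * (1 - w) / ((w - x) * (1 - x))"
      using nz(1)[OF w] x1 by (simp add: divide_simps) (simp add: algebra_simps)
    then have "cmod ((w + x) / (w - x) - (1 + x) / (1 - x)) = 2 * cmod x * cmod (1 - w) / (cmod (w - x) * cmod (1 - x))"
      by (simp add: norm_divide norm_mult)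
    also have "\<dots> \<le> 2 * 1 * cmod (1 - w) / ((1 - \<rho>) / 2 * (1 - \<rho>))"
      by (intro frac_le mult_mono nz(2)[OF w] x1) (use x \<rho> in auto)
    also have "\<dots> = 4 / (1 - \<rho>)\<^sup>2 * cmod (1 - w)" by (simp add: power2_eq_square)
    finally have k: "cmod ((w + x) / (w - x) - (1 + x) / (1 - x)) \<le> 4 / (1 - \<rho>)\<^sup>2 * cmod (1 - w)" .
    have "cmod (of_real (Re (h w)) * ((w + x) / (w - x)) - of_real (Re (h w)) * ((1 + x) / (1 - x)))
      = Re (h w) * cmod ((w + x) / (w - x) - (1 + x) / (1 - x))"
      unfolding right_diff_distrib[symmetric] norm_mult using R0 by simp
    also have "\<dots> \<le> Re (h w) * (4 / (1 - \<rho>)\<^sup>2 * cmod (1 - w))" using k R0 by (rule mult_left_mono)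
    also have "\<dots> = 4 / (1 - \<rho>)\<^sup>2 * (Re (h w) * cmod (1 - w))" by (simp add: mult_ac)
    also have "\<dots> \<le> 4 / (1 - \<rho>)\<^sup>2 * B w" using bound[OF w] by (intro mult_left_mono) auto
    finally show "cmod (of_real (Re (h w)) * ((w + x) / (w - x)) - of_real (Re (h w)) * ((1 + x) / (1 - x)))
       \<le> 4 / (1 - \<rho>)\<^sup>2 * B w" .
  next
    show "continuous_on (sphere 0 r) (\<lambda>w. of_real (Re (h w)) * ((w + x) / (w - x)) - of_real (Re (h w)) * ((1 + x) / (1 - x)))"
      using nz x1 by (auto intro!: continuous_intros ch)
    show "continuous_on (sphere 0 r) (\<lambda>w. 4 / (1 - \<rho>)\<^sup>2 * B w)" by (intro continuous_intros cB)
  qed (use r_pos in auto)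
  also have "\<dots> = 4 / (1 - \<rho>)\<^sup>2 * circle_avg r B"
    by (rule circle_avg_linear[OF bounded_linear_mult_right cB less_imp_le[OF r_pos(1)]])
  also have "\<dots> \<le> 4 / (1 - \<rho>)\<^sup>2 * (41 * d * c)" using avg_B by (intro mult_left_mono) auto
  finally show ?thesis by simp
qed

definition particle_disk_map :: "complex set \<Rightarrow> complex \<Rightarrow> complex" where
  "particle_disk_map P = disk_map (particle_map P)"

lemma particle_disk_map_conformal:
  assumes "particle P"
  shows "disk_conformal (particle_disk_map P) (ball 0 1 - inverse ` P)"
  using disk_conformal_disk_map[OF particle_map_conformal[OF assms]] particle_chart(6)[OF assms]
  by (simp add: disk_shape_def particle_disk_map_def)

text \<open>A particle is bounded, because its complement contains a neighbourhood of infinity. As 1 lies in its closure,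
its points are within its diameter of 1, and inversion does not increase the distance to 1 of a point
outside the unit disk.\<close>

lemma particle_near_one:
  assumes P: "particle P"
  shows "inverse ` P \<subseteq> cball 1 (diameter P)"
proof -
  note pc = particle_chart[OF P]
  obtain e where e: "e > 0" "ball 0 e \<subseteq> disk_shape P"
    using pc(3,5) by (auto simp: open_contains_ball)
  have "cmod p \<le> inverse e" if "p \<in> P" for p
  proof (rule ccontr)
    assume "\<not> ?thesis"
    then have "cmod (inverse p) < e" using e(1)
      by (simp add: norm_inverse) (metis inverse_inverse_eq less_imp_inverse_less not_le positive_imp_inverse_positive)
    then have "inverse p \<in> disk_shape P" using e(2) by auto
    then show False using that by (auto simp: disk_shape_def)
  qed
  then have "P \<subseteq> cball 0 (inverse e)" by auto
  then have bdd: "bounded P" by (rule bounded_subset[rotated]) simp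
  have one: "1 \<in> closure P" using P by (simp add: particle_def)
  show ?thesis
  proof (clarsimp simp: dist_norm)
    fix p assume p: "p \<in> P"
    then have p1: "1 < cmod p" using pc(2) by auto
    have "dist 1 p \<le> diameter (closure P)"
      by (rule diameter_bounded_bound) (use bdd one p closure_subset in auto)
    then have d: "cmod (1 - p) \<le> diameter P" by (simp add: diameter_closure[OF bdd] dist_norm)
    have "p \<noteq> 0" using p1 by auto
    then have "1 - inverse p = - (1 - p) / p" by (simp add: field_simps)
    then have "cmod (1 - inverse p) = cmod (1 - p) / cmod p" by (metis norm_divide norm_minus_cancel)
    also have "\<dots> \<le> cmod (1 - p) / 1" using p1 by (intro divide_left_mono) auto
    finally show "cmod (1 - inverse p) \<le> diameter P" using d by simp
  qed
qed

lemma particle_disk_map_estimate: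
  assumes P: "particle P" and c: "0 < lcap P" and d: "diameter P \<le> 1/4"
  shows "\<exists>h. (\<forall>x\<in>ball 0 1. particle_disk_map P x = x * exp (- h x) \<and> 0 \<le> Re (h x)) \<and>
    (\<forall>\<rho><1. \<forall>x. cmod x \<le> \<rho> \<longrightarrow> cmod (h x - of_real (lcap P) * ((1 + x) / (1 - x))) \<le> 164 * diameter P * lcap P / (1 - \<rho>)\<^sup>2)"
proof -
  let ?\<phi> = "particle_disk_map P"
  have \<phi>: "disk_conformal ?\<phi> (ball 0 1 - inverse ` P)" by (rule particle_disk_map_conformal[OF P])
  have dd: "0 < particle_cap P" "deriv ?\<phi> 0 = of_real (inverse (particle_cap P))"
    using deriv_disk_map[OF particle_map_conformal[OF P] _ particle_cap_expansion[OF P]]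
    by (auto simp: particle_disk_map_def)
  then have "deriv ?\<phi> 0 = of_real (exp (- lcap P))" by (simp add: lcap_def exp_minus)
  from disk_conformal_log[OF \<phi> _ this] obtain h where h: "h holomorphic_on ball 0 1" "h 0 = of_real (lcap P)"
    "\<And>x. x \<in> ball 0 1 \<Longrightarrow> ?\<phi> x = x * exp (- h x) \<and> 0 \<le> Re (h x)" by blast
  have "0 < diameter P" using P by (simp add: particle_def)
  then show ?thesis
    using slit_map_estimate[OF \<phi> particle_near_one[OF P] _ d c h] h(3) by blast
qed


section \<open>Averages of the driving points\<close>

text \<open>For bounded variables the deviation probabilities decay geometrically by Hoeffding's inequality, so the
Borel--Cantelli lemma applies for each deviation \<open>1 / (k + 1)\<close>.\<close>

lemma (in prob_space) strong_law_bounded: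
  fixes X :: "nat \<Rightarrow> 'a \<Rightarrow> real"
  assumes indep: "indep_vars (\<lambda>_. borel) X {1..}"
    and bound: "\<And>i \<omega>. \<omega> \<in> space M \<Longrightarrow> X i \<omega> \<in> {-1..1}"
    and mean: "\<And>i. i \<ge> 1 \<Longrightarrow> expectation (X i) = m"
  shows "AE \<omega> in M. (\<lambda>n. (\<Sum>i=1..n. X i \<omega>) / n) \<longlonglongrightarrow> m"
proof -
  have rv [measurable]: "X i \<in> borel_measurable M" if "i \<ge> 1" for i
    using indep that by (auto simp: indep_vars_def)
  have "AE \<omega> in M. \<forall>\<^sub>F n in sequentially. \<bar>(\<Sum>i=1..n. X i \<omega>) - n * m\<bar> < e * n" if e: "e > 0" for e :: real
  proof -
    define A where "A = (\<lambda>n::nat. {\<omega>\<in>space M. \<bar>(\<Sum>i=1..Suc n. X i \<omega>) - Suc n * m\<bar> \<ge> e * Suc n})"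
    have meas: "A n \<in> sets M" for n unfolding A_def by measurable
    have le: "prob (A n) \<le> 2 * exp (- e\<^sup>2 / 2) ^ Suc n" for n
    proof -
      interpret H: Hoeffding_ineq M "{1..Suc n}" X "\<lambda>_. -1" "\<lambda>_. 1" "\<Sum>i=1..Suc n. expectation (X i)"
        by unfold_locales (use bound in \<open>auto intro: indep_vars_subset[OF indep]\<close>)
      have "prob (A n) \<le> 2 * exp (-2 * (e * Suc n)\<^sup>2 / (\<Sum>i=1..Suc n. (1 - (-1))\<^sup>2))"
        using H.Hoeffding_ineq_abs_ge[of "e * Suc n"] e mean unfolding A_def by simp
      also have "-2 * (e * Suc n)\<^sup>2 / (\<Sum>i=1..Suc n. (1 - (-1))\<^sup>2) = Suc n * (- e\<^sup>2 / 2)"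
        by (simp add: power2_eq_square field_simps)
      finally show ?thesis by (simp only: exp_of_nat_mult)
    qed
    have "exp (- e\<^sup>2 / 2) < 1" using e by simp
    then have "summable (\<lambda>n. 2 * exp (- e\<^sup>2 / 2) ^ Suc n)"
      by (intro summable_mult summable_ignore_initial_segment[of _ 1, simplified] summable_geometric) simp
    then have "summable (\<lambda>n. prob (A n))"
      by (rule summable_comparison_test'[of _ 0]) (use le in simp)
    then have "AE \<omega> in M. \<forall>\<^sub>F n in sequentially. \<omega> \<in> space M - A n"
      by (intro borel_cantelli_AE1 meas) (simp_all add: emeasure_eq_measure)
    then show ?thesis
    proof eventually_elim
      case (elim \<omega>)
      then have "\<forall>\<^sub>F n in sequentially. \<bar>(\<Sum>i=1..Suc n. X i \<omega>) - Suc n * m\<bar> < e * Suc n"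
        by eventually_elim (auto simp: A_def)
      then show ?case by (subst eventually_sequentially_Suc[symmetric])
    qed
  qed
  then have "AE \<omega> in M. \<forall>k::nat. \<forall>\<^sub>F n in sequentially. \<bar>(\<Sum>i=1..n. X i \<omega>) - n * m\<bar> < inverse (Suc k) * n"
    by (subst AE_all_countable) auto
  then show ?thesis
  proof eventually_elim
    case (elim \<omega>)
    show ?case
    proof (rule tendstoI)
      fix e :: real assume "e > 0"
      then obtain k where k: "inverse (Suc k) < e" using reals_Archimedean by blast
      have "\<forall>\<^sub>F n in sequentially. \<bar>(\<Sum>i=1..n. X i \<omega>) - n * m\<bar> < inverse (Suc k) * n" using elim by blast
      with eventually_gt_at_top[of 0] show "\<forall>\<^sub>F n in sequentially. dist ((\<Sum>i=1..n. X i \<omega>) / n) m < e"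
      proof eventually_elim
        case (elim n)
        have "dist ((\<Sum>i=1..n. X i \<omega>) / n) m = \<bar>(\<Sum>i=1..n. X i \<omega>) - n * m\<bar> / n"
          using elim(1) by (simp add: dist_real_def field_simps)
        also have "\<dots> < inverse (Suc k)" using elim by (simp add: divide_less_eq)
        finally show ?case using k by simp
      qed
    qed
  qed
qed

text \<open>This is \<open>(z + \<zeta>) / (z - \<zeta>)\<close> for \<open>z = 1/x\<close>.\<close>

definition herglotz_kernel :: "complex \<Rightarrow> complex \<Rightarrow> complex" where
  "herglotz_kernel \<zeta> x = (1 + x * \<zeta>) / (1 - x * \<zeta>)"

definition herglotz :: "complex measure \<Rightarrow> complex \<Rightarrow> complex" where
  "herglotz \<nu> x = (\<integral>\<zeta>. herglotz_kernel \<zeta> x \<partial>\<nu>)"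

lemma one_minus_mult_bound:
  assumes "cmod \<zeta> = 1" "cmod x \<le> \<rho>"
  shows "1 - \<rho> \<le> cmod (1 - x * \<zeta>)"
  using norm_triangle_ineq2[of 1 "x * \<zeta>"] assms by (simp add: norm_mult)

lemma norm_herglotz_kernel_le:
  assumes "cmod \<zeta> = 1" "cmod x \<le> \<rho>" "\<rho> < 1"
  shows "cmod (herglotz_kernel \<zeta> x) \<le> 2 / (1 - \<rho>)"
proof -
  have "cmod (1 + x * \<zeta>) \<le> 2" using norm_triangle_ineq[of 1 "x * \<zeta>"] assms by (simp add: norm_mult)
  then show ?thesis
    unfolding herglotz_kernel_def norm_divide
    by (intro frac_le one_minus_mult_bound assms) (use assms in auto)
qed

text \<open>The remainder of the geometric series is bounded uniformly in \<open>\<zeta>\<close>. Hence the same bound holds after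
integration (\<open>herglotz_partial_sum\<close>), and the dependence on \<open>\<zeta>\<close> is reduced to finitely many powers
\<open>\<zeta>\<^sup>k\<close>.\<close>

lemma herglotz_kernel_partial_sum:
  assumes "cmod \<zeta> = 1" "cmod x \<le> \<rho>" "\<rho> < 1"
  shows "cmod (herglotz_kernel \<zeta> x - (1 + 2 * (\<Sum>k=1..N. x ^ k * \<zeta> ^ k))) \<le> 2 * \<rho> ^ Suc N / (1 - \<rho>)"
proof -
  have \<rho>: "0 \<le> \<rho>" using assms(2) norm_ge_zero[of x] by linarith
  define y where "y = x * \<zeta>"
  have nz: "1 - y \<noteq> 0" using one_minus_mult_bound[OF assms(1,2)] assms(3) by (auto simp: y_def)
  have "(1 - y) * (\<Sum>k=1..N. y ^ k) = y - y ^ Suc N"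
  proof (induction N)
    case (Suc N)
    have "(1 - y) * (\<Sum>k=1..Suc N. y ^ k) = (1 - y) * (\<Sum>k=1..N. y ^ k) + (1 - y) * y ^ Suc N"
      by (simp add: distrib_left)
    also have "\<dots> = (y - y ^ Suc N) + (1 - y) * y ^ Suc N" by (simp only: Suc)
    also have "\<dots> = y - y ^ Suc (Suc N)" by (simp add: algebra_simps)
    finally show ?case .
  qed auto
  then have "(\<Sum>k=1..N. y ^ k) = (y - y ^ Suc N) / (1 - y)"
    using nz by (simp add: eq_divide_eq mult.commute)
  then have "(\<Sum>k=1..N. x ^ k * \<zeta> ^ k) = (y - y ^ Suc N) / (1 - y)"
    by (simp only: y_def power_mult_distrib)
  moreover have "(1 + y) / (1 - y) - (1 + 2 * ((y - y ^ Suc N) / (1 - y))) = 2 * y ^ Suc N / (1 - y)"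
    using nz by (simp add: divide_simps)
  ultimately have "herglotz_kernel \<zeta> x - (1 + 2 * (\<Sum>k=1..N. x ^ k * \<zeta> ^ k)) = 2 * (x * \<zeta>) ^ Suc N / (1 - x * \<zeta>)"
    by (simp only: herglotz_kernel_def flip: y_def)
  then have "cmod (herglotz_kernel \<zeta> x - (1 + 2 * (\<Sum>k=1..N. x ^ k * \<zeta> ^ k))) = 2 * cmod x ^ Suc N / cmod (1 - x * \<zeta>)"
    using assms(1) by (simp add: norm_divide norm_mult norm_power)
  also have "\<dots> \<le> 2 * \<rho> ^ Suc N / (1 - \<rho>)"
    by (intro frac_le mult_left_mono power_mono one_minus_mult_bound assms) (use assms \<rho> in auto)
  finally show ?thesis .
qed

locale circle_measure = prob_space \<nu> for \<nu> :: "complex measure" +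
  assumes sets_eq: "sets \<nu> = sets (restrict_space borel (sphere 0 1))"
begin

lemma space_eq: "space \<nu> = sphere 0 1"
  using sets_eq_imp_space_eq[OF sets_eq] by (simp add: space_restrict_space)

lemma integrable_continuous:
  fixes g :: "complex \<Rightarrow> 'b::{banach, second_countable_topology}"
  assumes "continuous_on (sphere 0 1) g"
  shows "integrable \<nu> g"
proof -
  have "g \<in> borel_measurable \<nu>"
    using borel_measurable_continuous_on_restrict[OF assms] measurable_cong_sets[OF sets_eq refl] by blast
  moreover have "compact (g ` sphere 0 1)" by (intro compact_continuous_image assms) auto
  then obtain B where "\<And>y. y \<in> g ` sphere 0 1 \<Longrightarrow> norm y \<le> B"
    using compact_imp_bounded bounded_iff by metis
  then have "AE \<zeta> in \<nu>. norm (g \<zeta>) \<le> B" by (auto simp: space_eq)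
  ultimately show ?thesis by (intro integrable_const_bound)
qed

lemma continuous_herglotz_kernel:
  assumes "cmod x < 1"
  shows "continuous_on (sphere 0 1) (\<lambda>\<zeta>. herglotz_kernel \<zeta> x)"
  unfolding herglotz_kernel_def
  using one_minus_mult_bound[of _ x "cmod x"] assms
  by (intro continuous_intros ballI) (metis diff_gt_0_iff_gt dist_0_norm less_le_not_le mem_sphere norm_zero order_refl)

lemma norm_integral_le:
  assumes "continuous_on (sphere 0 1) g" "\<And>\<zeta>. cmod \<zeta> = 1 \<Longrightarrow> cmod (g \<zeta>) \<le> B"
  shows "cmod (\<integral>\<zeta>. g \<zeta> \<partial>\<nu>) \<le> B"
proof -
  have "cmod (\<integral>\<zeta>. g \<zeta> \<partial>\<nu>) \<le> (\<integral>\<zeta>. B \<partial>\<nu>)"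
    by (rule Bochner_Integration.integral_norm_bound_integral)
       (use assms in \<open>auto intro!: integrable_continuous simp: space_eq\<close>)
  then show ?thesis by (simp add: prob_space)
qed

lemma norm_herglotz_le:
  assumes "cmod x \<le> \<rho>" "\<rho> < 1"
  shows "cmod (herglotz \<nu> x) \<le> 2 / (1 - \<rho>)"
  unfolding herglotz_def
  by (rule norm_integral_le) (use assms in \<open>auto intro!: norm_herglotz_kernel_le continuous_herglotz_kernel\<close>)

lemma herglotz_partial_sum:
  assumes "cmod x \<le> \<rho>" "\<rho> < 1"
  shows "cmod (herglotz \<nu> x - (1 + 2 * (\<Sum>k=1..N. x ^ k * (\<integral>\<zeta>. \<zeta> ^ k \<partial>\<nu>)))) \<le> 2 * \<rho> ^ Suc N / (1 - \<rho>)"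
proof -
  have c: "continuous_on (sphere 0 1) (\<lambda>\<zeta>. herglotz_kernel \<zeta> x)"
    by (rule continuous_herglotz_kernel) (use assms in simp)
  have i: "integrable \<nu> (\<lambda>\<zeta>. x ^ k * \<zeta> ^ k)" for k
    by (intro integrable_continuous continuous_intros)
  have "(\<integral>\<zeta>. herglotz_kernel \<zeta> x - (1 + 2 * (\<Sum>k=1..N. x ^ k * \<zeta> ^ k)) \<partial>\<nu>)
     = herglotz \<nu> x - (1 + 2 * (\<Sum>k=1..N. x ^ k * (\<integral>\<zeta>. \<zeta> ^ k \<partial>\<nu>)))"
    unfolding herglotz_def using integrable_continuous[OF c] i
    by (simp add: Bochner_Integration.integral_sum prob_space)
  moreover have "cmod (\<integral>\<zeta>. herglotz_kernel \<zeta> x - (1 + 2 * (\<Sum>k=1..N. x ^ k * \<zeta> ^ k)) \<partial>\<nu>) \<le> 2 * \<rho> ^ Suc N / (1 - \<rho>)"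
    by (rule norm_integral_le[OF _ herglotz_kernel_partial_sum[OF _ assms]]) (intro continuous_intros c)
  ultimately show ?thesis by simp
qed

lemma holomorphic_herglotz: "herglotz \<nu> holomorphic_on ball 0 1"
proof (rule power_series_holomorphic)
  define a where "a = (\<lambda>k. (if k = 0 then 1 else 2 * (\<integral>\<zeta>. \<zeta> ^ k \<partial>\<nu>)))"
  fix w :: complex assume w: "w \<in> ball 0 1"
  have ps: "(\<Sum>k\<le>N. a k * (w - 0) ^ k) = 1 + 2 * (\<Sum>k=1..N. w ^ k * (\<integral>\<zeta>. \<zeta> ^ k \<partial>\<nu>))" for N
    unfolding atMost_atLeast0
    by (subst sum.atLeast_Suc_atMost) (auto simp: a_def sum_distrib_left mult_ac intro!: sum.cong)
  have "(\<lambda>N. 2 * cmod w ^ Suc N / (1 - cmod w)) \<longlonglongrightarrow> 2 * 0 / (1 - cmod w)"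
    by (intro tendsto_intros LIMSEQ_Suc LIMSEQ_power_zero) (use w in auto)
  then have "(\<lambda>N. 2 * cmod w ^ Suc N / (1 - cmod w)) \<longlonglongrightarrow> 0" by simp
  moreover have "norm (herglotz \<nu> w - (\<Sum>k\<le>N. a k * (w - 0) ^ k)) \<le> 2 * cmod w ^ Suc N / (1 - cmod w)" for N
    unfolding ps by (rule herglotz_partial_sum) (use w in auto)
  ultimately have "(\<lambda>N. herglotz \<nu> w - (\<Sum>k\<le>N. a k * (w - 0) ^ k)) \<longlonglongrightarrow> 0"
    by (rule Lim_null_comparison[OF always_eventually[OF allI], rotated])
  from tendsto_diff[OF tendsto_const[of "herglotz \<nu> w"] this]
  have "(\<lambda>N. \<Sum>k\<le>N. a k * (w - 0) ^ k) \<longlonglongrightarrow> herglotz \<nu> w" by simp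
  then show "(\<lambda>k. a k * (w - 0) ^ k) sums herglotz \<nu> w" by (simp add: sums_def_le)
qed

text \<open>Convergence of each moment makes the sums \<open>o(j)\<close> uniformly in \<open>x\<close>. The bound is stated in the form
\<open>B + \<eta> j\<close>, valid for every \<open>j\<close>, because all \<open>j \<le> n\<close> are used simultaneously: after multiplication by
a capacity \<open>c\<close> with \<open>c n \<le> T\<close> it becomes \<open>c B + \<eta> T\<close>, which is small once \<open>\<eta>\<close> and then \<open>c\<close> are.\<close>

lemma herglotz_sum_deviation:
  assumes \<zeta>: "\<And>i. cmod (\<zeta> i) = 1"
    and lim: "\<And>k. (\<lambda>n. (\<Sum>i=1..n. \<zeta> i ^ k) / of_nat n) \<longlonglongrightarrow> (\<integral>\<zeta>. \<zeta> ^ k \<partial>\<nu>)"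
    and \<rho>: "0 \<le> \<rho>" "\<rho> < 1" and \<eta>: "0 < \<eta>"
  shows "\<exists>B\<ge>0. \<forall>j x. cmod x \<le> \<rho> \<longrightarrow>
     cmod (\<Sum>i=1..j. herglotz_kernel (\<zeta> i) x - herglotz \<nu> x) \<le> B + \<eta> * real j"
proof -
  define m where "m = (\<lambda>k. \<integral>\<zeta>. \<zeta> ^ k \<partial>\<nu>)"
  define S where "S = (\<lambda>k j. \<Sum>i=1..j. \<zeta> i ^ k - m k)"
  have "(\<lambda>N. 2 * \<rho> ^ Suc N / (1 - \<rho>)) \<longlonglongrightarrow> 2 * 0 / (1 - \<rho>)"
    by (intro tendsto_intros LIMSEQ_Suc LIMSEQ_power_zero) (use \<rho> in auto)
  then have "\<forall>\<^sub>F N in sequentially. 2 * \<rho> ^ Suc N / (1 - \<rho>) < \<eta> / 4"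
    by (rule order_tendstoD) (use \<eta> in auto)
  then obtain N where N: "2 * \<rho> ^ Suc N / (1 - \<rho>) < \<eta> / 4"
    by (auto simp: eventually_sequentially)
  have m1: "cmod (m k) \<le> 1" for k unfolding m_def
    by (rule norm_integral_le) (auto intro!: continuous_intros simp: norm_power)
  define \<eta>' where "\<eta>' = \<eta> / (4 * (real N + 1))"
  have \<eta>': "\<eta>' > 0" using \<eta> by (simp add: \<eta>'_def)
  have "\<exists>B\<ge>0. \<forall>j. cmod (S k j) \<le> B + \<eta>' * real j" for k
  proof -
    have "\<forall>\<^sub>F n in sequentially. dist ((\<Sum>i=1..n. \<zeta> i ^ k) / of_nat n) (m k) < \<eta>'"
      using tendstoD[OF lim \<eta>'] by (simp add: m_def)
    then obtain J where J: "\<And>n. n \<ge> J \<Longrightarrow> dist ((\<Sum>i=1..n. \<zeta> i ^ k) / of_nat n) (m k) < \<eta>'"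
      by (auto simp: eventually_sequentially)
    have "cmod (S k j) \<le> 2 * real J + \<eta>' * real j" for j
    proof (cases "j \<ge> J \<and> j > 0")
      case True
      have "S k j = of_nat j * ((\<Sum>i=1..j. \<zeta> i ^ k) / of_nat j - m k)"
        using True by (simp add: S_def sum_subtractf field_simps)
      then have "cmod (S k j) = real j * dist ((\<Sum>i=1..j. \<zeta> i ^ k) / of_nat j) (m k)"
        by (simp add: norm_mult dist_norm)
      also have "\<dots> \<le> real j * \<eta>'" using J[of j] True by (intro mult_left_mono) auto
      finally show ?thesis by (simp add: mult.commute add_increasing)
    next
      case False
      then have "j \<le> J" by auto
      have "cmod (S k j) \<le> (\<Sum>i=1..j. 2)"
        unfolding S_def
      proof (rule sum_norm_le)
        fix i
        show "cmod (\<zeta> i ^ k - m k) \<le> 2"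
          using norm_triangle_ineq4[of "\<zeta> i ^ k" "m k"] m1[of k] \<zeta>[of i] by (simp add: norm_power)
      qed
      also have "\<dots> \<le> 2 * real J" using \<open>j \<le> J\<close> by simp
      finally show ?thesis using \<eta>' by (simp add: add_increasing2)
    qed
    then show ?thesis by (intro exI[of _ "2 * real J"]) auto
  qed
  then obtain B where B: "\<And>k. B k \<ge> 0" "\<And>k j. cmod (S k j) \<le> B k + \<eta>' * real j" by metis
  have main: "cmod (\<Sum>i=1..j. herglotz_kernel (\<zeta> i) x - herglotz \<nu> x) \<le> 2 * (\<Sum>k=1..N. B k) + \<eta> * real j"
    if x: "cmod x \<le> \<rho>" for j x
  proof -
    define K where "K = (\<lambda>z. 1 + 2 * (\<Sum>k=1..N. x ^ k * z ^ k))"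
    define q where "q = 1 + 2 * (\<Sum>k=1..N. x ^ k * m k)"
    have "x \<in> ball 0 1" using x \<rho> by simp
    have e1: "cmod (herglotz_kernel (\<zeta> i) x - K (\<zeta> i)) \<le> \<eta> / 4" for i
      using herglotz_kernel_partial_sum[OF \<zeta> x \<rho>(2), of i N] N by (simp add: K_def)
    have e2: "cmod (herglotz \<nu> x - q) \<le> \<eta> / 4"
      using herglotz_partial_sum[OF x \<rho>(2), of N] N by (simp add: q_def m_def)
    have split: "(\<Sum>i=1..j. herglotz_kernel (\<zeta> i) x - herglotz \<nu> x)
      = (\<Sum>i=1..j. (herglotz_kernel (\<zeta> i) x - K (\<zeta> i)) - (herglotz \<nu> x - q)) + (\<Sum>i=1..j. K (\<zeta> i) - q)"
      unfolding sum.distrib[symmetric] by (rule sum.cong) auto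
    have "cmod (\<Sum>i=1..j. (herglotz_kernel (\<zeta> i) x - K (\<zeta> i)) - (herglotz \<nu> x - q)) \<le> (\<Sum>i=1..j. \<eta> / 2)"
    proof (rule sum_norm_le)
      fix i
      show "cmod ((herglotz_kernel (\<zeta> i) x - K (\<zeta> i)) - (herglotz \<nu> x - q)) \<le> \<eta> / 2"
        using norm_triangle_ineq4[of "herglotz_kernel (\<zeta> i) x - K (\<zeta> i)" "herglotz \<nu> x - q"] e1[of i] e2 by linarith
    qed
    then have p1: "cmod (\<Sum>i=1..j. (herglotz_kernel (\<zeta> i) x - K (\<zeta> i)) - (herglotz \<nu> x - q)) \<le> \<eta> / 2 * real j"
      by (simp add: mult.commute)
    have "(\<Sum>i=1..j. K (\<zeta> i) - q) = (\<Sum>i=1..j. \<Sum>k=1..N. 2 * (x ^ k * (\<zeta> i ^ k - m k)))"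
      by (rule sum.cong) (auto simp: K_def q_def sum_distrib_left sum_subtractf right_diff_distrib)
    also have "\<dots> = (\<Sum>k=1..N. \<Sum>i=1..j. 2 * (x ^ k * (\<zeta> i ^ k - m k)))" by (rule sum.swap)
    also have "\<dots> = (\<Sum>k=1..N. 2 * x ^ k * S k j)"
      by (simp add: S_def sum_distrib_left mult.assoc)
    finally have "cmod (\<Sum>i=1..j. K (\<zeta> i) - q) = cmod (\<Sum>k=1..N. 2 * x ^ k * S k j)" by (rule arg_cong)
    also have "\<dots> \<le> (\<Sum>k=1..N. 2 * (B k + \<eta>' * real j))"
    proof (rule sum_norm_le)
      fix k
      have "cmod (2 * x ^ k * S k j) = 2 * (cmod x ^ k * cmod (S k j))" by (simp add: norm_mult norm_power)
      also have "\<dots> \<le> 2 * (1 * cmod (S k j))"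
        by (intro mult_left_mono mult_right_mono power_le_one) (use x \<rho> in auto)
      finally show "cmod (2 * x ^ k * S k j) \<le> 2 * (B k + \<eta>' * real j)" using B(2)[of k j] by simp
    qed
    also have "\<dots> = 2 * (\<Sum>k=1..N. B k) + 2 * real N * \<eta>' * real j"
      by (simp add: sum.distrib sum_distrib_left)
    also have "2 * real N * \<eta>' * real j \<le> \<eta> / 2 * real j"
      by (intro mult_right_mono) (use \<eta> in \<open>auto simp: \<eta>'_def field_simps\<close>)
    finally have p2: "cmod (\<Sum>i=1..j. K (\<zeta> i) - q) \<le> 2 * (\<Sum>k=1..N. B k) + \<eta> / 2 * real j" by simp
    show ?thesis unfolding split
      using norm_triangle_ineq[of "\<Sum>i=1..j. (herglotz_kernel (\<zeta> i) x - K (\<zeta> i)) - (herglotz \<nu> x - q)" "\<Sum>i=1..j. K (\<zeta> i) - q"] p1 p2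
      by simp
  qed
  show ?thesis
    by (rule exI[of _ "2 * (\<Sum>k=1..N. B k)"]) (use main B in \<open>auto intro!: sum_nonneg\<close>)
qed

end

text \<open>One null set serves all moments, as there are only countably many of them.\<close>

lemma moments_converge_AE:
  assumes \<nu>: "circle_measure \<nu>" and M: "prob_space M"
    and indep: "prob_space.indep_vars M (\<lambda>_. borel) \<theta> {1..}"
    and law: "\<And>j. j \<ge> 1 \<Longrightarrow> distr M (restrict_space borel (sphere 0 1)) (\<lambda>\<omega>. cis (\<theta> j \<omega>)) = \<nu>"
  shows "AE \<omega> in M. \<forall>k. (\<lambda>n. (\<Sum>i=1..n. cis (\<theta> i \<omega>) ^ k) / of_nat n) \<longlonglongrightarrow> (\<integral>\<zeta>. \<zeta> ^ k \<partial>\<nu>)"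
proof -
  interpret circle_measure \<nu> by (rule \<nu>)
  interpret M: prob_space M by (rule M)
  have [measurable]: "\<theta> j \<in> borel_measurable M" if "j \<ge> 1" for j
    using indep that by (auto simp: M.indep_vars_def)
  have cis_meas [measurable]: "cis \<in> borel_measurable borel"
    by (intro borel_measurable_continuous_onI continuous_intros)
  have mean: "M.expectation (\<lambda>\<omega>. L (cis (\<theta> j \<omega>) ^ k)) = L (\<integral>\<zeta>. \<zeta> ^ k \<partial>\<nu>)"
    if "bounded_linear L" "j \<ge> 1" for L :: "complex \<Rightarrow> real" and j k
  proof -
    have c: "continuous_on (sphere 0 1) (\<lambda>\<zeta>. L (\<zeta> ^ k))"
      by (intro continuous_intros bounded_linear.continuous_on[OF that(1)])
    have m: "(\<lambda>\<omega>. cis (\<theta> j \<omega>)) \<in> measurable M (restrict_space borel (sphere 0 1))"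
      by (rule measurable_restrict_space2) (use that in auto)
    have "L (\<integral>\<zeta>. \<zeta> ^ k \<partial>\<nu>) = (\<integral>\<zeta>. L (\<zeta> ^ k) \<partial>\<nu>)"
      by (rule integral_bounded_linear[OF that(1), symmetric]) (intro integrable_continuous continuous_intros)
    also have "\<dots> = (\<integral>\<zeta>. L (\<zeta> ^ k) \<partial>distr M (restrict_space borel (sphere 0 1)) (\<lambda>\<omega>. cis (\<theta> j \<omega>)))"
      by (simp add: law[OF that(2)])
    also have "\<dots> = M.expectation (\<lambda>\<omega>. L (cis (\<theta> j \<omega>) ^ k))"
      by (rule integral_distr[OF m borel_measurable_continuous_on_restrict[OF c]])
    finally show ?thesis ..
  qed
  have slln: "AE \<omega> in M. (\<lambda>n. (\<Sum>i=1..n. L (cis (\<theta> i \<omega>) ^ k)) / n) \<longlonglongrightarrow> L (\<integral>\<zeta>. \<zeta> ^ k \<partial>\<nu>)"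
    if L: "bounded_linear L" "\<And>z. \<bar>L z\<bar> \<le> cmod z" for L :: "complex \<Rightarrow> real" and k
  proof (rule M.strong_law_bounded)
    have "continuous_on UNIV (\<lambda>t. L (cis t ^ k))"
      by (intro continuous_intros bounded_linear.continuous_on[OF L(1)])
    then have "(\<lambda>t. L (cis t ^ k)) \<in> borel_measurable borel" by (rule borel_measurable_continuous_onI)
    then show "M.indep_vars (\<lambda>_. borel) (\<lambda>i \<omega>. L (cis (\<theta> i \<omega>) ^ k)) {1..}"
      by (intro M.indep_vars_compose2[OF indep]) auto
    show "L (cis (\<theta> i \<omega>) ^ k) \<in> {-1..1}" for i \<omega>
      using L(2)[of "cis (\<theta> i \<omega>) ^ k"] by (auto simp: norm_power abs_le_iff)
  qed (rule mean[OF L(1)])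
  have "AE \<omega> in M. \<forall>k. (\<lambda>n. (\<Sum>i=1..n. Re (cis (\<theta> i \<omega>) ^ k)) / n) \<longlonglongrightarrow> Re (\<integral>\<zeta>. \<zeta> ^ k \<partial>\<nu>)"
    by (subst AE_all_countable) (intro allI slln bounded_linear_Re abs_Re_le_cmod)
  moreover have "AE \<omega> in M. \<forall>k. (\<lambda>n. (\<Sum>i=1..n. Im (cis (\<theta> i \<omega>) ^ k)) / n) \<longlonglongrightarrow> Im (\<integral>\<zeta>. \<zeta> ^ k \<partial>\<nu>)"
    by (subst AE_all_countable) (intro allI slln bounded_linear_Im abs_Im_le_cmod)
  ultimately show ?thesis
  proof eventually_elim
    case (elim \<omega>)
    show ?case
    proof
      fix k
      show "(\<lambda>n. (\<Sum>i=1..n. cis (\<theta> i \<omega>) ^ k) / of_nat n) \<longlonglongrightarrow> (\<integral>\<zeta>. \<zeta> ^ k \<partial>\<nu>)"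
        unfolding tendsto_complex_iff using elim
        by (simp add: Re_divide_of_nat Im_divide_of_nat)
    qed
  qed
qed


section \<open>Compositions and the Loewner equation\<close>

lemma norm_exp_minus_one_plus_le:
  assumes "0 \<le> Re z"
  shows "cmod (exp (- z) - 1 + z) \<le> (cmod z)\<^sup>2"
proof -
  have "norm ((exp (- z) + z) - (exp (- 0) + 0)) \<le> cmod z * norm (z - 0)"
  proof (rule field_differentiable_bound[where S = "closed_segment 0 z" and f' = "\<lambda>w. 1 - exp (- w)"])
    fix w assume w: "w \<in> closed_segment 0 z"
    then obtain u where u: "0 \<le> u" "u \<le> 1" "w = u *\<^sub>R z" by (auto simp: closed_segment_def)
    show "((\<lambda>w. exp (- w) + w) has_field_derivative 1 - exp (- w)) (at w within closed_segment 0 z)"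
      by (auto intro!: derivative_eq_intros)
    have "cmod (1 - exp (- w)) \<le> cmod w"
      using norm_exp_minus_one_le[of w] assms u by (simp add: norm_minus_commute)
    also have "\<dots> \<le> cmod z" using u by (simp add: mult_left_le_one_le)
    finally show "cmod (1 - exp (- w)) \<le> cmod z" .
  qed auto
  then show ?thesis by (simp add: power2_eq_square algebra_simps)
qed

lemma deriv_bound_of_bound:
  assumes hol: "G holomorphic_on ball 0 1" and "cmod x \<le> \<rho>" "0 < g" "\<rho> + g < 1"
    and B: "\<And>w. cmod w \<le> \<rho> + g \<Longrightarrow> cmod (G w) \<le> B"
  shows "cmod (deriv G x) \<le> B / g"
proof -
  have near: "cmod w \<le> \<rho> + g" if "dist x w \<le> g" for w
    using that assms(2) norm_triangle_ineq4[of x "x - w"] by (simp add: dist_norm)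
  then have sub: "cball x g \<subseteq> ball 0 1" using assms(4) by (force simp: subset_iff)
  have "cmod ((deriv ^^ 1) G x) \<le> fact 1 * B / g ^ 1"
  proof (rule Cauchy_inequality)
    show "continuous_on (cball x g) G"
      using sub by (rule continuous_on_subset[OF holomorphic_on_imp_continuous_on[OF hol]])
    show "G holomorphic_on ball x g"
      using sub by (intro holomorphic_on_subset[OF hol]) auto
    show "cmod (G w) \<le> B" if "cmod (x - w) = g" for w
      by (rule B, rule near) (use that in \<open>simp add: dist_norm\<close>)
  qed fact
  then show ?thesis by simp
qed

text \<open>With Cauchy's estimate, a bound on a slightly larger disk yields a Lipschitz constant. For the sums of
kernels this turns a bound \<open>o(j)\<close> into Lipschitz constants \<open>o(j)\<close>.\<close>

lemma lipschitz_of_bound: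
  assumes hol: "G holomorphic_on ball 0 1" and xy: "cmod x \<le> \<rho>" "cmod y \<le> \<rho>" and g: "0 < g" "\<rho> + g < 1"
    and B: "\<And>w. cmod w \<le> \<rho> + g \<Longrightarrow> cmod (G w) \<le> B"
  shows "cmod (G x - G y) \<le> B / g * cmod (x - y)"
proof (rule field_differentiable_bound[where S = "cball 0 \<rho>" and f' = "deriv G"])
  fix w :: complex assume w: "w \<in> cball 0 \<rho>"
  then show "cmod (deriv G w) \<le> B / g" by (intro deriv_bound_of_bound[OF hol _ g B]) auto
  have "(G has_field_derivative deriv G w) (at w)"
    by (rule holomorphic_derivI[OF hol]) (use w g in auto)
  then show "(G has_field_derivative deriv G w) (at w within cball 0 \<rho>)" by (rule has_field_derivative_at_within)
qed (use xy in auto)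

lemma vector_derivative_bound:
  fixes f :: "real \<Rightarrow> 'a::real_normed_vector"
  assumes "convex S" "\<And>u. u \<in> S \<Longrightarrow> (f has_vector_derivative f' u) (at u within S)"
    "\<And>u. u \<in> S \<Longrightarrow> norm (f' u) \<le> B" "s \<in> S" "t \<in> S"
  shows "norm (f s - f t) \<le> B * \<bar>s - t\<bar>"
proof -
  have "norm (f s - f t) \<le> B * norm (s - t)"
  proof (rule differentiable_bound[OF assms(1)])
    fix u assume u: "u \<in> S"
    show "(f has_derivative (\<lambda>h. h *\<^sub>R f' u)) (at u within S)"
      using assms(2)[OF u] by (simp add: has_vector_derivative_def)
    show "onorm (\<lambda>h. h *\<^sub>R f' u) \<le> B"
    proof (rule onorm_le)
      show "norm (h *\<^sub>R f' u) \<le> B * norm h" for h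
        using mult_right_mono[OF assms(3)[OF u], of "\<bar>h\<bar>"] by (simp add: mult.commute)
    qed
  qed (use assms in auto)
  then show ?thesis by simp
qed

text \<open>The error terms collected in \<open>one_step\<close>; since \<open>g \<le> 1/4\<close>, all powers of \<open>1/g\<close> are dominated by the fourth.\<close>

lemma one_step_error_bound:
  fixes c \<epsilon> M g :: real
  assumes "0 < c" "0 \<le> \<epsilon>" "0 \<le> M" "0 < g" "g \<le> 1 / 4"
  shows "(1 / g\<^sup>2 * (c / g)\<^sup>2 + 1 / g * (c\<^sup>2 / g\<^sup>2 + c * \<epsilon>)) + 1 / (2 * g ^ 4) * c\<^sup>2
     + c * (c / g ^ 4) + c * (4 * (c * M / g ^ 3)) \<le> c * (4 / g ^ 4 * (c + \<epsilon> + c * M))"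
proof -
  define u where "u = 1 / g"
  have u: "4 \<le> u" using assms by (simp add: u_def field_simps)
  have t: "1 / g\<^sup>2 * (c / g)\<^sup>2 = c * (u ^ 4 * c)" "1 / g * (c\<^sup>2 / g\<^sup>2 + c * \<epsilon>) = c * (u ^ 3 * c) + c * (u * \<epsilon>)"
    "1 / (2 * g ^ 4) * c\<^sup>2 = c * (u ^ 4 * c) / 2" "c * (c / g ^ 4) = c * (u ^ 4 * c)"
    "c * (4 * (c * M / g ^ 3)) = c * (4 * (u ^ 3 * (c * M)))"
    "c * (4 / g ^ 4 * (c + \<epsilon> + c * M)) = c * (4 * (u ^ 4 * c)) + c * (4 * (u ^ 4 * \<epsilon>)) + c * (4 * (u ^ 4 * (c * M)))"
    by (simp_all add: u_def power2_eq_square power3_eq_cube power4_eq_xxxx distrib_left add_divide_distrib)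
  have "u ^ 3 * 4 \<le> u ^ 3 * u" using u by (intro mult_left_mono) auto
  then have i3: "4 * u ^ 3 \<le> u ^ 4" by (simp add: power3_eq_cube power4_eq_xxxx)
  have i1: "u \<le> u ^ 4" using u power_increasing[of 1 4 u] by simp
  have "4 * u ^ 3 * c \<le> u ^ 4 * c" "u * \<epsilon> \<le> u ^ 4 * \<epsilon>" "4 * u ^ 3 * (c * M) \<le> u ^ 4 * (c * M)"
    "0 \<le> u ^ 4 * c" "0 \<le> u ^ 4 * \<epsilon>" "0 \<le> u ^ 4 * (c * M)"
    by (intro mult_right_mono i1 i3 mult_nonneg_nonneg zero_le_power; use u assms in simp)+
  then have "u ^ 4 * c + u ^ 3 * c + u * \<epsilon> + u ^ 4 * c / 2 + u ^ 4 * c + 4 * (u ^ 3 * (c * M))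
     \<le> 4 * (u ^ 4 * c) + 4 * (u ^ 4 * \<epsilon>) + 4 * (u ^ 4 * (c * M))" by linarith
  from mult_left_mono[OF this less_imp_le[OF assms(1)]] show ?thesis
    unfolding t by (simp add: distrib_left)
qed

text \<open>A solution of the Loewner equation in the coordinate \<open>1/z\<close>. The bound \<open>|F| \<le> 1\<close> alone controls all
derivatives of \<open>F\<close> in space, and through the equation also its dependence on time.\<close>

locale loewner_disk =
  fixes F :: "real \<Rightarrow> complex \<Rightarrow> complex" and q :: "complex \<Rightarrow> complex"
  assumes F_hol: "\<And>t. 0 \<le> t \<Longrightarrow> F t holomorphic_on ball 0 1"
    and F_bound: "\<And>t x. 0 \<le> t \<Longrightarrow> cmod x < 1 \<Longrightarrow> cmod (F t x) \<le> 1"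
    and F_pde: "\<And>t x. 0 \<le> t \<Longrightarrow> cmod x < 1 \<Longrightarrow>
       ((\<lambda>s. F s x) has_vector_derivative - (x * deriv (F t) x * q x)) (at t within {0..})"
    and F_0: "\<And>x. cmod x < 1 \<Longrightarrow> F 0 x = x"
    and q_hol: "q holomorphic_on ball 0 1"
    and q_bound: "\<And>x \<rho>. cmod x \<le> \<rho> \<Longrightarrow> \<rho> < 1 \<Longrightarrow> cmod (q x) \<le> 2 / (1 - \<rho>)"
begin

text \<open>The disk of radius \<open>\<rho>\<close> is followed by three larger ones at distance \<open>g\<close> from each other, all inside the unit
disk. Each use of Cauchy's estimate passes to the next smaller disk and costs a factor \<open>1/g\<close>.\<close>

context
  fixes \<rho> g :: real
  assumes \<rho>: "0 \<le> \<rho>" "\<rho> < 1" and g_def: "g = (1 - \<rho>) / 4"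
begin

lemma g_pos: "0 < g" "g \<le> 1 / 4" and g_eq: "1 - \<rho> = 4 * g"
  using \<rho> by (auto simp: g_def)

lemma g_small: "\<rho> + g < 1" "\<rho> + 2 * g < 1" "\<rho> + g + g < 1" "\<rho> + 2 * g + g < 1"
proof -
  have "\<rho> = 1 - 4 * g" using g_eq by linarith
  then show "\<rho> + g < 1" "\<rho> + 2 * g < 1" "\<rho> + g + g < 1" "\<rho> + 2 * g + g < 1"
    using g_pos by simp_all
qed

lemma F_deriv_bound:
  assumes "0 \<le> t" "cmod x \<le> \<rho> + 2 * g"
  shows "cmod (deriv (F t) x) \<le> 1 / g"
  by (rule deriv_bound_of_bound[OF F_hol assms(2)])
     (use assms g_pos g_small in \<open>auto intro!: F_bound\<close>)

lemma F_lipschitz_time: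
  assumes "0 \<le> s" "0 \<le> t" "cmod x \<le> \<rho> + 2 * g"
  shows "cmod (F s x - F t x) \<le> 1 / g\<^sup>2 * \<bar>s - t\<bar>"
proof (rule vector_derivative_bound[where S = "{0..}"])
  fix u :: real assume u: "u \<in> {0..}"
  have x1: "cmod x < 1" using assms(3) g_small by linarith
  show "((\<lambda>s. F s x) has_vector_derivative - (x * deriv (F u) x * q x)) (at u within {0..})"
    by (rule F_pde) (use u x1 in auto)
  have "cmod (q x) \<le> 2 / (1 - (\<rho> + 2 * g))" by (rule q_bound[OF assms(3) g_small(2)])
  also have "1 - (\<rho> + 2 * g) = 2 * g" using g_eq by linarith
  finally have q: "cmod (q x) \<le> 1 / g" by simp
  have "cmod (- (x * deriv (F u) x * q x)) = cmod x * cmod (deriv (F u) x) * cmod (q x)"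
    by (simp add: norm_mult)
  also have "\<dots> \<le> 1 * (1 / g) * (1 / g)"
    by (intro mult_mono F_deriv_bound q) (use x1 u assms g_pos in auto)
  finally show "cmod (- (x * deriv (F u) x * q x)) \<le> 1 / g\<^sup>2" by (simp add: power2_eq_square)
qed (use assms in auto)

lemma F_deriv_lipschitz_time:
  assumes "0 \<le> s" "0 \<le> t" "cmod x \<le> \<rho> + g"
  shows "cmod (deriv (F s) x - deriv (F t) x) \<le> 1 / g ^ 3 * \<bar>s - t\<bar>"
proof -
  have x1: "x \<in> ball 0 1" using assms(3) g_small by simp
  have d: "(F u) field_differentiable (at x)" if "0 \<le> u" for u
    using holomorphic_on_imp_differentiable_at[OF F_hol[OF that] open_ball x1] .
  have "cmod (deriv (\<lambda>w. F s w - F t w) x) \<le> (1 / g\<^sup>2 * \<bar>s - t\<bar>) / g"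
  proof (rule deriv_bound_of_bound[OF _ assms(3)])
    show "cmod (F s w - F t w) \<le> 1 / g\<^sup>2 * \<bar>s - t\<bar>" if "cmod w \<le> \<rho> + g + g" for w
      by (rule F_lipschitz_time) (use assms that in auto)
  qed (use assms g_pos g_small in \<open>auto intro!: holomorphic_intros F_hol\<close>)
  also have "deriv (\<lambda>w. F s w - F t w) x = deriv (F s) x - deriv (F t) x"
    by (rule deriv_diff) (use d assms in auto)
  finally show ?thesis by (simp add: power2_eq_square power3_eq_cube)
qed

lemma F_deriv_lipschitz_space:
  assumes "0 \<le> t" "cmod x \<le> \<rho>" "cmod y \<le> \<rho>"
  shows "cmod (deriv (F t) x - deriv (F t) y) \<le> 1 / g\<^sup>2 * cmod (x - y)"
proof -
  have "cmod (deriv (F t) x - deriv (F t) y) \<le> (1 / g) / g * cmod (x - y)"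
  proof (rule lipschitz_of_bound[OF _ assms(2,3)])
    show "cmod (deriv (F t) w) \<le> 1 / g" if "cmod w \<le> \<rho> + g" for w
      by (rule F_deriv_bound) (use assms that g_pos in auto)
  qed (use assms g_pos g_small in \<open>auto intro!: holomorphic_deriv F_hol\<close>)
  then show ?thesis by (simp add: power2_eq_square)
qed

lemma F_taylor_space:
  assumes "0 \<le> t" "cmod x \<le> \<rho>" "cmod y \<le> \<rho>"
  shows "cmod (F t y - F t x - deriv (F t) x * (y - x)) \<le> 1 / g\<^sup>2 * (cmod (y - x))\<^sup>2"
proof -
  have "cmod ((F t y - deriv (F t) x * y) - (F t x - deriv (F t) x * x)) \<le> (1 / g\<^sup>2 * cmod (y - x)) * cmod (y - x)"
  proof (rule field_differentiable_bound[where S = "closed_segment x y" and f' = "\<lambda>w. deriv (F t) w - deriv (F t) x"])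
    fix w assume w: "w \<in> closed_segment x y"
    have "closed_segment x y \<subseteq> cball 0 \<rho>" by (rule closed_segment_subset) (use assms in auto)
    then have w\<rho>: "cmod w \<le> \<rho>" using w by auto
    have "(F t has_field_derivative deriv (F t) w) (at w)"
      by (rule holomorphic_derivI[OF F_hol[OF assms(1)] open_ball]) (use w\<rho> \<rho> in auto)
    from DERIV_diff[OF this DERIV_cmult[OF DERIV_ident, where c = "deriv (F t) x"]]
    have "((\<lambda>y. F t y - deriv (F t) x * y) has_field_derivative deriv (F t) w - deriv (F t) x) (at w)" by simp
    then show "((\<lambda>y. F t y - deriv (F t) x * y) has_field_derivative deriv (F t) w - deriv (F t) x) (at w within closed_segment x y)"
      by (rule has_field_derivative_at_within)
    have "cmod (deriv (F t) w - deriv (F t) x) \<le> 1 / g\<^sup>2 * cmod (w - x)"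
      by (rule F_deriv_lipschitz_space) (use assms w\<rho> in auto)
    also have "\<dots> \<le> 1 / g\<^sup>2 * cmod (y - x)"
      using segment_bound(1)[OF w] by (intro mult_left_mono) (auto simp: norm_minus_commute)
    finally show "cmod (deriv (F t) w - deriv (F t) x) \<le> 1 / g\<^sup>2 * cmod (y - x)" .
  qed auto
  then show ?thesis by (simp add: algebra_simps power2_eq_square)
qed

lemma q_le: "cmod x \<le> \<rho> \<Longrightarrow> cmod (q x) \<le> 1 / (2 * g)"
  using q_bound[of x \<rho>] \<rho> by (simp add: g_eq)

text \<open>No second derivative in time is available; the equation itself shows that the time derivative is
Lipschitz in time, which is what a first-order expansion needs.\<close>

lemma F_taylor_time:
  assumes "0 \<le> s" "0 \<le> c" "cmod x \<le> \<rho>"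
  shows "cmod (F (s + c) x - F s x + of_real c * (x * deriv (F s) x * q x)) \<le> 1 / (2 * g ^ 4) * c\<^sup>2"
proof -
  define v where "v = x * deriv (F s) x * q x"
  have x1: "cmod x < 1" "cmod x \<le> 1" using assms \<rho> by auto
  have "cmod ((F (s + c) x + (s + c) *\<^sub>R v) - (F s x + s *\<^sub>R v)) \<le> (1 / (2 * g ^ 4) * c) * \<bar>(s + c) - s\<bar>"
  proof (rule vector_derivative_bound[where S = "{s..s+c}"])
    fix u assume u: "u \<in> {s..s+c}"
    have "((\<lambda>u. F u x) has_vector_derivative - (x * deriv (F u) x * q x)) (at u within {s..s+c})"
      by (rule has_vector_derivative_within_subset[OF F_pde]) (use u assms x1 in auto)
    then show "((\<lambda>u. F u x + u *\<^sub>R v) has_vector_derivative - (x * deriv (F u) x * q x) + v) (at u within {s..s+c})"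
      by (auto intro!: derivative_eq_intros)
    have "- (x * deriv (F u) x * q x) + v = x * (deriv (F s) x - deriv (F u) x) * q x"
      by (simp add: v_def algebra_simps)
    then have "cmod (- (x * deriv (F u) x * q x) + v) = cmod x * cmod (deriv (F s) x - deriv (F u) x) * cmod (q x)"
      by (simp add: norm_mult)
    also have "\<dots> \<le> 1 * (1 / g ^ 3 * \<bar>s - u\<bar>) * (1 / (2 * g))"
      by (intro mult_mono F_deriv_lipschitz_time q_le x1) (use assms u g_pos in auto)
    also have "\<dots> \<le> 1 * (1 / g ^ 3 * c) * (1 / (2 * g))"
      by (intro mult_mono mult_left_mono) (use assms u g_pos in auto)
    also have "\<dots> = 1 / (2 * g ^ 4) * c" by (simp add: power_numeral_reduce)
    finally show "cmod (- (x * deriv (F u) x * q x) + v) \<le> 1 / (2 * g ^ 4) * c" .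
  qed (use assms in auto)
  moreover have eq: "(F (s + c) x + (s + c) *\<^sub>R v) - (F s x + s *\<^sub>R v) = F (s + c) x - F s x + of_real c * v"
    by (simp add: algebra_simps scaleR_conv_of_real)
  ultimately show ?thesis unfolding eq v_def[symmetric] using assms(2) by (simp add: power2_eq_square mult.assoc)
qed

text \<open>The solution minus the correction term of the summation by parts. The sum of \<open>x F' (k\<^sub>j - q)\<close> is not
small termwise; subtracting \<open>c x F' D\<^sub>j\<close> absorbs it, because \<open>D\<^sub>j\<close> increases by \<open>k\<^sub>j - q\<close>
in step \<open>j\<close>.\<close>

definition corrected :: "real \<Rightarrow> real \<Rightarrow> (complex \<Rightarrow> complex) \<Rightarrow> complex \<Rightarrow> complex" where
  "corrected c t D x = F t x - of_real c * (x * deriv (F t) x * D x)"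

text \<open>One particle against one time step of length \<open>c\<close>. The first-order changes of \<open>F\<close> are \<open>- c x F' k\<close> in
space and \<open>- c x F' q\<close> in time; their difference is cancelled by the increment of the correction
term, and every other change is of second order.\<close>

lemma one_step:
  assumes s: "0 \<le> s" and c: "0 < c" "c \<le> 1" and \<epsilon>: "0 \<le> \<epsilon>" "\<epsilon> \<le> 1" and x: "cmod x \<le> \<rho>"
    and h: "0 \<le> Re h" "cmod (h - of_real c * k) \<le> c * \<epsilon>" and k: "cmod k \<le> 1 / (2 * g)"
    and D: "D holomorphic_on ball 0 1" "\<And>w. cmod w \<le> \<rho> + g \<Longrightarrow> cmod (D w) \<le> M"
  shows "cmod (corrected c s D (x * exp (- h)) - corrected c (s + c) (\<lambda>x. D x + (k - q x)) x)
     \<le> c * (4 / g ^ 4 * (c + \<epsilon> + c * M))"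
proof -
  define y where "y = x * exp (- h)"
  define a where "a = (\<lambda>t w. w * deriv (F t) w)"
  note gp = g_pos
  have x1: "cmod x \<le> 1" using x \<rho> by auto
  have M0: "0 \<le> M" using D(2)[of x] x gp norm_ge_zero[of "D x"] by (smt (verit))
  have "cmod y = cmod x * exp (- Re h)" by (simp add: y_def norm_mult)
  also have "\<dots> \<le> cmod x * 1" using h(1) by (intro mult_left_mono) auto
  finally have yx: "cmod y \<le> cmod x" by simp
  then have y: "cmod y \<le> \<rho>" "cmod y \<le> 1" using x x1 by auto
  have hc: "cmod h \<le> c / g"
  proof -
    have "cmod h \<le> cmod (h - of_real c * k) + cmod (of_real c * k)" using norm_triangle_ineq[of "h - of_real c * k" "of_real c * k"] by simp
    also have "\<dots> \<le> c * 1 + c * (1 / (2 * g))"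
    proof -
      have "c * \<epsilon> \<le> c * 1" using c \<epsilon> by (intro mult_left_mono) auto
      moreover have "cmod (of_real c * k) \<le> c * (1 / (2 * g))"
        using c mult_left_mono[OF k, of c] by (simp add: norm_mult)
      ultimately show ?thesis using h(2) by linarith
    qed
    also have "\<dots> = c * (1 + 1 / (2 * g))" by (simp add: algebra_simps)
    also have "\<dots> \<le> c * (1 / g)" using c gp by (intro mult_left_mono) (auto simp: field_simps)
    finally show ?thesis by simp
  qed
  have xyh: "cmod (y - x) \<le> c / g"
  proof -
    have "y - x = x * (exp (- h) - 1)" by (simp add: y_def algebra_simps)
    then have "cmod (y - x) \<le> 1 * cmod h"
      using mult_mono[OF x1 norm_exp_minus_one_le[OF h(1)]] by (simp add: norm_mult)
    then show ?thesis using hc by simp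
  qed
  have lin: "cmod ((y - x) + of_real c * x * k) \<le> c\<^sup>2 / g\<^sup>2 + c * \<epsilon>"
  proof -
    have "(y - x) + of_real c * x * k = x * (exp (- h) - 1 + h) - x * (h - of_real c * k)"
      by (simp add: y_def algebra_simps)
    also have "cmod \<dots> \<le> cmod (x * (exp (- h) - 1 + h)) + cmod (x * (h - of_real c * k))" by (rule norm_triangle_ineq4)
    also have "\<dots> \<le> 1 * (cmod h)\<^sup>2 + 1 * (c * \<epsilon>)"
      unfolding norm_mult by (intro add_mono mult_mono norm_exp_minus_one_plus_le h x1) auto
    also have "(cmod h)\<^sup>2 \<le> (c / g)\<^sup>2" using hc by (intro power_mono) auto
    finally show ?thesis by (simp add: power_divide)
  qed
  \<comment> \<open>Moving the point from \<open>x\<close> to \<open>y\<close> changes \<open>F\<close> by \<open>- c a k\<close> to first order.\<close>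
  have e1: "cmod (F s y - F s x + of_real c * (a s x * k)) \<le> 1 / g\<^sup>2 * (c / g)\<^sup>2 + 1 / g * (c\<^sup>2 / g\<^sup>2 + c * \<epsilon>)"
  proof -
    have "F s y - F s x + of_real c * (a s x * k) =
       (F s y - F s x - deriv (F s) x * (y - x)) + deriv (F s) x * ((y - x) + of_real c * x * k)"
      by (simp add: a_def algebra_simps)
    also have "cmod \<dots> \<le> cmod (F s y - F s x - deriv (F s) x * (y - x)) + cmod (deriv (F s) x * ((y - x) + of_real c * x * k))"
      by (rule norm_triangle_ineq)
    also have "\<dots> \<le> 1 / g\<^sup>2 * (cmod (y - x))\<^sup>2 + 1 / g * (c\<^sup>2 / g\<^sup>2 + c * \<epsilon>)"
      unfolding norm_mult by (intro add_mono mult_mono F_taylor_space F_deriv_bound lin) (use s x y gp in auto)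
    also have "1 / g\<^sup>2 * (cmod (y - x))\<^sup>2 \<le> 1 / g\<^sup>2 * (c / g)\<^sup>2"
      using xyh by (intro mult_left_mono power_mono) auto
    finally show ?thesis by simp
  qed
  have e2: "cmod (F (s + c) x - F s x + of_real c * (a s x * q x)) \<le> 1 / (2 * g ^ 4) * c\<^sup>2"
    unfolding a_def by (rule F_taylor_time) (use s c x in auto)
  have da: "cmod (a (s + c) x - a s x) \<le> c / g ^ 3"
  proof -
    have "cmod (a (s + c) x - a s x) = cmod x * cmod (deriv (F (s + c)) x - deriv (F s) x)"
      unfolding a_def right_diff_distrib[symmetric] norm_mult ..
    also have "\<dots> \<le> 1 * (1 / g ^ 3 * \<bar>(s + c) - s\<bar>)"
      by (intro mult_mono x1 F_deriv_lipschitz_time) (use s c x gp in auto)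
    finally show ?thesis using c by simp
  qed
  have e3: "cmod ((a (s + c) x - a s x) * (k - q x)) \<le> c / g ^ 4"
  proof -
    have "cmod (k - q x) \<le> 1 / (2 * g) + 1 / (2 * g)" using norm_triangle_ineq4[of k "q x"] k q_le[OF x] by linarith
    then have "cmod (k - q x) \<le> 1 / g" using gp by (simp add: field_simps)
    then have "cmod ((a (s + c) x - a s x) * (k - q x)) \<le> (c / g ^ 3) * (1 / g)"
      unfolding norm_mult using da c gp by (intro mult_mono) auto
    then show ?thesis by (simp add: power_numeral_reduce mult_ac)
  qed
  \<comment> \<open>The correction term varies by \<open>O(c M)\<close> through its slowly varying factors; its prefactor \<open>c\<close> makes this second order.\<close>
  have e4: "cmod (a (s + c) x * D x - a s y * D y) \<le> 4 * (c * M / g ^ 3)"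
  proof -
    have "a (s + c) x * D x - a s y * D y = (a (s + c) x - a s x) * D x + x * (deriv (F s) x - deriv (F s) y) * D x
        + (x - y) * deriv (F s) y * D x + y * deriv (F s) y * (D x - D y)"
      by (simp add: a_def algebra_simps)
    also have "cmod \<dots> \<le> cmod ((a (s + c) x - a s x) * D x) + cmod (x * (deriv (F s) x - deriv (F s) y) * D x)
        + cmod ((x - y) * deriv (F s) y * D x) + cmod (y * deriv (F s) y * (D x - D y))"
      by (intro norm_triangle_mono order_refl)
    also have "\<dots> \<le> c / g ^ 3 * M + 1 * (1 / g\<^sup>2 * (c / g)) * M + c / g * (1 / g) * M + 1 * (1 / g) * (M / g * (c / g))"
    proof -
      have DM: "cmod (D x) \<le> M" using D(2) x gp by auto
      have 1: "cmod (deriv (F s) x - deriv (F s) y) \<le> 1 / g\<^sup>2 * (c / g)"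
      proof -
        have "cmod (deriv (F s) x - deriv (F s) y) \<le> 1 / g\<^sup>2 * cmod (x - y)"
          by (rule F_deriv_lipschitz_space) (use s x y in auto)
        also have "\<dots> \<le> 1 / g\<^sup>2 * (c / g)" using xyh by (intro mult_left_mono) (auto simp: norm_minus_commute)
        finally show ?thesis .
      qed
      have 2: "cmod (D x - D y) \<le> M / g * (c / g)"
      proof -
        have "cmod (D x - D y) \<le> M / g * cmod (x - y)"
          by (rule lipschitz_of_bound[OF D(1) x y(1) gp(1) g_small(1) D(2)])
        also have "\<dots> \<le> M / g * (c / g)" using xyh M0 gp by (intro mult_left_mono) (auto simp: norm_minus_commute)
        finally show ?thesis .
      qed
      have 3: "cmod (x - y) \<le> c / g" using xyh by (simp add: norm_minus_commute)
      have 4: "cmod (deriv (F s) y) \<le> 1 / g" by (rule F_deriv_bound) (use s y gp in auto)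
      show ?thesis
        unfolding norm_mult
        by (intro add_mono mult_mono da DM x1 y 1 2 3 4) (use c gp M0 in auto)
    qed
    also have "\<dots> \<le> 4 * (c * M / g ^ 3)"
    proof -
      have t: "1 * (1 / g\<^sup>2 * (c / g)) * M = c * M / g ^ 3" "c / g ^ 3 * M = c * M / g ^ 3"
        "1 * (1 / g) * (M / g * (c / g)) = c * M / g ^ 3"
        by (simp_all add: power2_eq_square power3_eq_cube mult_ac)
      have "c / g * (1 / g) * M \<le> c * M / g ^ 3"
      proof -
        have "c / g * (1 / g) * M = c * M * (1 / g\<^sup>2)" by (simp add: power2_eq_square)
        also have "\<dots> \<le> c * M * (1 / g ^ 3)"
          using c M0 gp by (intro mult_left_mono divide_left_mono power_decreasing) auto
        finally show ?thesis by simp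
      qed
      moreover have "A + A + B + A \<le> 4 * A" if "B \<le> A" for A B :: real using that by simp
      ultimately show ?thesis unfolding t by blast
    qed
    finally show ?thesis .
  qed
  define E1 where "E1 = F s y - F s x + of_real c * (a s x * k)"
  define E2 where "E2 = F (s + c) x - F s x + of_real c * (a s x * q x)"
  define E3 where "E3 = (a (s + c) x - a s x) * (k - q x)"
  define E4 where "E4 = a (s + c) x * D x - a s y * D y"
  have eq: "corrected c s D y - corrected c (s + c) (\<lambda>x. D x + (k - q x)) x = E1 - E2 + of_real c * E3 + of_real c * E4"
    by (simp add: corrected_def a_def E1_def E2_def E3_def E4_def algebra_simps)
  have n: "cmod (of_real c * z) = c * cmod z" for z using c by (simp add: norm_mult)
  have "cmod (E1 - E2 + of_real c * E3 + of_real c * E4) \<le> cmod E1 + cmod E2 + c * cmod E3 + c * cmod E4"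
    using norm_triangle_ineq4[of E1 E2] norm_triangle_ineq[of "E1 - E2" "of_real c * E3"]
      norm_triangle_ineq[of "E1 - E2 + of_real c * E3" "of_real c * E4"]
    unfolding n by linarith
  also have "\<dots> \<le> (1 / g\<^sup>2 * (c / g)\<^sup>2 + 1 / g * (c\<^sup>2 / g\<^sup>2 + c * \<epsilon>)) + 1 / (2 * g ^ 4) * c\<^sup>2
     + c * (c / g ^ 4) + c * (4 * (c * M / g ^ 3))"
    using add_mono[OF add_mono[OF add_mono[OF e1 e2] mult_left_mono[OF e3]] mult_left_mono[OF e4], of c c] c
    unfolding E1_def E2_def E3_def E4_def by linarith
  also have "\<dots> \<le> c * (4 / g ^ 4 * (c + \<epsilon> + c * M))"
    by (rule one_step_error_bound[OF c(1) \<epsilon>(1) M0 gp])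
  finally show ?thesis unfolding eq[unfolded y_def] .
qed

text \<open>Induction on \<open>n\<close>. The innermost map has index \<open>n\<close>, so \<open>\<Phi>\<^sub>n\<^sub>+\<^sub>1(x)\<close> is \<open>\<Phi>\<^sub>n\<close> at the image of \<open>x\<close>, and
the one-step errors add up. The maps contract, so the points never leave the disk of radius \<open>\<rho>\<close>.\<close>

lemma composition_estimate:
  fixes \<phi> h k :: "nat \<Rightarrow> complex \<Rightarrow> complex" and \<Phi> :: "nat \<Rightarrow> complex \<Rightarrow> complex"
  assumes c: "0 < c" "c \<le> 1" and \<epsilon>: "0 \<le> \<epsilon>" "\<epsilon> \<le> 1"
    and \<phi>: "\<And>j x. cmod x \<le> \<rho> \<Longrightarrow> \<phi> j x = x * exp (- h j x)"
    and h: "\<And>j x. cmod x \<le> \<rho> \<Longrightarrow> 0 \<le> Re (h j x)"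
       "\<And>j x. cmod x \<le> \<rho> \<Longrightarrow> cmod (h j x - of_real c * k j x) \<le> c * \<epsilon>"
    and k: "\<And>j. k j holomorphic_on ball 0 1" "\<And>j x. cmod x \<le> \<rho> \<Longrightarrow> cmod (k j x) \<le> 2 / (1 - \<rho>)"
    and D: "\<And>j w. j \<le> n \<Longrightarrow> cmod w \<le> \<rho> + g \<Longrightarrow> cmod (\<Sum>i=1..j. k i w - q w) \<le> M"
    and \<Phi>: "\<And>x. \<Phi> 0 x = x" "\<And>j x. \<Phi> (Suc j) x = \<Phi> j (\<phi> (Suc j) x)"
    and x: "cmod x \<le> \<rho>"
  shows "cmod (\<Phi> n x - F (c * real n) x) \<le> real n * c * (4 / g ^ 4 * (c + \<epsilon> + c * M)) + c * M / g"
proof -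
  define D where "D = (\<lambda>j w. \<Sum>i=1..j. k i w - q w)"
  have D_hol: "D j holomorphic_on ball 0 1" for j
    unfolding D_def by (intro holomorphic_intros k q_hol)
  define K where "K = c * (4 / g ^ 4 * (c + \<epsilon> + c * M))"
  have "cmod (\<Phi> j x - corrected c (c * real j) (D j) x) \<le> real j * K"
    if "j \<le> n" "cmod x \<le> \<rho>" for j x
    using that
  proof (induction j arbitrary: x)
    case 0
    then show ?case using \<rho> by (simp add: \<Phi> corrected_def D_def F_0)
  next
    case (Suc j)
    have y: "\<phi> (Suc j) x = x * exp (- h (Suc j) x)" using \<phi> Suc.prems by auto
    have "cmod (\<phi> (Suc j) x) = cmod x * exp (- Re (h (Suc j) x))" by (simp add: y norm_mult)
    also have "\<dots> \<le> cmod x * 1" using h(1)[of x "Suc j"] Suc.prems by (intro mult_left_mono) auto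
    finally have y\<rho>: "cmod (\<phi> (Suc j) x) \<le> \<rho>" using Suc.prems by simp
    have 1: "cmod (\<Phi> j (\<phi> (Suc j) x) - corrected c (c * real j) (D j) (\<phi> (Suc j) x)) \<le> real j * K"
      by (rule Suc.IH) (use Suc.prems y\<rho> in auto)
    have "cmod (corrected c (c * real j) (D j) (x * exp (- h (Suc j) x))
        - corrected c (c * real j + c) (\<lambda>w. D j w + (k (Suc j) x - q w)) x) \<le> K"
      unfolding K_def
    proof (rule one_step)
      show "cmod (k (Suc j) x) \<le> 1 / (2 * g)" using k(2)[of x "Suc j"] Suc.prems by (simp add: g_eq)
      show "cmod (D j w) \<le> M" if "cmod w \<le> \<rho> + g" for w
        using D[of j w] that Suc.prems by (simp add: D_def)
    qed (use Suc.prems c \<epsilon> h D_hol in auto)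
    also have "corrected c (c * real j + c) (\<lambda>w. D j w + (k (Suc j) x - q w)) x = corrected c (c * real (Suc j)) (D (Suc j)) x"
      by (simp add: corrected_def D_def algebra_simps)
    finally have 2: "cmod (corrected c (c * real j) (D j) (\<phi> (Suc j) x) - corrected c (c * real (Suc j)) (D (Suc j)) x) \<le> K"
      by (simp only: y)
    show ?case
      unfolding \<Phi>(2) using norm_triangle_ineq[of "\<Phi> j (\<phi> (Suc j) x) - corrected c (c * real j) (D j) (\<phi> (Suc j) x)"
         "corrected c (c * real j) (D j) (\<phi> (Suc j) x) - corrected c (c * real (Suc j)) (D (Suc j)) x"] 1 2
      by (simp add: distrib_right)
  qed
  from this[OF order_refl x] have 1: "cmod (\<Phi> n x - corrected c (c * real n) (D n) x) \<le> real n * c * (4 / g ^ 4 * (c + \<epsilon> + c * M))"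
    by (simp add: K_def mult.assoc)
  have "cmod (corrected c (c * real n) (D n) x - F (c * real n) x) = c * (cmod x * cmod (deriv (F (c * real n)) x) * cmod (D n x))"
    using c by (simp add: corrected_def norm_mult)
  also have "\<dots> \<le> c * (1 * (1 / g) * M)"
  proof -
    have DM: "cmod (D n x) \<le> M" using D[of n x] x g_pos by (simp add: D_def)
    then show ?thesis
      by (intro mult_left_mono mult_mono F_deriv_bound) (use c x \<rho> g_pos in auto)
  qed
  finally have 2: "cmod (corrected c (c * real n) (D n) x - F (c * real n) x) \<le> c * M / g" by simp
  show ?thesis
    using norm_triangle_ineq[of "\<Phi> n x - corrected c (c * real n) (D n) x" "corrected c (c * real n) (D n) x - F (c * real n) x"] 1 2
    by simp
qed

end

end


section \<open>The cluster and the Loewner chain in the disk\<close>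

text \<open>At time 0 the hull is the closed unit disk, since \<open>f\<^sub>0\<close> is the identity; by monotonicity all later
hulls contain it. Hence \<open>f\<^sub>t\<close> maps \<open>D0\<close> into itself and its transform maps the disk into itself. The equation
is the chain rule for \<open>1/z\<close>.\<close>

lemma loewner_kufarev_disk:
  assumes \<nu>: "circle_measure \<nu>" and f: "loewner_kufarev_solution \<nu> f"
  shows "loewner_disk (\<lambda>t. disk_map (f t)) (herglotz \<nu>)"
    and "\<And>t z. 0 \<le> t \<Longrightarrow> 1 < cmod z \<Longrightarrow> f t z \<noteq> 0"
proof -
  interpret circle_measure \<nu> by (rule \<nu>)
  obtain K where mono: "mono_on {0..} K"
    and conf: "\<And>t. 0 \<le> t \<Longrightarrow> normalized_conformal (f t) (- Fin ` K t)"
    using f unfolding loewner_kufarev_solution_def by blast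
  have init: "\<And>z. 1 < cmod z \<Longrightarrow> f 0 z = z"
    and pde: "\<And>t z. 0 \<le> t \<Longrightarrow> 1 < cmod z \<Longrightarrow> ((\<lambda>s. f s z) has_vector_derivative
           z * deriv (f t) z * (\<integral>\<zeta>. (z + \<zeta>) / (z - \<zeta>) \<partial>\<nu>)) (at t within {0..})"
    using f unfolding loewner_kufarev_solution_def by blast+
  have "sphere_map (f 0) p = p" if "p \<in> D0" for p
    using that by (auto simp: D0_def init)
  then have "sphere_map (f 0) ` D0 = D0" by simp
  then have K0: "- Fin ` K 0 = D0"
    using conf[of 0] by (auto simp: normalized_conformal_def bij_betw_def)
  have sub: "- Fin ` K t \<subseteq> D0" if "0 \<le> t" for t
  proof -
    have "K 0 \<subseteq> K t" using mono_onD[OF mono, of 0 t] that by simp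
    then show ?thesis unfolding K0[symmetric] by blast
  qed
  have gt1: "1 < cmod (f t z)" if "0 \<le> t" "1 < cmod z" for t z
    by (rule normalized_conformal_exterior[OF conf[OF that(1)] sub[OF that(1)] that(2)])
  then show nz: "\<And>t z. 0 \<le> t \<Longrightarrow> 1 < cmod z \<Longrightarrow> f t z \<noteq> 0" by fastforce
  have hol: "disk_map (f t) holomorphic_on ball 0 1" if "0 \<le> t" for t
    using disk_conformal_disk_map[OF conf[OF that] sub[OF that]] by (simp add: disk_conformal_def)
  have inv1: "1 < cmod (inverse x)" if "cmod x < 1" "x \<noteq> 0" for x
    using that by (simp add: norm_inverse one_less_inverse_iff)
  show "loewner_disk (\<lambda>t. disk_map (f t)) (herglotz \<nu>)"
  proof
    fix t :: real and x :: complex assume t: "0 \<le> t" and x: "cmod x < 1"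
    show "cmod (disk_map (f t) x) \<le> 1"
    proof (cases "x = 0")
      case False
      then show ?thesis using gt1[OF t inv1[OF x False]] by (simp add: disk_map_def norm_inverse inverse_le_1_iff)
    qed (simp add: disk_map_def)
    show "((\<lambda>s. disk_map (f s) x) has_vector_derivative - (x * deriv (disk_map (f t)) x * herglotz \<nu> x)) (at t within {0..})"
    proof (cases "x = 0")
      case False
      define z where "z = inverse x"
      have z: "1 < cmod z" using inv1[OF x False] by (simp add: z_def)
      have fz: "f t z \<noteq> 0" using nz t z by blast
      have "(\<lambda>\<zeta>. (z + \<zeta>) / (z - \<zeta>)) = (\<lambda>\<zeta>. herglotz_kernel \<zeta> x)"
      proof
        fix \<zeta>
        have "(z + \<zeta>) / (z - \<zeta>) = (x * (z + \<zeta>)) / (x * (z - \<zeta>))" using False by simp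
        also have "x * (z + \<zeta>) = 1 + x * \<zeta>" using False by (simp add: z_def distrib_left)
        also have "x * (z - \<zeta>) = 1 - x * \<zeta>" using False by (simp add: z_def right_diff_distrib)
        finally show "(z + \<zeta>) / (z - \<zeta>) = herglotz_kernel \<zeta> x" by (simp add: herglotz_kernel_def)
      qed
      then have H: "(\<integral>\<zeta>. (z + \<zeta>) / (z - \<zeta>) \<partial>\<nu>) = herglotz \<nu> x" by (simp add: herglotz_def)
      define f' where "f' = deriv (f t) z"
      have "f t holomorphic_on {z. 1 < cmod z}" using conf[OF t] by (simp add: normalized_conformal_def)
      moreover have "open {z::complex. 1 < cmod z}" by (intro open_Collect_less continuous_intros)
      ultimately have "(f t has_field_derivative f') (at (inverse x))"
        unfolding f'_def z_def[symmetric] by (rule holomorphic_derivI) (use z in simp)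
      then have "((\<lambda>y. f t (inverse y)) has_field_derivative f' * - (inverse x * inverse x)) (at x)"
        by (rule DERIV_chain2) (use False in \<open>auto intro!: derivative_eq_intros simp: power2_eq_square\<close>)
      from DERIV_inverse_fun[OF this] fz
      have "((\<lambda>y. inverse (f t (inverse y))) has_field_derivative f' * z\<^sup>2 / (f t z)\<^sup>2) (at x)"
        by (simp add: z_def[symmetric] power2_eq_square divide_inverse mult_ac)
      then have "(disk_map (f t) has_field_derivative f' * z\<^sup>2 / (f t z)\<^sup>2) (at x)"
        by (rule has_field_derivative_transform_within_open[where S = "- {0}"]) (use False in \<open>auto simp: disk_map_def\<close>)
      then have dF: "deriv (disk_map (f t)) x = f' * z\<^sup>2 / (f t z)\<^sup>2" by (rule DERIV_imp_deriv)
      have "((\<lambda>s. f s z) has_vector_derivative z * f' * herglotz \<nu> x) (at t within {0..})"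
        using pde[OF t z] by (simp add: H f'_def)
      moreover have "(inverse has_field_derivative - (inverse (f t z) ^ Suc (Suc 0))) (at (f t z) within (\<lambda>s. f s z) ` {0..})"
        by (rule DERIV_inverse[OF fz])
      ultimately have "((inverse \<circ> (\<lambda>s. f s z)) has_vector_derivative (z * f' * herglotz \<nu> x) * - (inverse (f t z) ^ Suc (Suc 0))) (at t within {0..})"
        by (rule field_vector_diff_chain_within)
      moreover have "(z * f' * herglotz \<nu> x) * - (inverse (f t z) ^ Suc (Suc 0)) = - (x * (f' * z\<^sup>2 / (f t z)\<^sup>2) * herglotz \<nu> x)"
        using False by (simp add: z_def power2_eq_square divide_inverse)
      moreover have "(inverse \<circ> (\<lambda>s. f s z)) = (\<lambda>s. disk_map (f s) x)"
        using False by (simp add: disk_map_def z_def fun_eq_iff)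
      ultimately show ?thesis by (simp only: dF)
    qed (simp add: disk_map_def)
  next
    fix x :: complex assume x: "cmod x < 1"
    show "disk_map (f 0) x = x" using inv1[OF x] init by (auto simp: disk_map_def)
  qed (use hol holomorphic_herglotz norm_herglotz_le in auto)
qed

lemma foldr_comp_snoc: "foldr (\<circ>) (fs @ [g]) id = foldr (\<circ>) fs id \<circ> g"
proof -
  have "foldr (\<circ>) fs h = foldr (\<circ>) fs id \<circ> h" for h :: "'a \<Rightarrow> 'a"
    by (induction fs) (auto simp: o_assoc)
  from this[of "g"] show ?thesis by simp
qed

lemma cluster_map_Suc:
  "cluster_map P \<theta> (Suc n) = cluster_map P \<theta> n \<circ> rotated_map (\<theta> (Suc n)) (particle_map (P (Suc n)))"
  unfolding cluster_map_def by (simp add: foldr_comp_snoc del: foldr_append)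

lemma sphere_map_comp: "sphere_map (f \<circ> g) p = sphere_map f (sphere_map g p)"
  by (cases p) auto

lemma disk_map_rotated: "disk_map (rotated_map t f) x = cis (- t) * disk_map f (cis t * x)"
  by (simp add: disk_map_def rotated_map_def cis_inverse)

text \<open>The cluster map in the coordinate \<open>1/z\<close>, where the rotation by \<open>\<theta>\<close> becomes the rotation by \<open>-\<theta>\<close>.\<close>

primrec disk_cluster :: "complex set \<Rightarrow> (nat \<Rightarrow> real) \<Rightarrow> nat \<Rightarrow> complex \<Rightarrow> complex" where
  "disk_cluster P \<theta> 0 x = x"
| "disk_cluster P \<theta> (Suc n) x =
     disk_cluster P \<theta> n (cis (- \<theta> (Suc n)) * particle_disk_map P (cis (\<theta> (Suc n)) * x))"

lemma norm_particle_disk_map_less: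
  assumes "particle P" "cmod x < 1"
  shows "cmod (particle_disk_map P x) < 1"
  using particle_disk_map_conformal[OF assms(1)] assms(2) by (force simp: disk_conformal_def bij_betw_def)

lemma norm_disk_cluster_less:
  assumes "particle P" "cmod x < 1"
  shows "cmod (disk_cluster P \<theta> n x) < 1"
  using assms(2)
proof (induction n arbitrary: x)
  case (Suc n)
  have "cmod (cis (- \<theta> (Suc n)) * particle_disk_map P (cis (\<theta> (Suc n)) * x)) < 1"
    using norm_particle_disk_map_less[OF assms(1), of "cis (\<theta> (Suc n)) * x"] Suc.prems by (simp add: norm_mult)
  from Suc.IH[OF this] show ?case by simp
qed simp

lemma sphere_map_cluster:
  assumes P: "particle P" and "cmod x < 1"
  shows "sphere_map (cluster_map (\<lambda>_. P) \<theta> n) (sphere_chart x) = sphere_chart (disk_cluster P \<theta> n x)"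
  using assms(2)
proof (induction n arbitrary: x)
  case 0
  have "sphere_map id p = p" for p by (cases p) auto
  moreover have "cluster_map (\<lambda>_. P) \<theta> 0 = id" by (simp add: cluster_map_def)
  ultimately show ?case by (simp only: disk_cluster.simps)
next
  case (Suc n)
  let ?r = "rotated_map (\<theta> (Suc n)) (particle_map P)"
  have "sphere_map ?r (sphere_chart x) = sphere_chart (disk_map ?r x)"
  proof (rule sphere_map_chart)
    assume "x \<noteq> 0"
    then have "1 < cmod (cis (- \<theta> (Suc n)) * inverse x)"
      using Suc.prems by (simp add: norm_mult norm_inverse one_less_inverse_iff)
    from normalized_conformal_exterior[OF particle_map_conformal[OF P] _ this]
    show "?r (inverse x) \<noteq> 0" by (auto simp: rotated_map_def)
  qed
  also have "disk_map ?r x = cis (- \<theta> (Suc n)) * particle_disk_map P (cis (\<theta> (Suc n)) * x)"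
    by (simp add: disk_map_rotated particle_disk_map_def)
  finally have 1: "sphere_map ?r (sphere_chart x) = sphere_chart (cis (- \<theta> (Suc n)) * particle_disk_map P (cis (\<theta> (Suc n)) * x))" .
  have "cmod (cis (- \<theta> (Suc n)) * particle_disk_map P (cis (\<theta> (Suc n)) * x)) < 1"
    using norm_particle_disk_map_less[OF P, of "cis (\<theta> (Suc n)) * x"] Suc.prems by (simp add: norm_mult)
  from Suc.IH[OF this] show ?case by (simp only: cluster_map_Suc sphere_map_comp 1 disk_cluster.simps)
qed

lemma lcap_nonneg:
  assumes P: "particle P"
  shows "0 \<le> lcap P"
proof -
  have c: "0 < particle_cap P" "deriv (particle_disk_map P) 0 = of_real (inverse (particle_cap P))"
    using deriv_disk_map[OF particle_map_conformal[OF P] _ particle_cap_expansion[OF P]]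
    by (auto simp: particle_disk_map_def)
  have \<phi>: "particle_disk_map P holomorphic_on ball 0 1" "particle_disk_map P 0 = 0"
    using particle_disk_map_conformal[OF P] by (auto simp: disk_conformal_def)
  have "cmod (deriv (particle_disk_map P) 0) \<le> 1"
    by (rule Schwarz_Lemma(2)[OF \<phi> norm_particle_disk_map_less[OF P], of 0]) auto
  then have "\<bar>inverse (particle_cap P)\<bar> \<le> 1" by (simp only: c(2) norm_of_real)
  then have "inverse (particle_cap P) \<le> 1" by linarith
  then have "1 \<le> particle_cap P" using c(1) by (simp add: inverse_le_1_iff)
  then show ?thesis by (simp add: lcap_def)
qed


section \<open>Convergence\<close>

text \<open>The deterministic estimate with all constants explicit. Rounding \<open>T / c\<close> down costs at most one time step, hence
the last term.\<close>

lemma disk_cluster_estimate: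
  fixes \<theta> :: "nat \<Rightarrow> real"
  assumes LD: "loewner_disk F q" and \<rho>: "0 \<le> \<rho>" "\<rho> < 1" and g: "g = (1 - \<rho>) / 4"
    and P: "particle P" and d: "diameter P \<le> 1/4" "164 * diameter P / (1 - \<rho>)\<^sup>2 \<le> 1"
    and c: "0 < lcap P" "lcap P \<le> 1"
    and B: "\<And>j x. cmod x \<le> \<rho> + g \<Longrightarrow> cmod (\<Sum>i=1..j. herglotz_kernel (cis (\<theta> i)) x - q x) \<le> B + \<eta> * real j"
      "0 \<le> B" "0 \<le> \<eta>"
    and T: "0 < T" and n: "n = nat \<lfloor>inverse (lcap P) * T\<rfloor>"
    and x: "cmod x \<le> \<rho>"
  shows "cmod (disk_cluster P \<theta> n x - F T x)
     \<le> T * (4 / g ^ 4 * (lcap P + 164 * diameter P / (1 - \<rho>)\<^sup>2 + (lcap P * B + \<eta> * T)))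
       + (lcap P * B + \<eta> * T) / g + lcap P / g\<^sup>2"
proof -
  interpret loewner_disk F q by (rule LD)
  define c where "c = lcap P"
  define \<epsilon> where "\<epsilon> = 164 * diameter P / (1 - \<rho>)\<^sup>2"
  define M where "M = B + \<eta> * real n"
  note gp = g_pos[OF \<rho> g] and gs = g_small[OF \<rho> g]
  have c01: "0 < c" "c \<le> 1" using c by (auto simp: c_def)
  have d0: "0 < diameter P" using P by (simp add: particle_def)
  have \<epsilon>01: "0 \<le> \<epsilon>" "\<epsilon> \<le> 1" using d d0 by (auto simp: \<epsilon>_def)
  have pos: "0 \<le> inverse c * T" using c01 T by simp
  have "real n = of_int \<lfloor>inverse c * T\<rfloor>" using pos by (simp add: n c_def)
  then have "real n \<le> inverse c * T" "inverse c * T < real n + 1" by linarith+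
  then have cn: "c * real n \<le> T" "T - c * real n \<le> c"
    using c01 by (simp_all add: field_simps)
  obtain h where h: "\<And>x. x \<in> ball 0 1 \<Longrightarrow> particle_disk_map P x = x * exp (- h x) \<and> 0 \<le> Re (h x)"
    "\<And>\<rho> x. \<rho> < 1 \<Longrightarrow> cmod x \<le> \<rho> \<Longrightarrow> cmod (h x - of_real (lcap P) * ((1 + x) / (1 - x))) \<le> 164 * diameter P * lcap P / (1 - \<rho>)\<^sup>2"
    using particle_disk_map_estimate[OF P c(1) d(1)] by blast
  have "cmod (disk_cluster P \<theta> n x - F (c * real n) x) \<le> real n * c * (4 / g ^ 4 * (c + \<epsilon> + c * M)) + c * M / g"
  proof (rule composition_estimate[OF \<rho> g c01 \<epsilon>01, where
        \<phi> = "\<lambda>j x. cis (- \<theta> j) * particle_disk_map P (cis (\<theta> j) * x)" and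
        h = "\<lambda>j x. h (cis (\<theta> j) * x)" and k = "\<lambda>j. herglotz_kernel (cis (\<theta> j))"])
    fix j x assume x: "cmod x \<le> \<rho>"
    then have x1: "cis (\<theta> j) * x \<in> ball 0 1" using \<rho> by (simp add: norm_mult)
    have "cis (- \<theta> j) * (cis (\<theta> j) * x) = x" by (simp add: cis_mult flip: mult.assoc)
    then show "cis (- \<theta> j) * particle_disk_map P (cis (\<theta> j) * x) = x * exp (- h (cis (\<theta> j) * x))"
      using h(1)[OF x1] by (simp flip: mult.assoc)
    show "0 \<le> Re (h (cis (\<theta> j) * x))" using h(1)[OF x1] by blast
    have "cmod (h (cis (\<theta> j) * x) - of_real (lcap P) * ((1 + cis (\<theta> j) * x) / (1 - cis (\<theta> j) * x))) \<le> 164 * diameter P * lcap P / (1 - \<rho>)\<^sup>2"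
      by (rule h(2)[OF \<rho>(2)]) (use x in \<open>simp add: norm_mult\<close>)
    then show "cmod (h (cis (\<theta> j) * x) - of_real c * herglotz_kernel (cis (\<theta> j)) x) \<le> c * \<epsilon>"
      by (simp add: herglotz_kernel_def c_def \<epsilon>_def mult_ac)
    show "cmod (herglotz_kernel (cis (\<theta> j)) x) \<le> 2 / (1 - \<rho>)"
      by (rule norm_herglotz_kernel_le) (use x \<rho> in auto)
  next
    fix j
    have "1 - w * cis (\<theta> j) \<noteq> 0" if "cmod w < 1" for w
      using one_minus_mult_bound[of "cis (\<theta> j)" w "cmod w"] that by auto
    then show "herglotz_kernel (cis (\<theta> j)) holomorphic_on ball 0 1"
      unfolding herglotz_kernel_def by (intro holomorphic_intros) auto
  next
    fix j :: nat and w :: complex assume "j \<le> n" "cmod w \<le> \<rho> + g"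
    then show "cmod (\<Sum>i=1..j. herglotz_kernel (cis (\<theta> i)) w - q w) \<le> M"
      using B(1)[of w j] mult_left_mono[of "real j" "real n" \<eta>] B(3) by (simp add: M_def)
  qed (use x in auto)
  also have "\<dots> \<le> T * (4 / g ^ 4 * (c + \<epsilon> + (c * B + \<eta> * T))) + (c * B + \<eta> * T) / g"
  proof -
    have "c * M = c * B + \<eta> * (c * real n)" by (simp add: M_def algebra_simps)
    also have "\<dots> \<le> c * B + \<eta> * T" using mult_left_mono[OF cn(1) B(3)] by simp
    finally have cM: "c * M \<le> c * B + \<eta> * T" .
    have M0: "0 \<le> M" using B by (simp add: M_def)
    have "real n * c * (4 / g ^ 4 * (c + \<epsilon> + c * M)) \<le> T * (4 / g ^ 4 * (c + \<epsilon> + (c * B + \<eta> * T)))"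
      by (intro mult_mono mult_left_mono add_mono cM order_refl) (use cn c01 \<epsilon>01 M0 T gp in \<open>auto simp: mult.commute\<close>)
    moreover have "c * M / g \<le> (c * B + \<eta> * T) / g" using cM gp by (intro divide_right_mono) auto
    ultimately show ?thesis by linarith
  qed
  finally have 1: "cmod (disk_cluster P \<theta> n x - F (c * real n) x) \<le> T * (4 / g ^ 4 * (c + \<epsilon> + (c * B + \<eta> * T))) + (c * B + \<eta> * T) / g" .
  have "cmod (F (c * real n) x - F T x) \<le> 1 / g\<^sup>2 * \<bar>c * real n - T\<bar>"
    by (rule F_lipschitz_time[OF \<rho> g]) (use c01 T x gp in auto)
  also have "\<dots> \<le> 1 / g\<^sup>2 * c" using cn by (intro mult_left_mono) auto
  finally have 2: "cmod (F (c * real n) x - F T x) \<le> c / g\<^sup>2" by simp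
  show ?thesis
    using norm_triangle_ineq[of "disk_cluster P \<theta> n x - F (c * real n) x" "F (c * real n) x - F T x"] 1 2
    unfolding c_def \<epsilon>_def by simp
qed

text \<open>Compact subsets of \<open>D0\<close> may contain infinity; in the chart they are just compact subsets of the disk.\<close>

lemma compact_subset_D0:
  assumes "compact K" "K \<subseteq> D0"
  obtains \<rho> where "0 \<le> \<rho>" "\<rho> < 1" "K \<subseteq> sphere_chart ` cball 0 \<rho>"
proof -
  have K: "compact (chart_coord ` K)"
    by (rule compact_continuous_image[OF continuous_on_chart_coord assms(1)]) (use assms(2) Fin_0_notin_D0 in auto)
  have sub: "chart_coord ` K \<subseteq> ball 0 1" using assms(2) by (auto simp: D0_eq_chart)
  have in_image: "p \<in> sphere_chart ` cball 0 \<rho>" if "p \<in> K" "cmod (chart_coord p) \<le> \<rho>" for p \<rho>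
  proof -
    have "p \<noteq> Fin 0" using that(1) assms(2) Fin_0_notin_D0 by auto
    then have "sphere_chart (chart_coord p) = p" by (rule sphere_chart_chart_coord)
    then show ?thesis using that(2) by (intro image_eqI[of _ _ "chart_coord p"]) auto
  qed
  show ?thesis
  proof (cases "K = {}")
    case True
    then show ?thesis using that[of 0] by auto
  next
    case False
    then obtain z where z: "z \<in> chart_coord ` K" "\<And>y. y \<in> chart_coord ` K \<Longrightarrow> cmod y \<le> cmod z"
      using continuous_attains_sup[OF K, of cmod] by (auto intro: continuous_intros)
    have "cmod z < 1" using z(1) sub by auto
    moreover have "K \<subseteq> sphere_chart ` cball 0 (cmod z)" using z(2) in_image by blast
    ultimately show ?thesis using that[of "cmod z"] by simp
  qed
qed

text \<open>The chart is uniformly continuous on the closed disk, so uniform convergence in the coordinate \<open>1/z\<close> is uniform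
convergence in the chordal metric.\<close>

lemma uniform_limit_sphere_chart:
  assumes "uniform_limit S f l F"
    and "\<And>x. x \<in> S \<Longrightarrow> l x \<in> cball 0 1" "\<forall>\<^sub>F d in F. \<forall>x\<in>S. f d x \<in> cball 0 1"
  shows "uniform_limit S (\<lambda>d x. sphere_chart (f d x)) (\<lambda>x. sphere_chart (l x)) F"
proof (rule uniform_limitI)
  fix e :: real assume "e > 0"
  have "uniformly_continuous_on (cball 0 1) sphere_chart"
    by (intro compact_uniformly_continuous continuous_on_sphere_chart) auto
  then obtain \<delta> where \<delta>: "\<delta> > 0"
    "\<And>x y. x \<in> cball 0 1 \<Longrightarrow> y \<in> cball 0 1 \<Longrightarrow> dist y x < \<delta> \<Longrightarrow> dist (sphere_chart y) (sphere_chart x) < e"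
    using \<open>e > 0\<close> unfolding uniformly_continuous_on_def by metis
  from uniform_limitD[OF assms(1) \<delta>(1)] assms(3)
  show "\<forall>\<^sub>F d in F. \<forall>x\<in>S. dist (sphere_chart (f d x)) (sphere_chart (l x)) < e"
    by eventually_elim (use \<delta>(2) assms(2) in blast)
qed

text \<open>In the estimate, \<open>\<eta>\<close> is chosen first, so small that the terms with \<open>\<eta> T\<close> contribute less than \<open>e\<close>; then
\<open>B\<close> is a constant and all remaining terms vanish with \<open>d\<close> and \<open>c\<close>.\<close>

lemma disk_cluster_converges:
  fixes \<theta> :: "nat \<Rightarrow> real" and P :: "real \<Rightarrow> complex set"
  assumes \<nu>: "circle_measure \<nu>" and LD: "loewner_disk F (herglotz \<nu>)"
    and lim: "\<And>k. (\<lambda>n. (\<Sum>i=1..n. cis (\<theta> i) ^ k) / of_nat n) \<longlonglongrightarrow> (\<integral>\<zeta>. \<zeta> ^ k \<partial>\<nu>)"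
    and P: "\<And>d. 0 < d \<Longrightarrow> d \<le> 1 \<Longrightarrow> particle (P d) \<and> diameter (P d) = d"
    and cap: "(\<lambda>d. lcap (P d)) \<in> \<Theta>[at_right 0](\<lambda>d. d\<^sup>2)" and T: "0 < T"
    and \<rho>: "0 \<le> \<rho>" "\<rho> < 1"
  shows "uniform_limit (cball 0 \<rho>) (\<lambda>d. disk_cluster (P d) \<theta> (nat \<lfloor>inverse (lcap (P d)) * T\<rfloor>)) (F T) (at_right 0)"
proof (rule uniform_limitI)
  interpret circle_measure \<nu> by (rule \<nu>)
  fix e :: real assume e: "e > 0"
  define g where "g = (1 - \<rho>) / 4"
  have g: "0 < g" "\<rho> + g < 1" using \<rho> by (auto simp: g_def field_simps)
  \<comment> \<open>The coefficient of \<open>\<eta>\<close> in the limit of the bound.\<close>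
  define A where "A = T * (4 / g ^ 4) * T + T / g"
  have A: "0 < A" using T g by (auto simp: A_def intro!: add_pos_pos)
  define \<eta> where "\<eta> = e / (2 * A)"
  have \<eta>: "0 < \<eta>" "A * \<eta> < e" using e A by (auto simp: \<eta>_def)
  obtain B where B: "0 \<le> B" "\<And>j x. cmod x \<le> \<rho> + g \<Longrightarrow>
     cmod (\<Sum>i=1..j. herglotz_kernel (cis (\<theta> i)) x - herglotz \<nu> x) \<le> B + \<eta> * real j"
    using herglotz_sum_deviation[of "\<lambda>i. cis (\<theta> i)" "\<rho> + g" \<eta>] lim \<rho> g \<eta> by auto
  define c where "c = (\<lambda>d. lcap (P d))"
  define bnd where "bnd = (\<lambda>d. T * (4 / g ^ 4 * (c d + 164 * d / (1 - \<rho>)\<^sup>2 + (c d * B + \<eta> * T)))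
       + (c d * B + \<eta> * T) / g + c d / g\<^sup>2)"
  have d0: "((\<lambda>d::real. d) \<longlongrightarrow> 0) (at_right 0)" by (rule tendsto_ident_at)
  have c0: "(c \<longlongrightarrow> 0) (at_right 0)"
  proof -
    have "c \<in> O[at_right 0](\<lambda>d. d\<^sup>2)" using cap unfolding c_def by (rule bigthetaD1)
    then obtain C where "\<forall>\<^sub>F d in at_right 0. norm (c d) \<le> C * norm (d\<^sup>2)" by (elim landau_o.bigE) (rule that)
    moreover have "((\<lambda>d::real. C * norm (d\<^sup>2)) \<longlongrightarrow> C * norm (0\<^sup>2 :: real)) (at_right 0)"
      by (intro tendsto_intros)
    ultimately show ?thesis by (intro Lim_null_comparison[of c "\<lambda>d. C * norm (d\<^sup>2)"]) simp_all
  qed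
  have "(bnd \<longlongrightarrow> T * (4 / g ^ 4 * (0 + 164 * 0 / (1 - \<rho>)\<^sup>2 + (0 * B + \<eta> * T))) + (0 * B + \<eta> * T) / g + 0 / g\<^sup>2) (at_right 0)"
    unfolding bnd_def by (intro tendsto_intros c0 d0) (use g \<rho> in auto)
  moreover have "T * (4 / g ^ 4 * (0 + 164 * 0 / (1 - \<rho>)\<^sup>2 + (0 * B + \<eta> * T))) + (0 * B + \<eta> * T) / g + 0 / g\<^sup>2 = A * \<eta>"
    by (simp add: A_def algebra_simps)
  ultimately have ev_bnd: "\<forall>\<^sub>F d in at_right 0. bnd d < e" using order_tendstoD(2)[of bnd _ "at_right 0" e] \<eta>(2) by simp
  have "((\<lambda>d. 164 * d / (1 - \<rho>)\<^sup>2) \<longlongrightarrow> 164 * 0 / (1 - \<rho>)\<^sup>2) (at_right 0)"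
    by (intro tendsto_intros d0) (use \<rho> in auto)
  then have ev_\<epsilon>: "\<forall>\<^sub>F d in at_right 0. 164 * d / (1 - \<rho>)\<^sup>2 < 1" by (rule order_tendstoD) simp
  have ev_c: "\<forall>\<^sub>F d in at_right 0. c d < 1" using c0 by (rule order_tendstoD) simp
  have ev_d: "\<forall>\<^sub>F d in at_right (0::real). 0 < d \<and> d < 1 / 4"
    unfolding eventually_at_right_field by (rule exI[of _ "1 / 4"]) auto
  have ev_nz: "\<forall>\<^sub>F d in at_right 0. c d \<noteq> 0"
  proof -
    have "(\<lambda>d::real. d\<^sup>2) \<in> O[at_right 0](c)" using bigthetaD2[OF cap] by (simp add: bigomega_iff_bigo c_def)
    then obtain C where "\<forall>\<^sub>F d in at_right 0. norm (d\<^sup>2) \<le> C * norm (c d)" by (elim landau_o.bigE) (rule that)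
    with ev_d show ?thesis by eventually_elim auto
  qed
  show "\<forall>\<^sub>F d in at_right 0. \<forall>x\<in>cball 0 \<rho>. dist (disk_cluster (P d) \<theta> (nat \<lfloor>inverse (lcap (P d)) * T\<rfloor>) x) (F T x) < e"
    using ev_bnd ev_\<epsilon> ev_c ev_d ev_nz
  proof eventually_elim
    case (elim d)
    have Pd: "particle (P d)" "diameter (P d) = d" using P[of d] elim by auto
    have cd: "0 < lcap (P d)" using lcap_nonneg[OF Pd(1)] elim by (simp add: c_def)
    show ?case
    proof
      fix x :: complex assume "x \<in> cball 0 \<rho>"
      then have x: "cmod x \<le> \<rho>" by simp
      have "cmod (disk_cluster (P d) \<theta> (nat \<lfloor>inverse (lcap (P d)) * T\<rfloor>) x - F T x)
        \<le> T * (4 / g ^ 4 * (lcap (P d) + 164 * diameter (P d) / (1 - \<rho>)\<^sup>2 + (lcap (P d) * B + \<eta> * T)))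
       + (lcap (P d) * B + \<eta> * T) / g + lcap (P d) / g\<^sup>2"
        by (rule disk_cluster_estimate[OF LD \<rho> g_def Pd(1) _ _ cd _ B(2,1) _ T refl x])
           (use elim \<eta> Pd in \<open>auto simp: c_def\<close>)
      also have "\<dots> = bnd d" by (simp add: bnd_def c_def Pd)
      finally show "dist (disk_cluster (P d) \<theta> (nat \<lfloor>inverse (lcap (P d)) * T\<rfloor>) x) (F T x) < e"
        using elim by (simp add: dist_norm)
    qed
  qed
qed

theorem theorem2:
  fixes \<nu> :: "complex measure"
    and M :: "'w measure"
    and \<theta> :: "nat \<Rightarrow> 'w \<Rightarrow> real"
    and P :: "real \<Rightarrow> complex set"
    and f :: "real \<Rightarrow> complex \<Rightarrow> complex"
    and T :: real
  assumes "prob_space \<nu>" and "sets \<nu> = sets (restrict_space borel (sphere 0 1))"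
    and "prob_space M"
    and "prob_space.indep_vars M (\<lambda>_. borel) \<theta> {1..}"
    and "\<And>j. j \<ge> 1 \<Longrightarrow>
           distr M (restrict_space borel (sphere 0 1)) (\<lambda>\<omega>. cis (\<theta> j \<omega>)) = \<nu>"
    and "\<And>d. 0 < d \<Longrightarrow> d \<le> 1 \<Longrightarrow> particle (P d) \<and> diameter (P d) = d"
    and "(\<lambda>d. lcap (P d)) \<in> \<Theta>[at_right 0](\<lambda>d. d\<^sup>2)"
    and "0 < T"
    and "loewner_kufarev_solution \<nu> f"
  shows "AE \<omega> in M. \<forall>K. compact K \<and> K \<subseteq> D0 \<longrightarrow>
           uniform_limit K
             (\<lambda>d. sphere_map (cluster_map (\<lambda>_. P d) (\<lambda>j. \<theta> j \<omega>) (nat \<lfloor>inverse (lcap (P d)) * T\<rfloor>)))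
             (sphere_map (f T)) (at_right 0)"
proof -
  have \<nu>: "circle_measure \<nu>"
    using assms(1,2) by (simp add: circle_measure_def circle_measure_axioms_def)
  note LD = loewner_kufarev_disk(1)[OF \<nu> assms(9)] and f_nz = loewner_kufarev_disk(2)[OF \<nu> assms(9)]
  have "AE \<omega> in M. \<forall>k. (\<lambda>n. (\<Sum>i=1..n. cis (\<theta> i \<omega>) ^ k) / of_nat n) \<longlonglongrightarrow> (\<integral>\<zeta>. \<zeta> ^ k \<partial>\<nu>)"
    by (rule moments_converge_AE[OF \<nu> assms(3,4,5)])
  then show ?thesis
  proof eventually_elim
    case (elim \<omega>)
    let ?N = "\<lambda>d. nat \<lfloor>inverse (lcap (P d)) * T\<rfloor>"
    let ?\<Phi> = "\<lambda>d. sphere_map (cluster_map (\<lambda>_. P d) (\<lambda>j. \<theta> j \<omega>) (?N d))"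
    show ?case
    proof (intro allI impI, elim conjE)
      fix K assume "compact K" "K \<subseteq> D0"
      then obtain \<rho> where \<rho>: "0 \<le> \<rho>" "\<rho> < 1" and K: "K \<subseteq> sphere_chart ` cball 0 \<rho>"
        using compact_subset_D0 by blast
      have ev_P: "\<forall>\<^sub>F d in at_right (0::real). particle (P d)"
        unfolding eventually_at_right_field by (rule exI[of _ 1]) (use assms(6) in auto)
      have "uniform_limit (cball 0 \<rho>) (\<lambda>d x. sphere_chart (disk_cluster (P d) (\<lambda>j. \<theta> j \<omega>) (?N d) x))
         (\<lambda>x. sphere_chart (disk_map (f T) x)) (at_right 0)"
      proof (rule uniform_limit_sphere_chart)
        show "uniform_limit (cball 0 \<rho>) (\<lambda>d. disk_cluster (P d) (\<lambda>j. \<theta> j \<omega>) (?N d)) (disk_map (f T)) (at_right 0)"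
          by (rule disk_cluster_converges[OF \<nu> LD _ assms(6,7,8) \<rho>]) (use elim in auto)
        show "disk_map (f T) x \<in> cball 0 1" if "x \<in> cball 0 \<rho>" for x
          using loewner_disk.F_bound[OF LD, of T x] that assms(8) \<rho> by simp
        show "\<forall>\<^sub>F d in at_right 0. \<forall>x\<in>cball 0 \<rho>. disk_cluster (P d) (\<lambda>j. \<theta> j \<omega>) (?N d) x \<in> cball 0 1"
          using ev_P
        proof eventually_elim
          case (elim d)
          show ?case using norm_disk_cluster_less[OF elim] \<rho> by (force intro: less_imp_le)
        qed
      qed
      then have lim: "uniform_limit (cball 0 \<rho>) (\<lambda>d x. ?\<Phi> d (sphere_chart x)) (\<lambda>x. sphere_map (f T) (sphere_chart x)) (at_right 0)"
      proof (rule uniform_limit_cong[THEN iffD1, rotated 2])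
        show "\<forall>\<^sub>F d in at_right 0. \<forall>x\<in>cball 0 \<rho>. sphere_chart (disk_cluster (P d) (\<lambda>j. \<theta> j \<omega>) (?N d) x) = ?\<Phi> d (sphere_chart x)"
          using ev_P
        proof eventually_elim
          case (elim d)
          show ?case using sphere_map_cluster[OF elim] \<rho> by simp
        qed
        fix x :: complex assume x: "x \<in> cball 0 \<rho>"
        show "sphere_chart (disk_map (f T) x) = sphere_map (f T) (sphere_chart x)"
        proof (rule sphere_map_chart[symmetric])
          assume "x \<noteq> 0"
          then show "f T (inverse x) \<noteq> 0"
            using x \<rho> assms(8) by (intro f_nz) (auto simp: norm_inverse one_less_inverse_iff)
        qed
      qed
      show "uniform_limit K ?\<Phi> (sphere_map (f T)) (at_right 0)"
      proof (rule uniform_limitI)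
        fix e :: real assume "e > 0"
        from uniform_limitD[OF lim this]
        show "\<forall>\<^sub>F d in at_right 0. \<forall>p\<in>K. dist (?\<Phi> d p) (sphere_map (f T) p) < e"
          by eventually_elim (use K in blast)
      qed
    qed
  qed
qed

end
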